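(* Assume there is $\theta^*\in\Theta$ such that for each $\theta\in\Theta$ $$\mathbb{E}^\theta_1\Big[\log\tfrac{f_{\theta^*}(X_1)}{f_0(X_1)}\Big]=D(f_\theta\,\|\,f_0)-D(f_\theta\,\|\,f_{\theta^*})>0 .$$ Suppose that the GCuSum algorithm, with some choice of thresholds $A=A_\alpha$, is uniformly asymptotically optimal (over $\theta\in\Theta$, as $\alpha\to0$) for the parametric family $\{f_\theta\}_{\theta\in\Theta}$ for Problem P (respectively Problem L) with $\beta=1$. Then, for each $\beta\in[0,1]$ and any $\mu>0$ and $0\le h<\infty$ chosen so that the $\mathsf{PDC}$ constraint $\beta$ is met, the GDECuSum algorithm with parameters $\mu,h$ and thresholds $A_\alpha$ is also uniformly asymptotically optimal for Problem P (respectively Problem L) with that $\beta$, as $\alpha\to0$.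
   Context: **Model.** $\{X_n\}_{n\ge1}$ are independent random variables; $X_n$ has density $f_0$ for $n<\gamma$ and density $f_\theta$ for $n\ge\gamma$, where $\gamma\ge1$ and $\theta\in\Theta$ are unknown and $f_\theta\ne f_0$ for all $\theta\in\Theta$. $\mathbb{P}^\theta_\gamma,\mathbb{E}^\theta_\gamma$ denote the corresponding probability and expectation; $\mathbb{P}_\infty,\mathbb{E}_\infty$ correspond to no change (all $X_n$ i.i.d. with density $f_0$). $D(p\|q)$ is the Kullback–Leibler divergence; $D(f_\theta\|f_0)=\mathbb{E}^\theta_1[\log\frac{f_\theta(X_1)}{f_0(X_1)}]$ and $D(f_0\|f_\theta)=-\mathbb{E}_\infty[\log\frac{f_\theta(X_1)}{f_0(X_1)}]$ are assumed finite and positive for every $\theta\in\Theta$. **Policies.** $S_n\in\{0,1\}$ indicates whether $X_n$ is used for decision making; $S_n$ is a function of $\mathcal{I}_{n-1}$, where $\mathcal{I}_n=\{X_1^{(S_1)},\dots,X_n^{(S_n)}\}$ and $X_k^{(S_k)}=X_k$ if $S_k=1$, while $X_k$ is absent if $S_k=0$. A policy $\Psi$ consists of the control maps producing $S_n$ and a stopping time $\tau$ with respect to $\{\mathcal{I}_n\}$; a policy is denoted by its stopping time. **Metrics.** $\mathsf{FAR}(\Psi)=1/\mathbb{E}_\infty[\tau]$; $\mathsf{PDC}(\Psi)=\limsup_{\gamma\to\infty}\mathbb{E}_\infty\big[\frac1\gamma\sum_{n=1}^{\gamma-1}S_n\big]$; $\mathsf{CADD}^\theta(\Psi)=\sup_{\gamma\ge1}\mathbb{E}^\theta_\gamma[\tau-\gamma\mid\tau\ge\gamma]$;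 $\mathsf{WADD}^\theta(\Psi)=\sup_{\gamma\ge1}\operatorname{ess\,sup}\mathbb{E}^\theta_\gamma[(\tau-\gamma)^+\mid\mathcal{I}_{\gamma-1}]$, where $x^+=\max\{0,x\}$. **Problems.** Given $0\le\alpha,\beta\le1$. Problem P: minimize $\mathsf{CADD}^\theta(\Psi)$ over policies $\Psi$ subject to $\mathsf{FAR}(\Psi)\le\alpha$ and $\mathsf{PDC}(\Psi)\le\beta$. Problem L: the same with $\mathsf{WADD}^\theta$ in place of $\mathsf{CADD}^\theta$. For fixed $\beta$, a family of policies $\{\Psi_\alpha\}$ is *uniformly asymptotically optimal* for one of these problems, as $\alpha\to0$, if each $\Psi_\alpha$ satisfies the two constraints and, for each $\theta\in\Theta$, the delay metric of $\Psi_\alpha$ equals $(1+o(1))$ times the infimum of that delay metric over all policies satisfying the two constraints, as $\alpha\to0$. **GCuSum.** All samples are used ($S_n=1$ for all $n$), $G_n=\max_{1\le k\le n}\sup_{\theta\in\Theta}\sum_{i=k}^n\log\frac{f_\theta(X_i)}{f_0(X_i)}$, and $\tau_{\mathrm{GC}}=\inf\{n\ge1:G_n\ge A\}$. **GDECuSum.** Set $W_0(\theta^* )=0$. For $n\ge1$: if $W_{n-1}(\theta^* )\ge0$, then $S_n=1$ and $W_n(\theta^* )=\max\{-h,\;W_{n-1}(\theta^* )+\log\frac{f_{\theta^*}(X_n)}{f_0(X_n)}\}$; if $W_{n-1}(\theta^* )<0$, then $S_n=0$ and $W_n(\theta^* )=\min\{0,W_{n-1}(\theta^* )+\mu\}$.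 The sequence $S_n$ is generated by this recursion for all $n$ (so $\mathsf{PDC}$ does not depend on the threshold). With the convention $\frac{f_\theta(X_i^{(S_i)})}{f_0(X_i^{(S_i)})}=1$ if $S_i=0$, put $\bar G_n=\max_{1\le k\le n}\sup_{\theta\in\Theta}\sum_{i=k}^n\log\frac{f_\theta(X_i^{(S_i)})}{f_0(X_i^{(S_i)})}$ and $\tau_{\mathrm{GD}}=\inf\{n\ge1:\bar G_n\ge A\}$.
   Formalization: The thresholds A_α are assumed positive for all 0<α≤1; this is automatic for small α, but with A_α≤0 at larger α GDECuSum alarms at its first skipped sample and can violate the FAR constraint that GCuSum meets. *)

theory Defs
  imports "HOL-Probability.Probability"
begin

text \<open>
  Observations take values in a measure space \<open>M\<close> and all densities are taken with respect
  to \<open>M\<close>. The sample space is the space of sequences \<open>\<omega> :: nat \<Rightarrow> 'a\<close>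
  with \<open>X\<^sub>n(\<omega>) = \<omega> n\<close> for \<open>n \<ge> 1\<close>; the coordinate
  \<open>\<omega> 0\<close> is a dummy that no policy can observe.
\<close>

definition is_density :: "'a measure \<Rightarrow> ('a \<Rightarrow> real) \<Rightarrow> bool" where
  "is_density M p \<longleftrightarrow>
     p \<in> borel_measurable M \<and> (\<forall>x\<in>space M. 0 \<le> p x) \<and> (\<integral>\<^sup>+x. ennreal (p x) \<partial>M) = 1"

abbreviation dens :: "'a measure \<Rightarrow> ('a \<Rightarrow> real) \<Rightarrow> 'a measure" where
  "dens M p \<equiv> density M (\<lambda>x. ennreal (p x))"

definition no_change :: "'a measure \<Rightarrow> ('a \<Rightarrow> real) \<Rightarrow> (nat \<Rightarrow> 'a) measure" where
  "no_change M p = (\<Pi>\<^sub>M n\<in>UNIV. dens M p)"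

definition change_at :: "'a measure \<Rightarrow> ('a \<Rightarrow> real) \<Rightarrow> ('a \<Rightarrow> real) \<Rightarrow> nat \<Rightarrow> (nat \<Rightarrow> 'a) measure" where
  "change_at M p q \<gamma> = (\<Pi>\<^sub>M n\<in>UNIV. if n < \<gamma> then dens M p else dens M q)"

text \<open>
  \<open>KL M p q\<close> is \<open>D(p\<parallel>q)\<close>; the library puts the reference measure first.
  Its value is a real number that is meaningful only when the divergence is finite, which is
  what \<open>KL_finite\<close> says (the negative part of the integrand is always integrable).
\<close>

definition KL :: "'a measure \<Rightarrow> ('a \<Rightarrow> real) \<Rightarrow> ('a \<Rightarrow> real) \<Rightarrow> real" where
  "KL M p q = KL_divergence (exp 1) (dens M q) (dens M p)"

definition KL_finite :: "'a measure \<Rightarrow> ('a \<Rightarrow> real) \<Rightarrow> ('a \<Rightarrow> real) \<Rightarrow> bool" where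
  "KL_finite M p q \<longleftrightarrow>
     absolutely_continuous (dens M q) (dens M p) \<and>
     integrable (dens M p) (entropy_density (exp 1) (dens M q) (dens M p))"

definition qcd_model ::
  "'a measure \<Rightarrow> ('a \<Rightarrow> real) \<Rightarrow> ('t \<Rightarrow> 'a \<Rightarrow> real) \<Rightarrow> 't set \<Rightarrow> bool" where
  "qcd_model M f0 f \<Theta> \<longleftrightarrow>
     sigma_finite_measure M \<and> is_density M f0 \<and>
     (\<forall>\<theta>\<in>\<Theta>. is_density M (f \<theta>) \<and> f \<theta> \<noteq> f0 \<and>
        KL_finite M (f \<theta>) f0 \<and> 0 < KL M (f \<theta>) f0 \<and>
        KL_finite M f0 (f \<theta>) \<and> 0 < KL M f0 (f \<theta>))"

text \<open>
  The log-likelihood ratio \<open>log (q x / p x)\<close> with \<open>log 0 = -\<infinity>\<close>. The value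
  \<open>-\<infinity>\<close> matters because suprema over an uncountable parameter set are taken
  pointwise, whereas \<open>ln 0 = 0\<close> in the library.
\<close>

definition llr :: "('a \<Rightarrow> real) \<Rightarrow> ('a \<Rightarrow> real) \<Rightarrow> 'a \<Rightarrow> ereal" where
  "llr p q x = (if q x = 0 then -\<infinity> else if p x = 0 then \<infinity> else ereal (ln (q x / p x)))"

text \<open>
  A policy is a pair \<open>(S, \<tau>)\<close>: \<open>S n \<omega>\<close> states that \<open>X\<^sub>n\<close> is
  used (\<open>S\<^sub>n = 1\<close>). \<open>observed M S t\<close> is the sigma-algebra generated by
  the absent-or-present observations \<open>X\<^sub>k\<close>, \<open>1 \<le> k \<le> t\<close>, i.e. by
  \<open>S\<^sub>k\<close> and by \<open>X\<^sub>k\<close> on the event \<open>S\<^sub>k = 1\<close>. The index set is \<open>enat\<close>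
  because stopping times may be infinite.
\<close>

type_synonym 'a control = "nat \<Rightarrow> (nat \<Rightarrow> 'a) \<Rightarrow> bool"
type_synonym 'a policy = "'a control \<times> ((nat \<Rightarrow> 'a) \<Rightarrow> enat)"

definition observed :: "'a measure \<Rightarrow> 'a control \<Rightarrow> enat \<Rightarrow> (nat \<Rightarrow> 'a) measure" where
  "observed M S t =
     (let \<Omega> = space (\<Pi>\<^sub>M n\<in>(UNIV::nat set). M) in
      sigma \<Omega>
       ({{\<omega>\<in>\<Omega>. S k \<omega>} | k. 1 \<le> k \<and> enat k \<le> t} \<union>
        {{\<omega>\<in>\<Omega>. S k \<omega> \<and> \<omega> k \<in> B} | k B. 1 \<le> k \<and> enat k \<le> t \<and> B \<in> sets M}))"

definition is_policy :: "'a measure \<Rightarrow> 'a policy \<Rightarrow> bool" where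
  "is_policy M \<Psi> = (case \<Psi> of (S, \<tau>) \<Rightarrow>
     (\<forall>n\<ge>1. Measurable.pred (observed M S (enat (n - 1))) (S n)) \<and>
     stopping_time (observed M S) \<tau> \<and>
     (\<forall>\<omega>\<in>space (\<Pi>\<^sub>M n\<in>(UNIV::nat set). M). 1 \<le> \<tau> \<omega>))"

definition FAR :: "'a measure \<Rightarrow> ('a \<Rightarrow> real) \<Rightarrow> 'a policy \<Rightarrow> ennreal" where
  "FAR M f0 \<Psi> = 1 / (\<integral>\<^sup>+\<omega>. ennreal_of_enat (snd \<Psi> \<omega>) \<partial>no_change M f0)"

definition PDC :: "'a measure \<Rightarrow> ('a \<Rightarrow> real) \<Rightarrow> 'a control \<Rightarrow> ennreal" where
  "PDC M f0 S = limsup (\<lambda>\<gamma>.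
     \<integral>\<^sup>+\<omega>. ennreal (1 / real \<gamma> * (\<Sum>n=1..<\<gamma>. of_bool (S n \<omega>))) \<partial>no_change M f0)"

text \<open>
  Subtraction on \<open>ennreal\<close> is truncated at 0, so \<open>\<tau> - \<gamma>\<close> is
  \<open>(\<tau> - \<gamma>)\<^sup>+\<close> below. In \<open>CADD\<close>, a change point \<open>\<gamma>\<close> for which the event
  \<open>\<tau> \<ge> \<gamma>\<close> has probability 0 contributes \<open>0 / 0 = 0\<close>, i.e. is ignored by the supremum.
\<close>

definition CADD ::
  "'a measure \<Rightarrow> ('a \<Rightarrow> real) \<Rightarrow> ('a \<Rightarrow> real) \<Rightarrow> 'a policy \<Rightarrow> ennreal" where
  "CADD M f0 f1 \<Psi> = (case \<Psi> of (S, \<tau>) \<Rightarrow>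
     SUP \<gamma>\<in>{1..}. let P = change_at M f0 f1 \<gamma> in
       (\<integral>\<^sup>+\<omega>\<in>{\<omega>. enat \<gamma> \<le> \<tau> \<omega>}. (ennreal_of_enat (\<tau> \<omega>) - of_nat \<gamma>) \<partial>P)
       / emeasure P {\<omega>\<in>space P. enat \<gamma> \<le> \<tau> \<omega>})"

definition WADD ::
  "'a measure \<Rightarrow> ('a \<Rightarrow> real) \<Rightarrow> ('a \<Rightarrow> real) \<Rightarrow> 'a policy \<Rightarrow> ennreal" where
  "WADD M f0 f1 \<Psi> = (case \<Psi> of (S, \<tau>) \<Rightarrow>
     SUP \<gamma>\<in>{1..}. let P = change_at M f0 f1 \<gamma> in
       esssup P (nn_cond_exp P (observed M S (enat (\<gamma> - 1)))
                   (\<lambda>\<omega>. ennreal_of_enat (\<tau> \<omega>) - of_nat \<gamma>)))"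

definition feasible ::
  "'a measure \<Rightarrow> ('a \<Rightarrow> real) \<Rightarrow> real \<Rightarrow> real \<Rightarrow> 'a policy \<Rightarrow> bool" where
  "feasible M f0 \<alpha> \<beta> \<Psi> \<longleftrightarrow>
     is_policy M \<Psi> \<and> FAR M f0 \<Psi> \<le> ennreal \<alpha> \<and> PDC M f0 (fst \<Psi>) \<le> ennreal \<beta>"

text \<open>
  The argument \<open>delay\<close> is \<open>CADD M f0\<close> for Problem P and \<open>WADD M f0\<close> for
  Problem L. The term \<open>\<epsilon> \<alpha>\<close> is the \<open>o(1)\<close>.
\<close>

definition unif_asymp_optimal ::
  "'a measure \<Rightarrow> ('a \<Rightarrow> real) \<Rightarrow> ('t \<Rightarrow> 'a \<Rightarrow> real) \<Rightarrow> 't set \<Rightarrow>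
   (('a \<Rightarrow> real) \<Rightarrow> 'a policy \<Rightarrow> ennreal) \<Rightarrow> real \<Rightarrow> (real \<Rightarrow> 'a policy) \<Rightarrow> bool" where
  "unif_asymp_optimal M f0 f \<Theta> delay \<beta> \<Psi> \<longleftrightarrow>
     (\<forall>\<alpha>\<in>{0<..1}. feasible M f0 \<alpha> \<beta> (\<Psi> \<alpha>)) \<and>
     (\<forall>\<theta>\<in>\<Theta>. \<exists>\<epsilon> :: real \<Rightarrow> real. (\<epsilon> \<longlongrightarrow> 0) (at_right 0) \<and>
        (\<forall>\<^sub>F \<alpha> in at_right 0.
           delay (f \<theta>) (\<Psi> \<alpha>) =
             ennreal (1 + \<epsilon> \<alpha>) * (INF \<Phi>\<in>{\<Phi>. feasible M f0 \<alpha> \<beta> \<Phi>}. delay (f \<theta>) \<Phi>)))"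

text \<open>
  \<open>glr_time\<close> is meant for thresholds \<open>A > 0\<close>: a skipped sample contributes the term 0,
  so with \<open>A \<le> 0\<close> a policy would raise an alarm as soon as it skips a sample.
\<close>

definition glr_stat ::
  "('a \<Rightarrow> real) \<Rightarrow> ('t \<Rightarrow> 'a \<Rightarrow> real) \<Rightarrow> 't set \<Rightarrow> 'a control \<Rightarrow> nat \<Rightarrow> (nat \<Rightarrow> 'a) \<Rightarrow> ereal" where
  "glr_stat f0 f \<Theta> S n \<omega> =
     (MAX k\<in>{1..n}. SUP \<theta>\<in>\<Theta>. \<Sum>i=k..n. if S i \<omega> then llr f0 (f \<theta>) (\<omega> i) else 0)"

definition glr_time ::
  "('a \<Rightarrow> real) \<Rightarrow> ('t \<Rightarrow> 'a \<Rightarrow> real) \<Rightarrow> 't set \<Rightarrow> 'a control \<Rightarrow> real \<Rightarrow> (nat \<Rightarrow> 'a) \<Rightarrow> enat" where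
  "glr_time f0 f \<Theta> S A \<omega> = Inf {enat n | n. 1 \<le> n \<and> ereal A \<le> glr_stat f0 f \<Theta> S n \<omega>}"

definition GCuSum ::
  "('a \<Rightarrow> real) \<Rightarrow> ('t \<Rightarrow> 'a \<Rightarrow> real) \<Rightarrow> 't set \<Rightarrow> real \<Rightarrow> 'a policy" where
  "GCuSum f0 f \<Theta> A = (let S = (\<lambda>n \<omega>. True) in (S, glr_time f0 f \<Theta> S A))"

primrec de_stat ::
  "('a \<Rightarrow> real) \<Rightarrow> ('a \<Rightarrow> real) \<Rightarrow> real \<Rightarrow> real \<Rightarrow> nat \<Rightarrow> (nat \<Rightarrow> 'a) \<Rightarrow> ereal" where
  "de_stat f0 f1 \<mu> h 0 \<omega> = 0"
| "de_stat f0 f1 \<mu> h (Suc n) \<omega> =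
     (if 0 \<le> de_stat f0 f1 \<mu> h n \<omega>
      then max (- ereal h) (de_stat f0 f1 \<mu> h n \<omega> + llr f0 f1 (\<omega> (Suc n)))
      else min 0 (de_stat f0 f1 \<mu> h n \<omega> + ereal \<mu>))"

definition de_control :: "('a \<Rightarrow> real) \<Rightarrow> ('a \<Rightarrow> real) \<Rightarrow> real \<Rightarrow> real \<Rightarrow> 'a control" where
  "de_control f0 f1 \<mu> h n \<omega> \<longleftrightarrow> 0 \<le> de_stat f0 f1 \<mu> h (n - 1) \<omega>"

definition GDECuSum ::
  "('a \<Rightarrow> real) \<Rightarrow> ('t \<Rightarrow> 'a \<Rightarrow> real) \<Rightarrow> 't set \<Rightarrow> 't \<Rightarrow> real \<Rightarrow> real \<Rightarrow> real \<Rightarrow> 'a policy" where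
  "GDECuSum f0 f \<Theta> \<theta>s \<mu> h A =
     (let S = de_control f0 (f \<theta>s) \<mu> h in (S, glr_time f0 f \<Theta> S A))"

end

(*
  Write z for the sequence of samples that GDECuSum actually uses. Whether a sample is used is
  decided before it is seen, so after the change z is again i.i.d. with the post-change density
  (and without a change, i.i.d. with density f_0). Skipped samples contribute 0 to the GLR
  statistic, so GDECuSum stops exactly when GCuSum, run on z, stops. Hence without a change
  GDECuSum stops no earlier in law than GCuSum, which gives the FAR constraint. After the change
  at gamma, given the past, the delay of GDECuSum is at most E_1[tau_GC] - 1 plus the number of
  samples skipped after gamma. Each excursion of the control statistic below 0 skips a bounded
  number of samples, and the number of excursions has bounded mean because a random walk with
  positive drift stays nonnegative with positive probability. So both delay metrics of GDECuSum
  exceed E_1[tau_GC] - 1 by at most a constant K, whereas both delay metrics of GCuSum are at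
  least E_1[tau_GC] - 1 (take gamma = 1). Finally E_1[tau_GC] tends to infinity as alpha -> 0,
  so the constant is negligible, and the infimum for beta is at least the infimum for 1.
*)
theory Submission
  imports Defs
begin

section \<open>Product laws with a change point\<close>

text \<open>Three obstacles shape the proof. The parameter set is arbitrary, so the supremum in the
  GLR statistic brings no measurability of its own; measurability is drawn from GCuSum being a
  policy, and events about GDECuSum are expressed through \<open>gc_time\<close> applied to the used
  samples. The worst-case metric conditions on the whole past, so the bound on skipped samples must
  be uniform over all control states \<open>w\<close> with -h \<le> w at the change. Only
  integrability of the log-likelihood ratio is available, so the chance that its walk never descends
  is bounded below by a maximal ergodic argument instead of moment bounds. With c = ceil(h / \<mu>)
  and p < 1 the post-change probability that the walk ever falls below its start, the constant is K
  = c + c / (1 - p). The divergence of E_1[tau_GC] rests on two estimates: E_infinity[tau_GC] \<ge>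
  1 / \<alpha> forces P_infinity(tau_GC \<le> n) \<le> n \<alpha>, and truncating the likelihood
  ratio of each sample carries this smallness over to P_1.\<close>

abbreviation seqM :: "'a measure \<Rightarrow> (nat \<Rightarrow> 'a) measure" where
  "seqM M \<equiv> \<Pi>\<^sub>M n\<in>UNIV. M"

lemma prob_space_dens: "is_density M p \<Longrightarrow> prob_space (dens M p)"
  by (rule prob_spaceI) (auto simp: is_density_def emeasure_density cong: nn_integral_cong)

lemma sets_change_at[simp, measurable_cong]: "sets (change_at M p q n) = sets (seqM M)"
  unfolding change_at_def by (intro sets_PiM_cong) auto

lemma sets_no_change[simp, measurable_cong]: "sets (no_change M p) = sets (seqM M)"
  unfolding no_change_def by (intro sets_PiM_cong) auto

lemma space_change_at[simp]: "space (change_at M p q n) = space (seqM M)"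
  by (rule sets_eq_imp_space_eq) simp

lemma space_no_change[simp]: "space (no_change M p) = space (seqM M)"
  by (rule sets_eq_imp_space_eq) simp

lemma change_at_same: "change_at M p p n = no_change M p"
  by (simp add: change_at_def no_change_def)

lemma prob_space_change_at:
  "is_density M p \<Longrightarrow> is_density M q \<Longrightarrow> prob_space (change_at M p q n)"
  unfolding change_at_def by (intro prob_space_PiM) (auto intro: prob_space_dens)

lemma prob_space_no_change: "is_density M p \<Longrightarrow> prob_space (no_change M p)"
  unfolding no_change_def by (intro prob_space_PiM) (auto intro: prob_space_dens)

text \<open>The preimage of a cylinder under gluing is a rectangle: coordinates below
  \<open>n\<close> constrain the first sequence, the others constrain the second one after a shift
  by \<open>n\<close>. The change-point law thus splits into an independent past and an i.i.d.
  post-change sequence indexed from 0, which is how conditioning on the past is carried out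
  later.\<close>

lemma distr_comb_seq_change_at:
  assumes p: "is_density M p" and q: "is_density M q"
  shows "distr (no_change M p \<Otimes>\<^sub>M no_change M q) (seqM M) (\<lambda>(\<omega>, \<omega>'). comb_seq n \<omega> \<omega>') = change_at M p q n"
    (is "?D = _")
proof -
  let ?C = "\<lambda>i. if i < n then dens M p else dens M q"
  let ?I = "UNIV::nat set"
  interpret P: prob_space "dens M p" by (rule prob_space_dens[OF p])
  interpret Q: prob_space "dens M q" by (rule prob_space_dens[OF q])
  interpret PP: product_prob_space "\<lambda>_. dens M p" ?I ..
  interpret QQ: product_prob_space "\<lambda>_. dens M q" ?I ..
  interpret C: product_prob_space ?C ?I
    by (intro product_prob_spaceI) (simp add: P.prob_space_axioms Q.prob_space_axioms)
  interpret NP: prob_space "no_change M p" by (rule prob_space_no_change[OF p])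
  interpret NQ: prob_space "no_change M q" by (rule prob_space_no_change[OF q])
  have sets_pair: "sets (no_change M p \<Otimes>\<^sub>M no_change M q) = sets (seqM M \<Otimes>\<^sub>M seqM M)"
    by (intro sets_pair_measure_cong) auto
  have space_pair: "space (no_change M p \<Otimes>\<^sub>M no_change M q) = space (seqM M \<Otimes>\<^sub>M seqM M)"
    by (rule sets_eq_imp_space_eq[OF sets_pair])
  have meas: "(\<lambda>(\<omega>, \<omega>'). comb_seq n \<omega> \<omega>') \<in> measurable (no_change M p \<Otimes>\<^sub>M no_change M q) (seqM M)"
    using measurable_comb_seq by (simp add: measurable_cong_sets[OF sets_pair refl])
  show ?thesis
    unfolding change_at_def
  proof (rule C.PiM_eq)
    show "sets ?D = sets (Pi\<^sub>M UNIV ?C)"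
      using sets_change_at[of M p q n] by (simp add: change_at_def)
    fix J :: "nat set" and E assume J: "finite J" "J \<subseteq> ?I" and E0: "\<And>j. j \<in> J \<Longrightarrow> E j \<in> sets (?C j)"
    have E: "E j \<in> sets M" if "j \<in> J" for j using E0[OF that] by (auto split: if_splits)
    let ?X = "prod_emb ?I ?C J (\<Pi>\<^sub>E j\<in>J. E j)"
    have sp: "x \<in> space M" if "j \<in> J" "x \<in> E j" for j x
      using E[THEN sets.sets_into_space] that by blast
    have X: "?X = prod_emb ?I (\<lambda>_. M) J (\<Pi>\<^sub>E j\<in>J. E j)"
      unfolding prod_emb_def by (intro arg_cong2[where f="(\<inter>)"] refl PiE_cong) simp
    let ?E = "prod_emb ?I (\<lambda>_. dens M p) (J \<inter> {..<n}) (\<Pi>\<^sub>E j\<in>J \<inter> {..<n}. E j)"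
    let ?F = "prod_emb ?I (\<lambda>_. dens M q) (((+) n) -` J) (\<Pi>\<^sub>E j\<in>((+) n) -` J. E (n + j))"
    have pre: "(\<lambda>(\<omega>, \<omega>'). comb_seq n \<omega> \<omega>') -` ?X \<inter> space (seqM M \<Otimes>\<^sub>M seqM M) = ?E \<times> ?F"
      using sp J unfolding X
      by (auto simp: space_pair_measure space_PiM prod_emb_def all_conj_distrib PiE_iff
               split: split_comb_seq split_comb_seq_asm)
    have ES: "?E \<in> sets (no_change M p)" "?F \<in> sets (no_change M q)"
      unfolding no_change_def using J E
      by (auto intro!: sets_PiM_I finite_vimageI simp: inj_on_def)
    have "emeasure ?D ?X = emeasure (no_change M p \<Otimes>\<^sub>M no_change M q) (?E \<times> ?F)"
      using J E unfolding X
      by (subst emeasure_distr[OF meas]) (auto intro!: sets_PiM_I simp: space_pair pre[unfolded X])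
    also have "\<dots> = emeasure (no_change M p) ?E * emeasure (no_change M q) ?F"
      by (intro NQ.emeasure_pair_measure_Times ES)
    also have "emeasure (no_change M q) ?F = (\<Prod>j\<in>((+) n) -` J. emeasure (dens M q) (E (n + j)))"
      unfolding no_change_def using J E
      by (intro QQ.emeasure_PiM_emb) (simp_all add: finite_vimageI inj_on_def)
    also have "\<dots> = (\<Prod>j\<in>J - (J \<inter> {..<n}). emeasure (dens M q) (E j))"
    proof (rule prod.reindex_cong [of "\<lambda>x. x - n"])
      show "((+) n) -` J = (\<lambda>x. x - n) ` (J - (J \<inter> {..<n}))"
      proof (intro equalityI subsetI)
        fix x assume "x \<in> ((+) n) -` J"
        then show "x \<in> (\<lambda>x. x - n) ` (J - (J \<inter> {..<n}))"
          by (intro image_eqI[of _ _ "n + x"]) auto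
      next
        fix x assume "x \<in> (\<lambda>x. x - n) ` (J - (J \<inter> {..<n}))"
        then obtain y where y: "x = y - n" "y \<in> J - (J \<inter> {..<n})" by (rule imageE)
        then have "n \<le> y" by auto
        then show "x \<in> ((+) n) -` J" using y by simp
      qed
    qed (auto intro!: inj_onI)
    also have "\<dots> = (\<Prod>j\<in>J - (J \<inter> {..<n}). emeasure (?C j) (E j))"
      by (intro prod.cong) auto
    also have "emeasure (no_change M p) ?E = (\<Prod>j\<in>J \<inter> {..<n}. emeasure (dens M p) (E j))"
      unfolding no_change_def using J E by (intro PP.emeasure_PiM_emb) simp_all
    also have "\<dots> = (\<Prod>j\<in>J \<inter> {..<n}. emeasure (?C j) (E j))"
      by (intro prod.cong) auto
    also have "(\<Prod>j\<in>J \<inter> {..<n}. emeasure (?C j) (E j)) * (\<Prod>j\<in>J - (J \<inter> {..<n}). emeasure (?C j) (E j))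
        = (\<Prod>j\<in>J. emeasure (?C j) (E j))"
      by (subst mult.commute, rule prod.subset_diff[symmetric]) (use J in auto)
    finally show "emeasure ?D ?X = (\<Prod>j\<in>J. emeasure (?C j) (E j))" .
  qed
qed

lemma nn_integral_change_at:
  assumes p: "is_density M p" and q: "is_density M q" and F[measurable]: "F \<in> borel_measurable (seqM M)"
  shows "(\<integral>\<^sup>+\<omega>. F \<omega> \<partial>change_at M p q n) =
    (\<integral>\<^sup>+u. \<integral>\<^sup>+v. F (comb_seq n u v) \<partial>no_change M q \<partial>no_change M p)"
proof -
  interpret NQ: prob_space "no_change M q" by (rule prob_space_no_change[OF q])
  have "(\<integral>\<^sup>+\<omega>. F \<omega> \<partial>change_at M p q n)
      = (\<integral>\<^sup>+x. F (comb_seq n (fst x) (snd x)) \<partial>(no_change M p \<Otimes>\<^sub>M no_change M q))"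
    unfolding distr_comb_seq_change_at[OF p q, symmetric]
    by (subst nn_integral_distr) (auto simp: split_beta')
  also have "\<dots> = (\<integral>\<^sup>+u. \<integral>\<^sup>+v. F (comb_seq n u v) \<partial>no_change M q \<partial>no_change M p)"
    by (subst NQ.nn_integral_fst[symmetric]) auto
  finally show ?thesis .
qed

text \<open>Gluing with equal densities before and after \<open>n\<close> gives back the i.i.d. law,
  and the discarded prefix integrates to 1.\<close>

lemma nn_integral_no_change_shift:
  assumes q: "is_density M q" and F[measurable]: "F \<in> borel_measurable (seqM M)"
  shows "(\<integral>\<^sup>+\<omega>. F (\<lambda>i. \<omega> (n + i)) \<partial>no_change M q) = (\<integral>\<^sup>+\<omega>. F \<omega> \<partial>no_change M q)"
proof -
  interpret NQ: prob_space "no_change M q" by (rule prob_space_no_change[OF q])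
  have [measurable]: "(\<lambda>\<omega> i. \<omega> (n + i)) \<in> measurable (seqM M) (seqM M)"
    by (rule measurable_PiM_single') (auto simp: space_PiM PiE_iff)
  have "(\<integral>\<^sup>+\<omega>. F (\<lambda>i. \<omega> (n + i)) \<partial>change_at M q q n)
     = (\<integral>\<^sup>+u. \<integral>\<^sup>+v. F (\<lambda>i. comb_seq n u v (n + i)) \<partial>no_change M q \<partial>no_change M q)"
    by (rule nn_integral_change_at[OF q q]) measurable
  also have "\<dots> = (\<integral>\<^sup>+\<omega>. F \<omega> \<partial>no_change M q)"
    using NQ.emeasure_space_1 by (simp add: comb_seq_def)
  finally show ?thesis by (simp add: change_at_same)
qed

lemma nn_integral_no_change_component:
  assumes q: "is_density M q" and F[measurable]: "F \<in> borel_measurable M"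
  shows "(\<integral>\<^sup>+\<omega>. F (\<omega> n) \<partial>no_change M q) = (\<integral>\<^sup>+x. F x \<partial>dens M q)"
proof -
  interpret Q: prob_space "dens M q" by (rule prob_space_dens[OF q])
  interpret QQ: product_prob_space "\<lambda>_. dens M q" "UNIV::nat set" ..
  have "distr (no_change M q) (dens M q) (\<lambda>\<omega>. \<omega> n) = dens M q"
    unfolding no_change_def by (rule QQ.PiM_component) simp
  then have "(\<integral>\<^sup>+x. F x \<partial>dens M q) = (\<integral>\<^sup>+x. F x \<partial>distr (no_change M q) (dens M q) (\<lambda>\<omega>. \<omega> n))"
    by simp
  also have "\<dots> = (\<integral>\<^sup>+\<omega>. F (\<omega> n) \<partial>no_change M q)"
    by (subst nn_integral_distr) (auto simp: no_change_def)
  finally show ?thesis ..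
qed

lemma nn_integral_no_change_case_nat:
  assumes q: "is_density M q" and F[measurable]: "F \<in> borel_measurable (seqM M)"
  shows "(\<integral>\<^sup>+\<omega>. F \<omega> \<partial>no_change M q) = (\<integral>\<^sup>+x. \<integral>\<^sup>+v. F (case_nat x v) \<partial>no_change M q \<partial>dens M q)"
proof -
  interpret NQ: prob_space "no_change M q" by (rule prob_space_no_change[OF q])
  have "(\<integral>\<^sup>+\<omega>. F \<omega> \<partial>no_change M q)
     = (\<integral>\<^sup>+u. \<integral>\<^sup>+v. F (case_nat (u 0) v) \<partial>no_change M q \<partial>no_change M q)"
    using nn_integral_change_at[OF q q F, of 1] by (simp add: change_at_same)
  also have "\<dots> = (\<integral>\<^sup>+x. \<integral>\<^sup>+v. F (case_nat x v) \<partial>no_change M q \<partial>dens M q)"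
    by (rule nn_integral_no_change_component[OF q]) measurable
  finally show ?thesis .
qed

section \<open>The GLR stopping time and the deterministic skipping dynamics\<close>

lemma glr_stat_ge_iff:
  assumes "1 \<le> m"
  shows "a \<le> glr_stat f0 f \<Theta> S m \<omega> \<longleftrightarrow>
    (\<exists>k<m. a \<le> (SUP \<theta>\<in>\<Theta>. \<Sum>i=Suc k..m. if S i \<omega> then llr f0 (f \<theta>) (\<omega> i) else 0))"
proof -
  let ?g = "\<lambda>k. SUP \<theta>\<in>\<Theta>. \<Sum>i=k..m. if S i \<omega> then llr f0 (f \<theta>) (\<omega> i) else 0"
  have "a \<le> glr_stat f0 f \<Theta> S m \<omega> \<longleftrightarrow> (\<exists>y\<in>?g ` {1..m}. a \<le> y)"
    unfolding glr_stat_def using assms by (intro Max_ge_iff) auto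
  also have "\<dots> \<longleftrightarrow> (\<exists>k\<in>Suc ` {..<m}. a \<le> ?g k)"
    unfolding image_Suc_lessThan by blast
  finally show ?thesis by (simp add: Bex_def lessThan_iff)
qed

lemma glr_time_le_iff:
  "glr_time f0 f \<Theta> S A \<omega> \<le> enat n \<longleftrightarrow> (\<exists>m\<in>{1..n}. ereal A \<le> glr_stat f0 f \<Theta> S m \<omega>)"
proof
  let ?X = "{enat n | n. 1 \<le> n \<and> ereal A \<le> glr_stat f0 f \<Theta> S n \<omega>}"
  assume le: "glr_time f0 f \<Theta> S A \<omega> \<le> enat n"
  have "?X \<noteq> {}"
  proof
    assume "?X = {}"
    then have "glr_time f0 f \<Theta> S A \<omega> = \<infinity>"
      by (simp only: glr_time_def Inf_enat_def if_True simp_thms)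
    with le show False by simp
  qed
  then obtain x where "x \<in> ?X" by blast
  then have "(LEAST x. x \<in> ?X) \<in> ?X" by (rule LeastI)
  then have "glr_time f0 f \<Theta> S A \<omega> \<in> ?X"
    using \<open>?X \<noteq> {}\<close> by (simp only: glr_time_def Inf_enat_def if_False)
  then obtain m where "glr_time f0 f \<Theta> S A \<omega> = enat m" "1 \<le> m" "ereal A \<le> glr_stat f0 f \<Theta> S m \<omega>"
    by blast
  then show "\<exists>m\<in>{1..n}. ereal A \<le> glr_stat f0 f \<Theta> S m \<omega>"
    using le by (intro bexI[of _ m]) simp_all
next
  assume "\<exists>m\<in>{1..n}. ereal A \<le> glr_stat f0 f \<Theta> S m \<omega>"
  then obtain m where m: "m \<in> {1..n}" "ereal A \<le> glr_stat f0 f \<Theta> S m \<omega>" by blast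
  have "glr_time f0 f \<Theta> S A \<omega> \<le> enat m"
    unfolding glr_time_def using m by (intro Inf_lower) auto
  also have "\<dots> \<le> enat n" using m by simp
  finally show "glr_time f0 f \<Theta> S A \<omega> \<le> enat n" .
qed

text \<open>Windows are written half-open, from \<open>k\<close> exclusive to \<open>m\<close>
  inclusive, so that counting used samples maps them to windows of the same shape. The condition
  \<open>k < m\<close> also rules out \<open>m = 0\<close>, where the maximum would range over an
  empty set.\<close>

lemma glr_time_le_window:
  "glr_time f0 f \<Theta> S A \<omega> \<le> enat n \<longleftrightarrow>
    (\<exists>m\<le>n. \<exists>k<m. ereal A \<le> (SUP \<theta>\<in>\<Theta>. \<Sum>i=Suc k..m. if S i \<omega> then llr f0 (f \<theta>) (\<omega> i) else 0))"
proof -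
  have "(m \<in> {1..n} \<and> ereal A \<le> glr_stat f0 f \<Theta> S m \<omega>) \<longleftrightarrow>
    (m \<le> n \<and> (\<exists>k<m. ereal A \<le> (SUP \<theta>\<in>\<Theta>. \<Sum>i=Suc k..m. if S i \<omega> then llr f0 (f \<theta>) (\<omega> i) else 0)))" for m
  proof (cases "1 \<le> m")
    case True
    then show ?thesis by (simp only: glr_stat_ge_iff atLeastAtMost_iff simp_thms)
  qed simp
  then show ?thesis unfolding glr_time_le_iff Bex_def by simp
qed

lemma glr_time_ge_1: "1 \<le> glr_time f0 f \<Theta> S A \<omega>"
  unfolding glr_time_def by (rule Inf_greatest) (auto simp: one_enat_def)

lemma enat_le_by_nat: "(\<And>n. y \<le> enat n \<Longrightarrow> x \<le> enat n) \<Longrightarrow> x \<le> y"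
  by (cases y) auto

lemma glr_stat_cong:
  assumes "\<And>i. 1 \<le> i \<Longrightarrow> i \<le> n \<Longrightarrow> S i \<omega> = S' i \<omega>' \<and> (S i \<omega> \<longrightarrow> \<omega> i = \<omega>' i)"
  shows "glr_stat f0 f \<Theta> S n \<omega> = glr_stat f0 f \<Theta> S' n \<omega>'"
  unfolding glr_stat_def
proof (intro arg_cong[where f=Max] image_cong SUP_cong sum.cong refl)
  fix k \<theta> i
  assume "k \<in> {1..n}" "i \<in> {k..n}"
  then show "(if S i \<omega> then llr f0 (f \<theta>) (\<omega> i) else 0) = (if S' i \<omega>' then llr f0 (f \<theta>) (\<omega>' i) else 0)"
    using assms[of i] by auto
qed

lemma glr_time_cong:
  assumes "\<And>i. 1 \<le> i \<Longrightarrow> S i \<omega> = S' i \<omega>' \<and> (S i \<omega> \<longrightarrow> \<omega> i = \<omega>' i)"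
  shows "glr_time f0 f \<Theta> S A \<omega> = glr_time f0 f \<Theta> S' A \<omega>'"
proof -
  have "glr_stat f0 f \<Theta> S n \<omega> = glr_stat f0 f \<Theta> S' n \<omega>'" for n
    using assms by (intro glr_stat_cong) blast
  then show ?thesis by (simp only: glr_time_def)
qed

text \<open>Forgetting the first \<open>n\<close> samples only removes windows from the maximum, so
  the restarted test cannot alarm earlier.\<close>

lemma glr_time_le_shift:
  assumes "\<And>i. 1 \<le> i \<Longrightarrow> S (n + i) \<omega> = S' i x \<and> (S' i x \<longrightarrow> \<omega> (n + i) = x i)"
  shows "glr_time f0 f \<Theta> S A \<omega> \<le> enat n + glr_time f0 f \<Theta> S' A x"
proof (cases "glr_time f0 f \<Theta> S' A x")
  case (enat m)
  then have "glr_time f0 f \<Theta> S' A x \<le> enat m" by simp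
  then obtain j k where j: "j \<le> m" "k < j"
    and ge: "ereal A \<le> (SUP \<theta>\<in>\<Theta>. \<Sum>i=Suc k..j. if S' i x then llr f0 (f \<theta>) (x i) else 0)"
    unfolding glr_time_le_window by blast
  have "(\<Sum>i=Suc (n + k)..n + j. if S i \<omega> then llr f0 (f \<theta>) (\<omega> i) else 0)
      = (\<Sum>i=Suc k..j. if S' i x then llr f0 (f \<theta>) (x i) else 0)" for \<theta>
  proof -
    have "(\<Sum>i=Suc (n + k)..n + j. if S i \<omega> then llr f0 (f \<theta>) (\<omega> i) else 0)
      = (\<Sum>i=Suc k..j. if S (n + i) \<omega> then llr f0 (f \<theta>) (\<omega> (n + i)) else 0)"
      using sum.shift_bounds_cl_nat_ivl[of "\<lambda>i. if S i \<omega> then llr f0 (f \<theta>) (\<omega> i) else 0" "Suc k" n j]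
      by (simp add: add.commute cong: if_cong)
    also have "\<dots> = (\<Sum>i=Suc k..j. if S' i x then llr f0 (f \<theta>) (x i) else 0)"
      using assms by (intro sum.cong) auto
    finally show ?thesis .
  qed
  with ge have "ereal A \<le> (SUP \<theta>\<in>\<Theta>. \<Sum>i=Suc (n + k)..n + j. if S i \<omega> then llr f0 (f \<theta>) (\<omega> i) else 0)"
    by (simp only:)
  with j have "glr_time f0 f \<Theta> S A \<omega> \<le> enat (n + m)"
    unfolding glr_time_le_window by (intro exI[of _ "n + j"] conjI exI[of _ "n + k"]) auto
  then show ?thesis by (simp add: enat)
qed simp

text \<open>
  Skipped samples contribute nothing, so up to re-indexing by the number \<open>N\<close> of used samples
  the statistic only sees the sequence \<open>z\<close> of used samples. The threshold must be positive
  because a window without used samples has statistic 0.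
\<close>

lemma glr_time_selected:
  assumes A: "0 < A" and \<Theta>: "\<Theta> \<noteq> {}"
    and N0: "N 0 = 0" and NS: "\<And>i. N (Suc i) = (if S (Suc i) \<omega> then Suc (N i) else N i)"
    and z: "\<And>i. 1 \<le> i \<Longrightarrow> i \<le> n \<Longrightarrow> S i \<omega> \<Longrightarrow> z (N i) = \<omega> i"
  shows "glr_time f0 f \<Theta> S A \<omega> \<le> enat n \<longleftrightarrow> glr_time f0 f \<Theta> (\<lambda>_ _. True) A z \<le> enat (N n)"
proof -
  have N_mono: "N k \<le> N m" if "k \<le> m" for k m
    using that by (rule lift_Suc_mono_le[rotated]) (simp add: NS)
  \<comment> \<open>The count grows in steps of at most 1, so it takes every value up to
    \<open>N n\<close>; this pulls a window of \<open>z\<close> back to a window of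
    \<open>\<omega>\<close>.\<close>
  have N_surj: "\<exists>m\<le>n. N m = j" if "j \<le> N n" for j n
    using that
  proof (induction n)
    case (Suc n)
    then show ?case by (cases "j \<le> N n") (auto simp: NS le_Suc_eq split: if_splits)
  qed (simp add: N0)
  have sum_eq: "(\<Sum>i=Suc k..m. if S i \<omega> then llr f0 (f \<theta>) (\<omega> i) else 0)
      = (\<Sum>j=Suc (N k)..N m. llr f0 (f \<theta>) (z j))" if "k \<le> m" "m \<le> n" for k m \<theta>
    using that
  proof (induction m rule: dec_induct)
    case (step m)
    then show ?case using N_mono[of k m] z[of "Suc m"] by (auto simp: NS)
  qed simp
  show ?thesis
  proof
    assume "glr_time f0 f \<Theta> S A \<omega> \<le> enat n"
    then obtain m k where m: "m \<le> n" "k < m"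
      and ge: "ereal A \<le> (SUP \<theta>\<in>\<Theta>. \<Sum>i=Suc k..m. if S i \<omega> then llr f0 (f \<theta>) (\<omega> i) else 0)"
      unfolding glr_time_le_window by blast
    have ge': "ereal A \<le> (SUP \<theta>\<in>\<Theta>. \<Sum>j=Suc (N k)..N m. llr f0 (f \<theta>) (z j))"
      using ge m by (simp only: sum_eq less_imp_le)
    have "N k < N m"
    proof (rule ccontr)
      assume "\<not> N k < N m"
      then have "(SUP \<theta>\<in>\<Theta>. \<Sum>j=Suc (N k)..N m. llr f0 (f \<theta>) (z j)) = 0"
        using \<Theta> by simp
      with ge' A show False by simp
    qed
    then show "glr_time f0 f \<Theta> (\<lambda>_ _. True) A z \<le> enat (N n)"
      unfolding glr_time_le_window if_True using N_mono[OF m(1)] ge' by blast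
  next
    assume "glr_time f0 f \<Theta> (\<lambda>_ _. True) A z \<le> enat (N n)"
    then obtain j i where j: "j \<le> N n" "i < j"
      and ge: "ereal A \<le> (SUP \<theta>\<in>\<Theta>. \<Sum>i=Suc i..j. llr f0 (f \<theta>) (z i))"
      unfolding glr_time_le_window if_True by blast
    obtain m where m: "m \<le> n" "N m = j" using N_surj[OF j(1)] by auto
    obtain k where k: "k \<le> m" "N k = i" using N_surj[of i m] j m by auto
    have km: "k < m" using k m j by (metis nat_less_le)
    have "ereal A \<le> (SUP \<theta>\<in>\<Theta>. \<Sum>i=Suc k..m. if S i \<omega> then llr f0 (f \<theta>) (\<omega> i) else 0)"
      using ge m k by (simp only: sum_eq)
    then show "glr_time f0 f \<Theta> S A \<omega> \<le> enat n"
      unfolding glr_time_le_window using km m by blast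
  qed
qed

section \<open>The control statistic as a walk: ranks and positions of the used samples\<close>

locale de_walk =
  fixes L :: "'a \<Rightarrow> ereal" and \<mu> h :: real
  assumes mu: "0 < \<mu>" and h: "0 \<le> h"
begin

definition step :: "ereal \<Rightarrow> 'a \<Rightarrow> ereal" where
  "step w x = (if 0 \<le> w then max (- ereal h) (w + L x) else min 0 (w + ereal \<mu>))"

primrec state :: "ereal \<Rightarrow> (nat \<Rightarrow> 'a) \<Rightarrow> nat \<Rightarrow> ereal" where
  "state w v 0 = w"
| "state w v (Suc n) = step (state w v n) (v n)"

primrec used :: "ereal \<Rightarrow> (nat \<Rightarrow> 'a) \<Rightarrow> nat \<Rightarrow> nat" where
  "used w v 0 = 0"
| "used w v (Suc n) = (if 0 \<le> state w v n then Suc (used w v n) else used w v n)"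

text \<open>
  Started in state \<open>w\<close>, \<open>skips w\<close> samples are skipped before the first used one,
  which leaves the statistic in state \<open>max 0 w\<close>. This makes \<open>selected i w v\<close>, the \<open>i\<close>-th used
  sample, and \<open>skipped i w v\<close>, the number of samples skipped before it, recursive in \<open>i\<close> from the
  front, which is the recursion that matches the i.i.d. law. Indices start at 0.
\<close>

definition skips :: "ereal \<Rightarrow> nat" where
  "skips w = (if 0 \<le> w then 0 else nat \<lceil>- real_of_ereal w / \<mu>\<rceil>)"

definition observe :: "ereal \<Rightarrow> 'a \<Rightarrow> ereal" where
  "observe w x = max (- ereal h) (max 0 w + L x)"

primrec selected :: "nat \<Rightarrow> ereal \<Rightarrow> (nat \<Rightarrow> 'a) \<Rightarrow> 'a" where
  "selected 0 w v = v (skips w)"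
| "selected (Suc i) w v = selected i (observe w (v (skips w))) (\<lambda>j. v (Suc (skips w) + j))"

primrec skipped :: "nat \<Rightarrow> ereal \<Rightarrow> (nat \<Rightarrow> 'a) \<Rightarrow> nat" where
  "skipped 0 w v = skips w"
| "skipped (Suc i) w v = skips w + skipped i (observe w (v (skips w))) (\<lambda>j. v (Suc (skips w) + j))"

text \<open>\<open>state\<close> and \<open>used\<close> grow at the back of the sequence, whereas
  \<open>selected\<close> and \<open>skipped\<close> peel samples off its front; this lemma and the
  next reconcile the two recursions.\<close>

lemma state_front: "state w v (Suc n) = state (step w (v 0)) (\<lambda>i. v (Suc i)) n"
  by (induction n) auto

lemma used_front:
  "used w v (Suc n) = (if 0 \<le> w then 1 else 0) + used (step w (v 0)) (\<lambda>i. v (Suc i)) n"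
  by (induction n) (auto simp: state_front simp del: state.simps(2))

lemma skips_nonneg: "0 \<le> w \<Longrightarrow> skips w = 0"
  by (simp add: skips_def)

text \<open>A skipped step raises the state by \<mu>, capped at 0, so the ceiling of -w / \<mu>
  drops by exactly 1. The state -\<infinity> is excluded: it would never recover, while
  \<open>real_of_ereal\<close> sends it to 0 and \<open>skips\<close> would report no skips.\<close>

lemma skips_negative:
  assumes "w < 0" "w \<noteq> -\<infinity>"
  shows "skips w = Suc (skips (step w x))"
proof -
  from assms obtain r where w: "w = ereal r" "r < 0" by (cases w) auto
  show ?thesis
  proof (cases "r + \<mu> < 0")
    case True
    have e: "- (r + \<mu>) / \<mu> = - r / \<mu> - 1" using mu by (simp add: field_simps)
    have "0 < - (r + \<mu>) / \<mu>" using True mu by (intro divide_pos_pos) auto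
    then have "0 < \<lceil>- (r + \<mu>) / \<mu>\<rceil>" by simp
    moreover have "\<lceil>- (r + \<mu>) / \<mu>\<rceil> = \<lceil>- r / \<mu>\<rceil> - 1" unfolding e by linarith
    ultimately have "nat \<lceil>- r / \<mu>\<rceil> = Suc (nat \<lceil>- (r + \<mu>) / \<mu>\<rceil>)" by linarith
    then show ?thesis using w True by (simp add: skips_def step_def min_def zero_ereal_def)
  next
    case False
    have "0 < - r / \<mu>" "- r / \<mu> \<le> 1" using False w mu by (auto simp: field_simps)
    then have "\<lceil>- r / \<mu>\<rceil> = 1" by linarith
    then show ?thesis using w False by (simp add: skips_def step_def min_def zero_ereal_def)
  qed
qed

lemma skips_bounded:
  assumes "- ereal h \<le> w"
  shows "skips w \<le> nat \<lceil>h / \<mu>\<rceil>"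
proof (cases "0 \<le> w")
  case False
  with assms obtain r where w: "w = ereal r" "r < 0" "- h \<le> r" by (cases w) auto
  have "- r / \<mu> \<le> h / \<mu>" using w mu by (intro divide_right_mono) auto
  then have "nat \<lceil>- r / \<mu>\<rceil> \<le> nat \<lceil>h / \<mu>\<rceil>" by (intro nat_mono ceiling_mono)
  then show ?thesis using w by (simp add: skips_def)
qed (simp add: skips_def)

lemma step_nonneg: "0 \<le> w \<Longrightarrow> step w x = observe w x"
  by (simp add: step_def observe_def max_absorb2)

lemma step_finite: "w \<noteq> -\<infinity> \<Longrightarrow> step w x \<noteq> -\<infinity>"
  by (cases w) (auto simp: step_def max_def min_def)

lemma observe_ge: "- ereal h \<le> observe w x"
  by (simp add: observe_def)

lemma observe_finite: "observe w x \<noteq> -\<infinity>"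
  using observe_ge[of w x] by auto

text \<open>The cap at 0 makes every run of skips end exactly at 0, so the next used sample is
  processed from 0 whether or not one skip has already taken place.\<close>

lemma observe_negative:
  assumes "w < 0"
  shows "observe (step w x) y = observe w y"
proof -
  have "step w x \<le> 0" using assms by (simp add: step_def)
  then have "max 0 (step w x) = max 0 w" using assms by (simp add: max_absorb1)
  then show ?thesis by (simp add: observe_def)
qed

lemma selected_negative:
  assumes "w < 0" "w \<noteq> -\<infinity>"
  shows "selected i w v = selected i (step w x) (\<lambda>j. v (Suc j))"
  using assms by (cases i) (simp_all add: skips_negative[of w x] observe_negative)

lemma skipped_negative:
  assumes "w < 0" "w \<noteq> -\<infinity>"
  shows "skipped i w v = Suc (skipped i (step w x) (\<lambda>j. v (Suc j)))"
  using assms by (cases i) (simp_all add: skips_negative[of w x] observe_negative)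

text \<open>\<open>used w v m\<close> counts the uses strictly before \<open>v m\<close>, which is
  the rank of \<open>v m\<close> among the used samples when ranks start at 0.\<close>

lemma selected_used:
  assumes "0 \<le> state w v m" "w \<noteq> -\<infinity>"
  shows "selected (used w v m) w v = v m"
  using assms
proof (induction m arbitrary: w v)
  case (Suc m)
  have IH: "selected (used (step w (v 0)) (\<lambda>i. v (Suc i)) m) (step w (v 0)) (\<lambda>i. v (Suc i)) = v (Suc m)"
    using Suc.prems by (intro Suc.IH) (auto simp: state_front step_finite simp del: state.simps(2))
  show ?case
  proof (cases "0 \<le> w")
    case True
    then show ?thesis
      using IH by (simp add: used_front step_nonneg skips_nonneg del: used.simps(2))
  next
    case False
    then have "w < 0" by simp
    from selected_negative[OF this Suc.prems(2), of _ v "v 0"] False IH show ?thesis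
      by (simp add: used_front del: used.simps(2))
  qed
qed (simp add: skips_nonneg)

text \<open>The used sample of rank \<open>i\<close> sits at position
  \<open>i + skipped i w v\<close>, so a prefix of length one more contains \<open>Suc i\<close>
  uses. That position is the induction measure: peeling off the first sample lowers it by 1, whether
  the sample is used or skipped.\<close>

lemma used_skipped:
  assumes "w \<noteq> -\<infinity>"
  shows "used w v (Suc (i + skipped i w v)) = Suc i"
  using assms
proof (induction "i + skipped i w v" arbitrary: i w v rule: less_induct)
  case less
  show ?case
  proof (cases "0 \<le> w")
    case True
    show ?thesis
    proof (cases i)
      case 0
      then show ?thesis using True by (simp add: skips_nonneg)
    next
      case (Suc j)
      let ?p = "j + skipped j (observe w (v 0)) (\<lambda>j. v (Suc j))"
      have "used (observe w (v 0)) (\<lambda>j. v (Suc j)) (Suc ?p) = Suc j"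
        using True Suc by (intro less.hyps) (auto simp: skips_nonneg observe_finite)
      moreover have "i + skipped i w v = Suc ?p"
        using True Suc by (simp add: skips_nonneg)
      ultimately show ?thesis
        using True Suc used_front[of w v "Suc ?p"] by (simp only: step_nonneg) simp
    qed
  next
    case False
    then have w: "w < 0" by simp
    note sk = skipped_negative[OF w less.prems, of i v "v 0"]
    have "used (step w (v 0)) (\<lambda>j. v (Suc j)) (Suc (i + skipped i (step w (v 0)) (\<lambda>j. v (Suc j)))) = Suc i"
      using sk less.prems by (intro less.hyps) (auto simp: step_finite)
    then show ?thesis
      using False sk used_front[of w v "Suc (i + skipped i (step w (v 0)) (\<lambda>j. v (Suc j)))"] by simp
  qed
qed

lemma used_le: "used w v n \<le> n"
  by (induction n) auto

end

section \<open>Law of the selected samples\<close>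

locale de_walk_model = de_walk L \<mu> h for L :: "'a \<Rightarrow> ereal" and \<mu> h :: real +
  fixes M :: "'a measure"
  assumes L_measurable[measurable]: "L \<in> borel_measurable M"
begin

text \<open>The index itself is random, because the number of skips depends on earlier samples; its
  countable range allows a case split over its values.\<close>

lemma measurable_component_at:
  assumes [measurable]: "g \<in> measurable N (seqM M)" "k \<in> measurable N (count_space (UNIV :: nat set))"
  shows "(\<lambda>x. g x (k x)) \<in> measurable N M"
  by (rule measurable_compose_countable[where f="\<lambda>n x. g x n"]) measurable

lemma measurable_shift_at:
  assumes [measurable]: "g \<in> measurable N (seqM M)" "k \<in> measurable N (count_space (UNIV :: nat set))"
  shows "(\<lambda>x j. g x (k x + j)) \<in> measurable N (seqM M)"
proof (rule measurable_PiM_single')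
  have meas: "(\<lambda>x. g x (k x + j)) \<in> measurable N M" for j
    by (rule measurable_component_at) measurable
  then show "(\<lambda>x. g x (k x + j)) \<in> measurable N M" for j .
  show "(\<lambda>x j. g x (k x + j)) \<in> space N \<rightarrow> (\<Pi>\<^sub>E i\<in>UNIV. space M)"
    using measurable_space[OF meas] by (auto simp: PiE_iff)
qed

lemma measurable_skips[measurable]: "skips \<in> measurable borel (count_space UNIV)"
  unfolding skips_def by measurable

lemma measurable_observe[measurable (raw)]:
  assumes [measurable]: "f \<in> borel_measurable N" "g \<in> measurable N M"
  shows "(\<lambda>x. observe (f x) (g x)) \<in> borel_measurable N"
  unfolding observe_def by measurable

lemma measurable_step[measurable (raw)]:
  assumes [measurable]: "f \<in> borel_measurable N" "g \<in> measurable N M"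
  shows "(\<lambda>x. step (f x) (g x)) \<in> borel_measurable N"
  unfolding step_def by measurable

lemma measurable_selected:
  assumes "f \<in> borel_measurable N" "g \<in> measurable N (seqM M)"
  shows "(\<lambda>x. selected i (f x) (g x)) \<in> measurable N M"
  using assms
proof (induction i arbitrary: f g)
  case 0
  note [measurable] = 0
  show ?case unfolding selected.simps by (rule measurable_component_at) measurable
next
  case (Suc i)
  note [measurable] = Suc.prems
  have [measurable]: "(\<lambda>x. g x (skips (f x))) \<in> measurable N M"
    by (rule measurable_component_at) measurable
  have [measurable]: "(\<lambda>x j. g x (Suc (skips (f x)) + j)) \<in> measurable N (seqM M)"
    by (rule measurable_shift_at) measurable
  show ?case unfolding selected.simps by (rule Suc.IH) measurable
qed

lemma measurable_skipped:
  assumes "f \<in> borel_measurable N" "g \<in> measurable N (seqM M)"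
  shows "(\<lambda>x. skipped i (f x) (g x)) \<in> measurable N (count_space UNIV)"
  using assms
proof (induction i arbitrary: f g)
  case 0
  note [measurable] = 0
  show ?case by simp
next
  case (Suc i)
  note [measurable] = Suc.prems
  have [measurable]: "(\<lambda>x. g x (skips (f x))) \<in> measurable N M"
    by (rule measurable_component_at) measurable
  have [measurable]: "(\<lambda>x j. g x (Suc (skips (f x)) + j)) \<in> measurable N (seqM M)"
    by (rule measurable_shift_at) measurable
  have [measurable]: "(\<lambda>x. skipped i (observe (f x) (g x (skips (f x)))) (\<lambda>j. g x (Suc (skips (f x)) + j)))
      \<in> measurable N (count_space UNIV)"
    by (rule Suc.IH) measurable
  show ?case unfolding skipped.simps by measurable
qed

lemma measurable_selected_seq[measurable]:
  "(\<lambda>v i. selected i w v) \<in> measurable (seqM M) (seqM M)"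
proof (rule measurable_PiM_single')
  have meas: "(\<lambda>v. selected i w v) \<in> measurable (seqM M) M" for i
    by (rule measurable_selected) simp_all
  then show "(\<lambda>v. selected i w v) \<in> measurable (seqM M) M" for i .
  show "(\<lambda>v i. selected i w v) \<in> space (seqM M) \<rightarrow> (\<Pi>\<^sub>E i\<in>UNIV. space M)"
    using measurable_space[OF meas] by (auto simp: PiE_iff)
qed

lemma measurable_tail[measurable]: "(\<lambda>v j. v (Suc j)) \<in> measurable (seqM M) (seqM M)"
  using measurable_shift_at[of "\<lambda>v. v" "seqM M" "\<lambda>_. Suc 0"] by simp

text \<open>From a fixed state the number of skips is deterministic, so dropping the skipped samples
  leaves the i.i.d. law unchanged. Integrating over the first used sample then puts the rest in
  state \<open>observe w x\<close>, and the induction hypothesis gives a value independent of that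
  state. This is why \<open>w\<close> is generalised.\<close>

lemma nn_integral_prod_indicator_selected:
  assumes q: "is_density M q" and E: "\<And>i. E i \<in> sets M"
  shows "(\<integral>\<^sup>+v. (\<Prod>i<n. indicator (E i) (selected i w v)) \<partial>no_change M q)
    = (\<Prod>i<n. emeasure (dens M q) (E i))"
  using E
proof (induction n arbitrary: w E)
  case 0
  interpret NQ: prob_space "no_change M q" by (rule prob_space_no_change[OF q])
  show ?case using NQ.emeasure_space_1 by simp
next
  case (Suc n)
  note [measurable] = Suc.prems
  define F where "F u = indicator (E 0) (u 0) *
    (\<Prod>i<n. indicator (E (Suc i)) (selected i (observe w (u 0)) (\<lambda>j. u (Suc j))) :: ennreal)" for u
  have head[measurable]: "(\<lambda>u. u 0) \<in> measurable (seqM M) M" by simp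
  have tail: "(\<lambda>u. selected i (observe w (u 0)) (\<lambda>j. u (Suc j))) \<in> measurable (seqM M) M" for i
    by (rule measurable_selected) measurable
  have [measurable]: "F \<in> borel_measurable (seqM M)"
    unfolding F_def using Suc.prems
    by (intro borel_measurable_times_ennreal borel_measurable_prod_ennreal
      measurable_compose[OF head borel_measurable_indicator]
      measurable_compose[OF tail borel_measurable_indicator])
  have sel: "(\<lambda>v. selected i w' v) \<in> measurable (no_change M q) M" for i w'
    using measurable_selected[of "\<lambda>_. w'" "no_change M q" "\<lambda>v. v" i] by simp
  have [measurable]: "(\<lambda>v. \<Prod>i<n. indicator (E (Suc i)) (selected i w' v) :: ennreal) \<in> borel_measurable (no_change M q)" for w'
    using Suc.prems
    by (intro borel_measurable_prod_ennreal measurable_compose[OF sel borel_measurable_indicator])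
  have "(\<integral>\<^sup>+v. (\<Prod>i<Suc n. indicator (E i) (selected i w v)) \<partial>no_change M q)
      = (\<integral>\<^sup>+v. F (\<lambda>i. v (skips w + i)) \<partial>no_change M q)"
    by (simp add: F_def prod.lessThan_Suc_shift del: prod.lessThan_Suc)
  also have "\<dots> = (\<integral>\<^sup>+v. F v \<partial>no_change M q)"
    by (rule nn_integral_no_change_shift[OF q]) measurable
  also have "\<dots> = (\<integral>\<^sup>+x. \<integral>\<^sup>+v. F (case_nat x v) \<partial>no_change M q \<partial>dens M q)"
    by (rule nn_integral_no_change_case_nat[OF q]) measurable
  also have "\<dots> = (\<integral>\<^sup>+x. indicator (E 0) x * (\<Prod>i<n. emeasure (dens M q) (E (Suc i))) \<partial>dens M q)"
    unfolding F_def using Suc.prems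
    by (intro nn_integral_cong) (simp add: nn_integral_cmult Suc.IH)
  also have "\<dots> = (\<Prod>i<Suc n. emeasure (dens M q) (E i))"
    using Suc.prems by (simp add: nn_integral_multc prod.lessThan_Suc_shift del: prod.lessThan_Suc)
  finally show ?case .
qed

text \<open>Optional skipping: whether a sample is used is decided before it is seen.\<close>

lemma distr_selected:
  assumes q: "is_density M q"
  shows "distr (no_change M q) (seqM M) (\<lambda>v i. selected i w v) = no_change M q"
    (is "?D = _")
proof -
  interpret Q: prob_space "dens M q" by (rule prob_space_dens[OF q])
  interpret QQ: product_prob_space "\<lambda>_. dens M q" "UNIV::nat set" ..
  show ?thesis
    unfolding no_change_def[of M q]
  proof (rule QQ.PiM_eq)
    show "sets (distr (Pi\<^sub>M UNIV (\<lambda>n. dens M q)) (seqM M) (\<lambda>v i. selected i w v)) = sets (\<Pi>\<^sub>M n\<in>UNIV. dens M q)"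
      using sets_no_change[of M q] by (simp add: no_change_def)
    fix J :: "nat set" and E assume J: "finite J" "J \<subseteq> UNIV" and E0: "\<And>j. j \<in> J \<Longrightarrow> E j \<in> sets (dens M q)"
    then obtain n where n: "J \<subseteq> {..<n}" by (meson finite_nat_iff_bounded)
    \<comment> \<open>Padding with the whole space extends the cylinder from \<open>J\<close> to an
      initial segment of indices.\<close>
    define E' where "E' j = (if j \<in> J then E j else space M)" for j
    have E'[measurable]: "E' j \<in> sets M" for j using E0 by (auto simp: E'_def)
    let ?X = "prod_emb UNIV (\<lambda>_. dens M q) J (\<Pi>\<^sub>E j\<in>J. E j)"
    have X: "?X \<in> sets (seqM M)"
      using sets_no_change[of M q] J E0 by (auto simp: no_change_def intro!: sets_PiM_I)
    have "emeasure ?D ?X = (\<integral>\<^sup>+v. indicator ?X (\<lambda>i. selected i w v) \<partial>no_change M q)"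
      using X by (subst nn_integral_indicator[symmetric], simp, subst nn_integral_distr) auto
    also have "\<dots> = (\<integral>\<^sup>+v. (\<Prod>i<n. indicator (E' i) (selected i w v)) \<partial>no_change M q)"
    proof (rule nn_integral_cong)
      fix v assume "v \<in> space (no_change M q)"
      then have v: "v \<in> space (seqM M)" by simp
      have sp: "selected i w v \<in> space M" for i
        using measurable_space[OF measurable_selected_seq v, of w] by (auto simp: space_PiM PiE_iff)
      have "(\<lambda>i. selected i w v) \<in> ?X \<longleftrightarrow> (\<forall>i<n. selected i w v \<in> E' i)"
        using n sp by (auto simp: prod_emb_def E'_def PiE_iff subset_eq)
      then show "indicator ?X (\<lambda>i. selected i w v) = (\<Prod>i<n. indicator (E' i) (selected i w v) :: ennreal)"
        by (auto simp: indicator_def)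
    qed
    also have "\<dots> = (\<Prod>i<n. emeasure (dens M q) (E' i))"
      by (rule nn_integral_prod_indicator_selected[OF q E'])
    also have "\<dots> = (\<Prod>i\<in>J. emeasure (dens M q) (E i))"
      using n Q.emeasure_space_1 by (intro prod.mono_neutral_cong_right) (auto simp: E'_def)
    finally show "emeasure (distr (Pi\<^sub>M UNIV (\<lambda>n. dens M q)) (seqM M) (\<lambda>v i. selected i w v)) ?X
      = (\<Prod>i\<in>J. emeasure (dens M q) (E i))"
      by (simp add: no_change_def)
  qed
qed

lemma nn_integral_selected:
  assumes q: "is_density M q" and F[measurable]: "F \<in> borel_measurable (seqM M)"
  shows "(\<integral>\<^sup>+v. F (\<lambda>i. selected i w v) \<partial>no_change M q) = (\<integral>\<^sup>+v. F v \<partial>no_change M q)"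
proof -
  have "(\<integral>\<^sup>+v. F v \<partial>distr (no_change M q) (seqM M) (\<lambda>v i. selected i w v))
      = (\<integral>\<^sup>+v. F (\<lambda>i. selected i w v) \<partial>no_change M q)"
    by (subst nn_integral_distr) auto
  then show ?thesis by (simp add: distr_selected[OF q])
qed

lemma skipped_mono: "skipped i w v \<le> skipped (Suc i) w v"
proof (induction i arbitrary: w v)
  case (Suc i)
  show ?case
    unfolding skipped.simps(2)[of "Suc i" w v] skipped.simps(2)[of i w v]
    by (intro add_left_mono Suc.IH)
qed simp

end

section \<open>Mean number of skipped samples\<close>

context
  fixes Y :: "'a \<Rightarrow> real"
begin

primrec descent :: "nat \<Rightarrow> (nat \<Rightarrow> 'a) \<Rightarrow> real" where
  "descent 0 v = 0"
| "descent (Suc n) v = max 0 (descent n (\<lambda>i. v (Suc i)) - Y (v 0))"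

lemma descent_nonneg: "0 \<le> descent n v"
  by (cases n) simp_all

lemma descent_mono: "descent n v \<le> descent (Suc n) v"
proof (induction n arbitrary: v)
  case (Suc n)
  show ?case
    unfolding descent.simps(2)[of "Suc n" v] descent.simps(2)[of n v]
    using Suc.IH[of "\<lambda>i. v (Suc i)"] by linarith
qed simp

lemma measurable_descent:
  assumes [measurable]: "Y \<in> borel_measurable M"
  shows "descent n \<in> borel_measurable (seqM M)"
proof (induction n)
  case (Suc n)
  have "(\<lambda>v j. v (Suc j)) \<in> measurable (seqM M) (seqM M)"
    by (rule measurable_PiM_single') (auto simp: PiE_iff space_PiM)
  from measurable_compose[OF this Suc.IH]
  have [measurable]: "(\<lambda>v. descent n (\<lambda>i. v (Suc i))) \<in> borel_measurable (seqM M)" .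
  show ?case unfolding descent.simps by measurable
qed simp

text \<open>
  \<open>descent n\<close> is the largest descent of the random walk with increments \<open>Y\<close> below its starting
  point. That it vanishes with positive probability is the maximal ergodic lemma, in Garsia's
  form: the mean of \<open>descent (n + 1)\<close> exceeds that of the shifted \<open>descent n\<close>, so
  \<open>Y\<close> has nonpositive mean on the event that the walk descends.
\<close>

lemma descent_integral:
  assumes q: "is_density M q" and Y: "integrable (dens M q) Y"
  shows "(\<integral>\<^sup>+v. ennreal (Y (v 0)) * indicator {v. 0 < descent (Suc n) v} v \<partial>no_change M q)
    \<le> (\<integral>\<^sup>+x. ennreal (- Y x) \<partial>dens M q)"
proof -
  have Ym[measurable]: "Y \<in> borel_measurable M" using Y by auto
  note [measurable] = measurable_descent[OF Ym]
  let ?Q = "no_change M q"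
  interpret NQ: prob_space ?Q by (rule prob_space_no_change[OF q])
  have Yneg: "(\<integral>\<^sup>+x. ennreal (- Y x) \<partial>dens M q) < \<infinity>"
    using integrableD(3)[OF Y] by (simp add: less_top)
  have tail: "(\<lambda>v j. v (Suc j)) \<in> measurable (seqM M) (seqM M)"
    by (rule measurable_PiM_single') (auto simp: PiE_iff space_PiM)
  have shift_meas: "(\<lambda>v. ennreal (descent n (\<lambda>i. v (Suc i)))) \<in> borel_measurable ?Q" for n
    using measurable_compose[OF measurable_compose[OF tail measurable_descent[OF Ym]] measurable_ennreal]
    by simp
  have neg_meas: "(\<lambda>v. ennreal (- Y (v 0))) \<in> borel_measurable ?Q" by measurable
  have neg: "(\<integral>\<^sup>+v. ennreal (- Y (v 0)) \<partial>?Q) = (\<integral>\<^sup>+x. ennreal (- Y x) \<partial>dens M q)"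
    by (rule nn_integral_no_change_component[OF q]) measurable
  have shift: "(\<integral>\<^sup>+v. ennreal (descent n (\<lambda>i. v (Suc i))) \<partial>?Q) = (\<integral>\<^sup>+v. ennreal (descent n v) \<partial>?Q)" for n
    using nn_integral_no_change_shift[OF q, of "\<lambda>v. ennreal (descent n v)" 1] by simp
  \<comment> \<open>Finiteness is what allows the mean of \<open>descent n\<close> to be cancelled
    at the end.\<close>
  have fin: "(\<integral>\<^sup>+v. ennreal (descent n v) \<partial>?Q) < \<infinity>" for n
  proof (induction n)
    case (Suc n)
    have "(\<integral>\<^sup>+v. ennreal (descent (Suc n) v) \<partial>?Q)
        \<le> (\<integral>\<^sup>+v. ennreal (descent n (\<lambda>i. v (Suc i))) + ennreal (- Y (v 0)) \<partial>?Q)"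
    proof (rule nn_integral_mono)
      fix v
      have "descent (Suc n) v \<le> descent n (\<lambda>i. v (Suc i)) + max 0 (- Y (v 0))"
        using descent_nonneg[of n "\<lambda>i. v (Suc i)"] by simp
      then have "ennreal (descent (Suc n) v) \<le> ennreal (descent n (\<lambda>i. v (Suc i)) + max 0 (- Y (v 0)))"
        by (rule ennreal_leI)
      also have "\<dots> = ennreal (descent n (\<lambda>i. v (Suc i))) + ennreal (- Y (v 0))"
        using descent_nonneg by (subst ennreal_plus) (auto simp: max_def ennreal_neg)
      finally show "ennreal (descent (Suc n) v) \<le> ennreal (descent n (\<lambda>i. v (Suc i))) + ennreal (- Y (v 0))" .
    qed
    also have "\<dots> = (\<integral>\<^sup>+v. ennreal (descent n v) \<partial>?Q) + (\<integral>\<^sup>+x. ennreal (- Y x) \<partial>dens M q)"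
      unfolding nn_integral_add[OF shift_meas neg_meas] neg shift ..
    also have "\<dots> < \<infinity>" using Suc Yneg by simp
    finally show ?case .
  qed simp
  let ?I = "indicator {v. 0 < descent (Suc n) v} :: (nat \<Rightarrow> 'a) \<Rightarrow> ennreal"
  \<comment> \<open>Here \<open>ennreal (Y (v 0))\<close> is the positive part of the first
    increment and \<open>ennreal (- Y (v 0))\<close> its negative part.\<close>
  have "(\<integral>\<^sup>+v. ennreal (descent n v) \<partial>?Q) + (\<integral>\<^sup>+v. ennreal (Y (v 0)) * ?I v \<partial>?Q)
     \<le> (\<integral>\<^sup>+v. ennreal (descent (Suc n) v) \<partial>?Q) + (\<integral>\<^sup>+v. ennreal (Y (v 0)) * ?I v \<partial>?Q)"
    by (intro add_right_mono nn_integral_mono ennreal_leI descent_mono)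
  also have "\<dots> = (\<integral>\<^sup>+v. ennreal (descent (Suc n) v) + ennreal (Y (v 0)) * ?I v \<partial>?Q)"
    by (rule nn_integral_add[symmetric]) measurable
  also have "\<dots> \<le> (\<integral>\<^sup>+v. ennreal (descent n (\<lambda>i. v (Suc i))) + ennreal (- Y (v 0)) \<partial>?Q)"
  proof (rule nn_integral_mono)
    fix v
    show "ennreal (descent (Suc n) v) + ennreal (Y (v 0)) * ?I v
        \<le> ennreal (descent n (\<lambda>i. v (Suc i))) + ennreal (- Y (v 0))"
    proof (cases "0 < descent (Suc n) v")
      case False
      then show ?thesis by (simp add: ennreal_neg)
    next
      case True
      \<comment> \<open>On this event the maximum is attained by its second argument, so adding the
        positive part of \<open>Y (v 0)\<close> to both sides leaves the shifted descent plus the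
        negative part.\<close>
      then have eq: "descent (Suc n) v = descent n (\<lambda>i. v (Suc i)) - Y (v 0)" by (simp add: max_def split: if_splits)
      have "ennreal (descent (Suc n) v) + ennreal (Y (v 0)) = ennreal (descent (Suc n) v + max 0 (Y (v 0)))"
        using descent_nonneg[of "Suc n" v] by (subst ennreal_plus) (auto simp: max_def ennreal_neg)
      also have "\<dots> = ennreal (descent n (\<lambda>i. v (Suc i)) + max 0 (- Y (v 0)))"
        unfolding eq by (intro arg_cong[where f=ennreal]) (simp add: max_def)
      also have "\<dots> = ennreal (descent n (\<lambda>i. v (Suc i))) + ennreal (- Y (v 0))"
        using descent_nonneg by (subst ennreal_plus) (auto simp: max_def ennreal_neg)
      finally show ?thesis using True by simp
    qed
  qed
  also have "\<dots> = (\<integral>\<^sup>+v. ennreal (descent n v) \<partial>?Q) + (\<integral>\<^sup>+x. ennreal (- Y x) \<partial>dens M q)"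
    unfolding nn_integral_add[OF shift_meas neg_meas] neg shift ..
  finally show ?thesis using fin[of n] by (auto simp: ennreal_add_left_cancel_le simp del: descent.simps)
qed

lemma descent_prob_less_1:
  assumes q: "is_density M q" and Y: "integrable (dens M q) Y" and pos: "0 < (\<integral>x. Y x \<partial>dens M q)"
  obtains p :: real where "0 \<le> p" "p < 1"
    "\<And>n. emeasure (no_change M q) {v\<in>space (seqM M). 0 < descent n v} \<le> ennreal p"
proof -
  have Ym[measurable]: "Y \<in> borel_measurable M" using Y by auto
  note [measurable] = measurable_descent[OF Ym]
  let ?Q = "no_change M q"
  interpret NQ: prob_space ?Q by (rule prob_space_no_change[OF q])
  define E where "E n = {v\<in>space (seqM M). 0 < descent n v}" for n
  have E[measurable]: "E n \<in> sets ?Q" for n unfolding E_def by measurable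
  have inc: "incseq E"
    unfolding E_def using descent_mono by (intro incseq_SucI) (auto intro: less_le_trans)
  have U: "(\<Union>n. E n) \<in> sets ?Q" using E by (intro sets.countable_nat_UN) auto
  \<comment> \<open>The probability of ever descending; the events \<open>E n\<close> increase, so
    one \<open>p\<close> serves every horizon.\<close>
  define p where "p = measure ?Q (\<Union>n. E n)"
  \<comment> \<open>If the walk descended almost surely, letting n grow in
    \<open>descent_integral\<close> would bound the mean of the positive part of \<open>Y\<close> by
    that of its negative part, against the positive mean.\<close>
  have "p \<noteq> 1"
  proof
    assume "p = 1"
    then have "AE v in ?Q. v \<in> (\<Union>n. E n)"
      using NQ.AE_in_set_eq_1[OF U] unfolding p_def by (simp only: simp_thms)
    have "(\<integral>\<^sup>+x. ennreal (Y x) \<partial>dens M q) = (\<integral>\<^sup>+v. ennreal (Y (v 0)) \<partial>?Q)"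
      by (rule nn_integral_no_change_component[OF q, symmetric]) measurable
    also have "\<dots> = (\<integral>\<^sup>+v. (SUP n. ennreal (Y (v 0)) * indicator (E n) v) \<partial>?Q)"
    proof (rule nn_integral_cong_AE, use \<open>AE v in ?Q. v \<in> (\<Union>n. E n)\<close> in eventually_elim)
      fix v assume "v \<in> (\<Union>n. E n)"
      then obtain n where "v \<in> E n" by auto
      then have "ennreal (Y (v 0)) \<le> (SUP n. ennreal (Y (v 0)) * indicator (E n) v)"
        by (intro SUP_upper2[of n]) auto
      moreover have "(SUP n. ennreal (Y (v 0)) * indicator (E n) v) \<le> ennreal (Y (v 0))"
        by (intro SUP_least) (auto simp: indicator_def)
      ultimately show "ennreal (Y (v 0)) = (SUP n. ennreal (Y (v 0)) * indicator (E n) v)"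
        by (rule antisym)
    qed
    also have "\<dots> = (SUP n. \<integral>\<^sup>+v. ennreal (Y (v 0)) * indicator (E n) v \<partial>?Q)"
    proof (rule nn_integral_monotone_convergence_SUP)
      show "incseq (\<lambda>n v. ennreal (Y (v 0)) * indicator (E n) v)"
        using inc by (intro incseq_SucI le_funI mult_left_mono indicator_leI) (auto simp: incseq_Suc_iff subset_eq)
    qed measurable
    also have "\<dots> \<le> (\<integral>\<^sup>+x. ennreal (- Y x) \<partial>dens M q)"
    proof (rule SUP_least)
      fix n
      have "(\<integral>\<^sup>+v. ennreal (Y (v 0)) * indicator (E n) v \<partial>?Q)
        \<le> (\<integral>\<^sup>+v. ennreal (Y (v 0)) * indicator {v. 0 < descent (Suc n) v} v \<partial>?Q)"
        using descent_mono[of n]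
        by (intro nn_integral_mono mult_left_mono indicator_leI) (auto simp: E_def intro: less_le_trans)
      also note descent_integral[OF q Y]
      finally show "(\<integral>\<^sup>+v. ennreal (Y (v 0)) * indicator (E n) v \<partial>?Q) \<le> (\<integral>\<^sup>+x. ennreal (- Y x) \<partial>dens M q)" .
    qed
    finally have le: "(\<integral>\<^sup>+x. ennreal (Y x) \<partial>dens M q) \<le> (\<integral>\<^sup>+x. ennreal (- Y x) \<partial>dens M q)" .
    have "enn2real (\<integral>\<^sup>+x. ennreal (Y x) \<partial>dens M q) \<le> enn2real (\<integral>\<^sup>+x. ennreal (- Y x) \<partial>dens M q)"
      using integrableD(3)[OF Y] by (intro enn2real_mono[OF le]) (simp add: less_top)
    with pos show False by (simp add: real_lebesgue_integral_def[OF Y])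
  qed
  then have "p < 1" using NQ.prob_le_1[of "\<Union>n. E n"] unfolding p_def by linarith
  moreover have "emeasure ?Q (E n) \<le> ennreal p" for n
    unfolding p_def NQ.emeasure_eq_measure[symmetric] using U by (intro emeasure_mono) auto
  ultimately show thesis by (intro that[of p]) (auto simp: p_def E_def)
qed

end

context de_walk_model
begin

text \<open>After the skips forced by the starting state, further skips occur only if the walk falls
  below 0. A fall costs at most ceil(h / \<mu>) skips and restarts the walk at 0, from where it
  falls again with probability at most \<open>p\<close>. A constant with ceil(h / \<mu>) + C p \<le>
  C therefore pays for a fall and everything after it, and the bound is C times the probability of a
  fall, propagated by first-step analysis.\<close>

lemma skipped_integral_bound:
  assumes q: "is_density M q" and Y: "Y \<in> borel_measurable M" and LY: "AE x in dens M q. L x = ereal (Y x)"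
    and p: "\<And>n. emeasure (no_change M q) {v\<in>space (seqM M). 0 < descent Y n v} \<le> p"
    and C: "of_nat (nat \<lceil>h / \<mu>\<rceil>) + C * p \<le> C"
  shows "(\<integral>\<^sup>+v. of_nat (skipped i w v) \<partial>no_change M q) \<le> of_nat (skips w) +
    C * emeasure (no_change M q) {v\<in>space (seqM M). max 0 w < ereal (descent Y i v)}"
proof (induction i arbitrary: w)
  let ?Q = "no_change M q"
  interpret NQ: prob_space ?Q by (rule prob_space_no_change[OF q])
  note [measurable] = Y measurable_descent[OF Y]
  \<comment> \<open>The probability that the walk with increments \<open>Y\<close>, started at
    height \<open>s\<close>, is below 0 at some time up to \<open>n\<close>; time 0 counts, so it
    equals 1 for negative \<open>s\<close>.\<close>
  define e where "e n s = emeasure ?Q {v\<in>space (seqM M). s < ereal (descent Y n v)}" for n s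
  {
    case 0
    show ?case using NQ.emeasure_space_1 by simp
  next
    case (Suc i)
    have [measurable]: "(\<lambda>v. skipped i w v) \<in> measurable (seqM M) (count_space UNIV)" for i w
      by (rule measurable_skipped) measurable
    define R where "R u = (of_nat (skipped i (observe w (u 0)) (\<lambda>j. u (Suc j))) :: ennreal)" for u
    have "(\<lambda>u. skipped i (observe w (u 0)) (\<lambda>j. u (Suc j))) \<in> measurable (seqM M) (count_space UNIV)"
      by (rule measurable_skipped) measurable
    then have R_meas: "R \<in> borel_measurable (seqM M)"
      unfolding R_def by (rule measurable_compose) simp
    have shift_meas: "(\<lambda>v j. v (skips w + j)) \<in> measurable (seqM M) (seqM M)"
      by (rule measurable_shift_at) simp_all
    have R_shift_meas: "(\<lambda>v. R (\<lambda>j. v (skips w + j))) \<in> borel_measurable ?Q"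
      using measurable_compose[OF shift_meas R_meas] by simp
    have e_neg: "e n s = 1" if "s < 0" for n s
    proof -
      have "s < ereal (descent Y n v)" for v
        using that descent_nonneg[of Y n v] by (metis ereal_less_eq(3) less_le_trans zero_ereal_def)
      then show ?thesis using NQ.emeasure_space_1 by (simp add: e_def)
    qed
    have e_zero: "e n 0 \<le> p" for n
      using p[of n] by (simp add: e_def zero_ereal_def)
    have e_Suc: "(\<integral>\<^sup>+x. e i (s + ereal (Y x)) \<partial>dens M q) = e (Suc i) s" if "0 \<le> s" for s
    proof -
      have iff: "s < ereal (descent Y (Suc i) (case_nat x v)) \<longleftrightarrow> s + ereal (Y x) < ereal (descent Y i v)" for x v
        using that by (cases s) (auto simp: max_def)
      have "e (Suc i) s = (\<integral>\<^sup>+v. indicator {v\<in>space (seqM M). s < ereal (descent Y (Suc i) v)} v \<partial>?Q)"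
        unfolding e_def by (subst nn_integral_indicator) auto
      also have "\<dots> = (\<integral>\<^sup>+x. \<integral>\<^sup>+v. indicator {v\<in>space (seqM M). s < ereal (descent Y (Suc i) v)} (case_nat x v) \<partial>?Q \<partial>dens M q)"
        by (rule nn_integral_no_change_case_nat[OF q]) measurable
      also have "\<dots> = (\<integral>\<^sup>+x. \<integral>\<^sup>+v. indicator {v\<in>space (seqM M). s + ereal (Y x) < ereal (descent Y i v)} v \<partial>?Q \<partial>dens M q)"
      proof (intro nn_integral_cong)
        fix x v assume "x \<in> space (dens M q)" "v \<in> space ?Q"
        then have "case_nat x v \<in> space (seqM M)" "v \<in> space (seqM M)"
          by (auto simp: space_PiM PiE_iff split: nat.split)
        then show "indicator {v\<in>space (seqM M). s < ereal (descent Y (Suc i) v)} (case_nat x v) =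
            (indicator {v\<in>space (seqM M). s + ereal (Y x) < ereal (descent Y i v)} v :: ennreal)"
          unfolding indicator_def mem_Collect_eq iff by simp
      qed
      also have "\<dots> = (\<integral>\<^sup>+x. e i (s + ereal (Y x)) \<partial>dens M q)"
        unfolding e_def by (intro nn_integral_cong nn_integral_indicator) measurable
      finally show ?thesis ..
    qed
    \<comment> \<open>If the sample keeps the statistic nonnegative, both sides coincide. Otherwise
      the right side is \<open>C\<close>, which covers the excursion and the restart from 0;
      clipping at -h affects only this case.\<close>
    have bound: "of_nat (skips (observe w x)) + C * e i (max 0 (observe w x)) \<le> C * e i (max 0 w + L x)" for x
    proof (cases "0 \<le> max 0 w + L x")
      case True
      then have "observe w x = max 0 w + L x" using h by (simp add: observe_def max_absorb2 order_trans[of _ 0])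
      with True show ?thesis by (simp add: skips_nonneg max_absorb2)
    next
      case False
      then have "observe w x \<le> 0" using h by (simp add: observe_def)
      then have m: "max 0 (observe w x) = 0" by (simp add: max_absorb1)
      have "of_nat (skips (observe w x)) + C * e i 0 \<le> of_nat (nat \<lceil>h / \<mu>\<rceil>) + C * p"
        using skips_bounded[OF observe_ge] e_zero by (intro add_mono mult_left_mono) auto
      also note C
      finally show ?thesis using False e_neg[of "max 0 w + L x" i] by (simp add: m)
    qed
    have "(\<integral>\<^sup>+v. of_nat (skipped (Suc i) w v) \<partial>?Q) = (\<integral>\<^sup>+v. of_nat (skips w) + R (\<lambda>j. v (skips w + j)) \<partial>?Q)"
      by (simp add: R_def)
    also have "\<dots> = of_nat (skips w) + (\<integral>\<^sup>+v. R (\<lambda>j. v (skips w + j)) \<partial>?Q)"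
      using R_shift_meas NQ.emeasure_space_1 by (subst nn_integral_add) simp_all
    also have "(\<integral>\<^sup>+v. R (\<lambda>j. v (skips w + j)) \<partial>?Q) = (\<integral>\<^sup>+v. R v \<partial>?Q)"
      by (rule nn_integral_no_change_shift[OF q R_meas])
    also have "\<dots> = (\<integral>\<^sup>+x. \<integral>\<^sup>+v. of_nat (skipped i (observe w x) v) \<partial>?Q \<partial>dens M q)"
      unfolding nn_integral_no_change_case_nat[OF q R_meas] by (simp add: R_def)
    also have "\<dots> \<le> (\<integral>\<^sup>+x. of_nat (skips (observe w x)) + C * e i (max 0 (observe w x)) \<partial>dens M q)"
      unfolding e_def by (intro nn_integral_mono Suc.IH)
    also have "\<dots> \<le> (\<integral>\<^sup>+x. C * e i (max 0 w + L x) \<partial>dens M q)"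
      by (intro nn_integral_mono bound)
    also have "\<dots> = (\<integral>\<^sup>+x. C * e i (max 0 w + ereal (Y x)) \<partial>dens M q)"
      by (intro nn_integral_cong_AE, use LY in eventually_elim) simp
    also have "\<dots> = C * (\<integral>\<^sup>+x. e i (max 0 w + ereal (Y x)) \<partial>dens M q)"
      unfolding e_def by (rule nn_integral_cmult) measurable
    also have "\<dots> = C * e (Suc i) (max 0 w)"
      by (simp add: e_Suc)
    finally show ?case unfolding e_def by (simp add: add_left_mono)
  }
qed

lemma skipped_total_bound:
  assumes q: "is_density M q" and Y: "integrable (dens M q) Y" "0 < (\<integral>x. Y x \<partial>dens M q)"
    and LY: "AE x in dens M q. L x = ereal (Y x)"
  obtains K :: real where "0 \<le> K"
    "\<And>w. - ereal h \<le> w \<Longrightarrow> (\<integral>\<^sup>+v. (SUP i. of_nat (skipped i w v)) \<partial>no_change M q) \<le> ennreal K"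
proof -
  let ?Q = "no_change M q"
  interpret NQ: prob_space ?Q by (rule prob_space_no_change[OF q])
  have Ym: "Y \<in> borel_measurable M" using Y by auto
  obtain p :: real where p: "0 \<le> p" "p < 1"
    "\<And>n. emeasure ?Q {v\<in>space (seqM M). 0 < descent Y n v} \<le> ennreal p"
    using descent_prob_less_1[OF q Y] by metis
  define c where "c = real (nat \<lceil>h / \<mu>\<rceil>)"
  \<comment> \<open>The geometric sum c + c p + c p^2 + ..., solving c + C p = C. The extra
    \<open>c\<close> in the final bound pays for the skips of a negative starting state, which makes
    the bound uniform in \<open>w\<close>.\<close>
  define C where "C = c / (1 - p)"
  have c: "0 \<le> c" by (simp add: c_def)
  then have C0: "0 \<le> C" using p by (simp add: C_def)
  have "c + C * p = C" using p by (simp add: C_def field_simps)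
  then have C: "of_nat (nat \<lceil>h / \<mu>\<rceil>) + ennreal C * ennreal p \<le> ennreal C"
    using ennreal_plus[of c "C * p"] ennreal_mult[of C p] c C0 p
    by (simp add: c_def ennreal_of_nat_eq_real_of_nat)
  have "(\<integral>\<^sup>+v. (SUP i. of_nat (skipped i w v)) \<partial>?Q) \<le> ennreal (c + C)" if w: "- ereal h \<le> w" for w
  proof -
    have "(\<integral>\<^sup>+v. (SUP i. of_nat (skipped i w v)) \<partial>?Q) = (SUP i. \<integral>\<^sup>+v. of_nat (skipped i w v) \<partial>?Q)"
    proof (rule nn_integral_monotone_convergence_SUP)
      show "incseq (\<lambda>i v. of_nat (skipped i w v) :: ennreal)"
        by (intro incseq_SucI le_funI of_nat_mono skipped_mono)
      have [measurable]: "(\<lambda>v. skipped i w v) \<in> measurable (seqM M) (count_space UNIV)" for i w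
        by (rule measurable_skipped) measurable
      show "(\<lambda>v. of_nat (skipped i w v)) \<in> borel_measurable ?Q" for i by measurable
    qed
    also have "\<dots> \<le> ennreal (c + C)"
    proof (rule SUP_least)
      fix i
      have "(\<integral>\<^sup>+v. of_nat (skipped i w v) \<partial>?Q) \<le> of_nat (skips w) +
        ennreal C * emeasure ?Q {v\<in>space (seqM M). max 0 w < ereal (descent Y i v)}"
        by (rule skipped_integral_bound[OF q Ym LY p(3) C])
      also have "\<dots> \<le> of_nat (nat \<lceil>h / \<mu>\<rceil>) + ennreal C * 1"
        using skips_bounded[OF w] NQ.measure_le_1 by (intro add_mono mult_left_mono) auto
      also have "\<dots> = ennreal (c + C)"
        using c C0 by (simp add: c_def ennreal_plus ennreal_of_nat_eq_real_of_nat)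
      finally show "(\<integral>\<^sup>+v. of_nat (skipped i w v) \<partial>?Q) \<le> ennreal (c + C)" .
    qed
    finally show ?thesis .
  qed
  then show thesis using that[of "c + C"] c C0 by auto
qed

end

section \<open>GDECuSum is a policy\<close>

lemma measurable_enat_of_le:
  assumes "\<And>n. {\<omega>\<in>space N. T \<omega> \<le> enat n} \<in> sets N"
  shows "T \<in> measurable N (count_space UNIV)"
  unfolding measurable_count_space_eq2_countable
proof (intro conjI ballI)
  fix a :: enat
  show "T -` {a} \<inter> space N \<in> sets N"
  proof (cases a)
    case (enat n)
    have "T -` {a} \<inter> space N = {\<omega>\<in>space N. T \<omega> \<le> enat n} - (\<Union>k\<in>{..<n}. {\<omega>\<in>space N. T \<omega> \<le> enat k})"
      (is "?l = ?r")
    proof (intro set_eqI)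
      fix \<omega>
      show "\<omega> \<in> ?l \<longleftrightarrow> \<omega> \<in> ?r"
        unfolding enat by (cases "T \<omega>") (auto simp: not_le dest: leD)
    qed
    also have "\<dots> \<in> sets N" using assms by (intro sets.Diff sets.finite_UN) auto
    finally show ?thesis .
  next
    case infinity
    have "T -` {a} \<inter> space N = space N - (\<Union>n. {\<omega>\<in>space N. T \<omega> \<le> enat n})" (is "?l = ?r")
    proof (intro set_eqI)
      fix \<omega>
      show "\<omega> \<in> ?l \<longleftrightarrow> \<omega> \<in> ?r"
        unfolding infinity by (cases "T \<omega>") auto
    qed
    also have "\<dots> \<in> sets N" using assms by (intro sets.Diff sets.countable_nat_UN) auto
    finally show ?thesis .
  qed
qed simp

lemma measurable_ennreal_of_enat_comp:
  "T \<in> measurable N (count_space UNIV) \<Longrightarrow> (\<lambda>\<omega>. ennreal_of_enat (T \<omega>)) \<in> borel_measurable N"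
  by (rule measurable_compose[where N="count_space UNIV"]) simp_all

lemma
  shows space_observed[simp]: "space (observed M S t) = space (seqM M)"
    and sets_observed: "sets (observed M S t) = sigma_sets (space (seqM M))
      ({{\<omega>\<in>space (seqM M). S k \<omega>} | k. 1 \<le> k \<and> enat k \<le> t} \<union>
       {{\<omega>\<in>space (seqM M). S k \<omega> \<and> \<omega> k \<in> B} | k B. 1 \<le> k \<and> enat k \<le> t \<and> B \<in> sets M})"
  unfolding observed_def Let_def by (auto intro!: space_measure_of sets_measure_of)

lemma observed_used_set:
  "1 \<le> k \<Longrightarrow> enat k \<le> t \<Longrightarrow> {\<omega>\<in>space (seqM M). S k \<omega>} \<in> sets (observed M S t)"
  unfolding sets_observed by (intro sigma_sets.Basic) auto

lemma observed_value_set: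
  "1 \<le> k \<Longrightarrow> enat k \<le> t \<Longrightarrow> B \<in> sets M \<Longrightarrow> {\<omega>\<in>space (seqM M). S k \<omega> \<and> \<omega> k \<in> B} \<in> sets (observed M S t)"
  unfolding sets_observed by (intro sigma_sets.Basic) auto

lemma observed_mono: "s \<le> t \<Longrightarrow> sets (observed M S s) \<subseteq> sets (observed M S t)"
  unfolding sets_observed by (intro sigma_sets_mono') (auto intro: order_trans)

lemma measurable_observed_mono:
  "s \<le> t \<Longrightarrow> f \<in> measurable (observed M S s) N \<Longrightarrow> f \<in> measurable (observed M S t) N"
  using observed_mono[of s t M S] by (auto simp: measurable_def)

lemma observed_subset_seqM:
  assumes "\<And>k. 1 \<le> k \<Longrightarrow> {\<omega>\<in>space (seqM M). S k \<omega>} \<in> sets (seqM M)"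
  shows "sets (observed M S t) \<subseteq> sets (seqM M)"
  unfolding sets_observed
proof (intro sets.sigma_sets_subset subsetI, elim UnE CollectE exE conjE)
  fix x k assume "x = {\<omega>\<in>space (seqM M). S k \<omega>}" "1 \<le> k"
  then show "x \<in> sets (seqM M)" using assms by blast
next
  fix x k B assume x: "x = {\<omega>\<in>space (seqM M). S k \<omega> \<and> \<omega> k \<in> B}" "1 \<le> k" and B: "B \<in> sets M"
  have "{\<omega>\<in>space (seqM M). \<omega> k \<in> B} \<in> sets (seqM M)"
    using B by (intro sets_Collect_single) auto
  from sets.Int[OF assms[OF x(2)] this] show "x \<in> sets (seqM M)"
    unfolding x by (simp add: Collect_conj_eq Int_ac)
qed

text \<open>The raw coordinate is not a function of the observed data when the sample is absent;
  replacing it by a fixed point in that case makes it one.\<close>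

lemma measurable_observed_value:
  assumes k: "1 \<le> k" "enat k \<le> t" and x0: "x0 \<in> space M"
  shows "(\<lambda>\<omega>. if S k \<omega> then \<omega> k else x0) \<in> measurable (observed M S t) M"
proof (rule measurableI)
  fix \<omega> assume "\<omega> \<in> space (observed M S t)"
  then show "(if S k \<omega> then \<omega> k else x0) \<in> space M" using x0 by (auto simp: space_PiM PiE_iff)
next
  fix B assume B: "B \<in> sets M"
  have "(\<lambda>\<omega>. if S k \<omega> then \<omega> k else x0) -` B \<inter> space (observed M S t)
    = {\<omega>\<in>space (seqM M). S k \<omega> \<and> \<omega> k \<in> B} \<union>
      (if x0 \<in> B then space (observed M S t) - {\<omega>\<in>space (seqM M). S k \<omega>} else {})"
    by (auto split: if_splits)
  also have "\<dots> \<in> sets (observed M S t)"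
    using sets.compl_sets[OF observed_used_set[OF k, of M S]] observed_value_set[OF k B, of S]
    by (intro sets.Un) (auto split: if_splits)
  finally show "(\<lambda>\<omega>. if S k \<omega> then \<omega> k else x0) -` B \<inter> space (observed M S t) \<in> sets (observed M S t)" .
qed

text \<open>The generators only involve indices below \<gamma>, where glued sequences with the same
  \<open>u\<close> agree, and the property passes through complements and countable unions. This
  stands in for conditioning on the past: with \<open>u\<close> fixed, the indicator of a past event
  is constant in the post-change sequence.\<close>

lemma observed_determined:
  assumes S: "\<And>k u v v'. 1 \<le> k \<Longrightarrow> k < \<gamma> \<Longrightarrow> S k (comb_seq \<gamma> u v) = S k (comb_seq \<gamma> u v')"
    and B: "B \<in> sets (observed M S (enat (\<gamma> - 1)))"
    and sp: "u \<in> space (seqM M)" "v \<in> space (seqM M)" "v' \<in> space (seqM M)"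
  shows "comb_seq \<gamma> u v \<in> B \<longleftrightarrow> comb_seq \<gamma> u v' \<in> B"
proof -
  have c: "comb_seq \<gamma> u v \<in> space (seqM M)" "comb_seq \<gamma> u v' \<in> space (seqM M)"
    using sp by (auto simp: space_PiM PiE_iff comb_seq_def)
  show ?thesis
    using B unfolding sets_observed
  proof (induction rule: sigma_sets.induct)
    case (Basic a)
    then show ?case
    proof (elim UnE CollectE exE conjE)
      fix k assume k: "a = {\<omega>\<in>space (seqM M). S k \<omega>}" "1 \<le> k" "enat k \<le> enat (\<gamma> - 1)"
      then have "k < \<gamma>" by simp
      with k c S[of k u v v'] show ?thesis by simp
    next
      fix k A assume k: "a = {\<omega>\<in>space (seqM M). S k \<omega> \<and> \<omega> k \<in> A}" "1 \<le> k" "enat k \<le> enat (\<gamma> - 1)"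
      then have "k < \<gamma>" by simp
      with k c S[of k u v v'] show ?thesis by (simp add: comb_seq_less)
    qed
  qed (use c in auto)
qed

section \<open>Pathwise comparison of the two alarm times, and measurability through the observed
  data\<close>

locale de_setting =
  fixes M :: "'a measure" and f0 :: "'a \<Rightarrow> real" and f :: "'t \<Rightarrow> 'a \<Rightarrow> real"
    and \<Theta> :: "'t set" and \<theta>s :: 't and \<mu> h :: real
  assumes model: "qcd_model M f0 f \<Theta>" and \<theta>s: "\<theta>s \<in> \<Theta>" and mu: "0 < \<mu>" and h: "0 \<le> h"
begin

lemma density_f0: "is_density M f0" and density_f: "\<theta> \<in> \<Theta> \<Longrightarrow> is_density M (f \<theta>)"
  using model by (auto simp: qcd_model_def)

lemma measurable_f0[measurable]: "f0 \<in> borel_measurable M"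
  and measurable_f: "\<theta> \<in> \<Theta> \<Longrightarrow> f \<theta> \<in> borel_measurable M"
  using density_f0 density_f by (auto simp: is_density_def)

lemma measurable_llr: "llr f0 (f \<theta>s) \<in> borel_measurable M"
proof -
  note [measurable] = measurable_f[OF \<theta>s]
  show ?thesis unfolding llr_def by measurable
qed

sublocale de_walk_model "llr f0 (f \<theta>s)" \<mu> h M
  by unfold_locales (use mu h measurable_llr in auto)

abbreviation "W \<equiv> de_stat f0 (f \<theta>s) \<mu> h"
abbreviation "S \<equiv> de_control f0 (f \<theta>s) \<mu> h"
abbreviation "gc_time A \<equiv> glr_time f0 f \<Theta> (\<lambda>_ _. True) A"
abbreviation "gd_time A \<equiv> glr_time f0 f \<Theta> S A"

lemma W_Suc: "W (Suc n) \<omega> = step (W n \<omega>) (\<omega> (Suc n))"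
  by (simp add: step_def)

lemma W_add: "W (n + m) \<omega> = state (W n \<omega>) (\<lambda>i. \<omega> (Suc (n + i))) m"
  by (induction m) (simp_all add: W_Suc del: de_stat.simps(2))

lemma W_ge: "- ereal h \<le> W n \<omega>"
proof (induction n)
  case 0
  show ?case using h by simp
next
  case (Suc n)
  have "W n \<omega> \<le> W n \<omega> + ereal \<mu>" using mu by (cases "W n \<omega>") auto
  then show ?case using Suc h by (auto simp: min_def max_def intro: order_trans)
qed

lemma W_finite: "W n \<omega> \<noteq> - \<infinity>"
  using W_ge[of n \<omega>] by auto

lemma S_Suc: "S (Suc n) \<omega> \<longleftrightarrow> 0 \<le> W n \<omega>"
  by (simp add: de_control_def)

lemma W_cong: "(\<And>i. 1 \<le> i \<Longrightarrow> i \<le> n \<Longrightarrow> \<omega> i = \<omega>' i) \<Longrightarrow> W n \<omega> = W n \<omega>'"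
  by (induction n) (simp_all add: W_Suc del: de_stat.simps(2))

lemma S_comb_seq: "1 \<le> k \<Longrightarrow> k < n \<Longrightarrow> S k (comb_seq n u v) = S k (comb_seq n u v')"
  unfolding de_control_def by (intro arg_cong[where f="(\<le>) 0"] W_cong) (simp add: comb_seq_less)

text \<open>Windows reaching back before time \<open>n\<close> are dropped, which can only delay the
  alarm; the restarted test starts its control in state \<open>W n \<omega>\<close> and is GCuSum on
  the selected samples. If that alarms at its \<open>Suc i\<close>-th sample, the position of this
  sample adds at most \<open>k\<close> skips. The point \<open>d\<close> fills the dummy coordinate
  0.\<close>

lemma gd_time_le_gc_time:
  assumes A: "0 < A" and k: "\<And>i. skipped i (W n \<omega>) (\<lambda>i. \<omega> (Suc (n + i))) \<le> k"
  shows "gd_time A \<omega> \<le> enat n +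
      (gc_time A (case_nat d (\<lambda>i. selected i (W n \<omega>) (\<lambda>i. \<omega> (Suc (n + i))))) + enat k)"
proof -
  let ?w = "W n \<omega>" and ?v = "\<lambda>i. \<omega> (Suc (n + i))"
  let ?S = "\<lambda>m x. 0 \<le> state ?w (\<lambda>i. x (Suc i)) (m - 1)"
  let ?z = "case_nat d (\<lambda>i. selected i ?w ?v)"
  have "gd_time A \<omega> \<le> enat n + glr_time f0 f \<Theta> ?S A (case_nat d ?v)"
  proof (rule glr_time_le_shift)
    fix i :: nat assume "1 \<le> i"
    then obtain j where j: "i = Suc j" by (cases i) auto
    show "S (n + i) \<omega> = ?S i (case_nat d ?v) \<and> (?S i (case_nat d ?v) \<longrightarrow> \<omega> (n + i) = (case_nat d ?v) i)"
      using S_Suc[of "n + j" \<omega>] W_add[of n j \<omega>] by (simp add: j)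
  qed
  also have "glr_time f0 f \<Theta> ?S A (case_nat d ?v) \<le> gc_time A ?z + enat k"
  proof (cases "gc_time A ?z")
    case (enat j)
    then obtain i where i: "j = Suc i" using glr_time_ge_1[of f0 f \<Theta> "\<lambda>_ _. True" A ?z]
      by (cases j) (auto simp: one_enat_def)
    \<comment> \<open>The number of samples after time \<open>n\<close>, up to and including the
      used sample at which GCuSum alarms.\<close>
    let ?n = "Suc (i + skipped i ?w ?v)"
    have "glr_time f0 f \<Theta> ?S A (case_nat d ?v) \<le> enat ?n \<longleftrightarrow> gc_time A ?z \<le> enat (used ?w ?v ?n)"
    proof (rule glr_time_selected[OF A])
      show "\<Theta> \<noteq> {}" using \<theta>s by auto
      fix i assume "1 \<le> i" "?S i (case_nat d ?v)"
      then obtain m where m: "i = Suc m" "0 \<le> state ?w ?v m" by (cases i) auto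
      then show "?z (used ?w ?v i) = case_nat d ?v i"
        using selected_used[OF m(2) W_finite] by simp
    qed simp_all
    moreover have "used ?w ?v ?n = j" using used_skipped[OF W_finite] i by simp
    ultimately have "glr_time f0 f \<Theta> ?S A (case_nat d ?v) \<le> enat ?n" using enat by simp
    also have "enat ?n \<le> gc_time A ?z + enat k" using k[of i] by (simp add: enat i)
    finally show ?thesis .
  qed simp
  finally show ?thesis by (simp add: add_left_mono)
qed

text \<open>The number of used samples never exceeds the number of samples, so reaching the same
  alarm takes at least as long with skips.\<close>

lemma gc_time_le_gd_time:
  assumes A: "0 < A"
  shows "gc_time A (case_nat d (\<lambda>i. selected i 0 (\<lambda>i. \<omega> (Suc i)))) \<le> gd_time A \<omega>"
proof (rule enat_le_by_nat)
  let ?v = "\<lambda>i. \<omega> (Suc i)"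
  let ?z = "case_nat d (\<lambda>i. selected i 0 ?v)"
  fix n assume "gd_time A \<omega> \<le> enat n"
  also have "gd_time A \<omega> \<le> enat n \<longleftrightarrow> gc_time A ?z \<le> enat (used 0 ?v n)"
  proof (rule glr_time_selected[OF A])
    show "\<Theta> \<noteq> {}" using \<theta>s by auto
    show "used 0 ?v (Suc i) = (if S (Suc i) \<omega> then Suc (used 0 ?v i) else used 0 ?v i)" for i
      using W_add[of 0 i \<omega>] by (simp add: S_Suc)
    fix i assume "1 \<le> i" "S i \<omega>"
    then obtain m where m: "i = Suc m" "0 \<le> state 0 ?v m"
      using W_add[of 0 _ \<omega>] S_Suc by (cases i) auto
    then show "?z (used 0 ?v i) = \<omega> i"
      using selected_used[OF m(2)] by simp
  qed simp
  also have "enat (used 0 ?v n) \<le> enat n" using used_le by simp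
  finally show "gc_time A ?z \<le> enat n" .
qed

lemma W_measurable_observed:
  "x0 \<in> space M \<Longrightarrow> W n \<in> borel_measurable (observed M S (enat n))"
proof (induction n)
  case (Suc n)
  let ?O = "observed M S (enat (Suc n))"
  have W: "W n \<in> borel_measurable ?O"
    by (rule measurable_observed_mono[OF _ Suc.IH[OF Suc.prems]]) simp
  have x: "(\<lambda>\<omega>. if S (Suc n) \<omega> then \<omega> (Suc n) else x0) \<in> measurable ?O M"
    by (rule measurable_observed_value) (use Suc.prems in auto)
  \<comment> \<open>When \<open>S (Suc n)\<close> fails the statistic is negative and
    \<open>step\<close> ignores the sample, so \<open>x0\<close> may stand in for it.\<close>
  have "W (Suc n) = (\<lambda>\<omega>. step (W n \<omega>) (if S (Suc n) \<omega> then \<omega> (Suc n) else x0))"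
    by (intro ext) (simp add: S_Suc step_def)
  also have "\<dots> \<in> borel_measurable ?O"
    by (rule measurable_step[OF W x])
  finally show ?case .
next
  case 0
  have "W 0 = (\<lambda>_. 0)" by (simp add: fun_eq_iff)
  then show ?case by simp
qed

lemma space_M_nonempty: obtains x0 where "x0 \<in> space M"
proof -
  interpret prob_space "dens M f0" by (rule prob_space_dens[OF density_f0])
  from not_empty show thesis using that by auto
qed

lemma S_predictable:
  assumes "1 \<le> n"
  shows "Measurable.pred (observed M S (enat (n - 1))) (S n)"
proof -
  obtain x0 where "x0 \<in> space M" by (rule space_M_nonempty)
  note [measurable] = W_measurable_observed[OF this, of "n - 1"]
  have "S n = (\<lambda>\<omega>. 0 \<le> W (n - 1) \<omega>)" by (simp add: de_control_def fun_eq_iff)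
  then show ?thesis by (simp only:) measurable
qed

lemma S_sets: "{\<omega>\<in>space (seqM M). S k \<omega>} \<in> sets (seqM M)"
proof -
  have W: "W n \<in> borel_measurable (seqM M)" for n
  proof (induction n)
    case 0
    have "W 0 = (\<lambda>_. 0)" by (simp add: fun_eq_iff)
    then show ?case by simp
  next
    case (Suc n)
    have "W (Suc n) = (\<lambda>\<omega>. step (W n \<omega>) (\<omega> (Suc n)))" by (intro ext W_Suc)
    also have "\<dots> \<in> borel_measurable (seqM M)"
      by (rule measurable_step[OF Suc.IH]) simp
    finally show ?case .
  qed
  have "{\<omega>\<in>space (seqM M). 0 \<le> W (k - 1) \<omega>} \<in> sets (seqM M)"
    using W by (intro borel_measurable_le) auto
  then show ?thesis by (simp add: de_control_def)
qed

text \<open>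
  Unlike \<open>selected\<close>, this only looks at the first \<open>n\<close> samples. The inner conditional keeps every
  subterm measurable with respect to the observed data.
\<close>

primrec used_samples :: "'a \<Rightarrow> nat \<Rightarrow> (nat \<Rightarrow> 'a) \<Rightarrow> nat \<Rightarrow> 'a" where
  "used_samples x0 0 \<omega> = (\<lambda>_. x0)"
| "used_samples x0 (Suc n) \<omega> = (\<lambda>j. if S (Suc n) \<omega> \<and> used 0 (\<lambda>i. \<omega> (Suc i)) (Suc n) = j
     then (if S (Suc n) \<omega> then \<omega> (Suc n) else x0) else used_samples x0 n \<omega> j)"

lemma S_state: "S (Suc n) \<omega> \<longleftrightarrow> 0 \<le> state 0 (\<lambda>i. \<omega> (Suc i)) n"
  using W_add[of 0 n \<omega>] by (simp add: S_Suc)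

lemma used_samples_eq:
  assumes "1 \<le> i" "i \<le> n" "S i \<omega>"
  shows "used_samples x0 n \<omega> (used 0 (\<lambda>i. \<omega> (Suc i)) i) = \<omega> i"
  using assms(2)
proof (induction n)
  case 0
  with assms show ?case by simp
next
  case (Suc n)
  let ?u = "used 0 (\<lambda>i. \<omega> (Suc i))"
  show ?case
  proof (cases "i = Suc n")
    case False
    then have "i \<le> n" using Suc by simp
    have "?u i \<le> ?u n"
      using \<open>i \<le> n\<close> by (rule lift_Suc_mono_le[rotated]) simp
    \<comment> \<open>A later used sample has a strictly larger count, so an entry once written is
      never overwritten.\<close>
    then have "\<not> (S (Suc n) \<omega> \<and> ?u (Suc n) = ?u i)" by (auto simp: S_state)
    then show ?thesis using Suc.IH[OF \<open>i \<le> n\<close>] by (simp only: used_samples.simps if_False)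
  qed (use assms in simp)
qed

lemma used_measurable_observed:
  "(\<lambda>\<omega>. used 0 (\<lambda>i. \<omega> (Suc i)) n) \<in> measurable (observed M S (enat n)) (count_space UNIV)"
proof (induction n)
  case (Suc n)
  have [measurable]: "(\<lambda>\<omega>. used 0 (\<lambda>i. \<omega> (Suc i)) n) \<in> measurable (observed M S (enat (Suc n))) (count_space UNIV)"
    by (rule measurable_observed_mono[OF _ Suc.IH]) simp
  have [measurable]: "Measurable.pred (observed M S (enat (Suc n))) (S (Suc n))"
    by (rule measurable_observed_mono[OF _ S_predictable]) simp_all
  have "(\<lambda>\<omega>. used 0 (\<lambda>i. \<omega> (Suc i)) (Suc n)) = (\<lambda>\<omega>. if S (Suc n) \<omega> then Suc (used 0 (\<lambda>i. \<omega> (Suc i)) n) else used 0 (\<lambda>i. \<omega> (Suc i)) n)"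
    by (simp add: S_state)
  also have "\<dots> \<in> measurable (observed M S (enat (Suc n))) (count_space UNIV)"
    by measurable
  finally show ?case .
qed simp

lemma used_samples_measurable:
  assumes x0: "x0 \<in> space M"
  shows "used_samples x0 n \<in> measurable (observed M S (enat n)) (seqM M)"
proof -
  have comp: "(\<lambda>\<omega>. used_samples x0 n \<omega> j) \<in> measurable (observed M S (enat n)) M" for j n
  proof (induction n)
    case 0
    show ?case using x0 by simp
  next
    case (Suc n)
    let ?O = "observed M S (enat (Suc n))"
    have [measurable]: "(\<lambda>\<omega>. used_samples x0 n \<omega> j) \<in> measurable ?O M"
      by (rule measurable_observed_mono[OF _ Suc.IH]) simp
    have [measurable]: "(\<lambda>\<omega>. if S (Suc n) \<omega> then \<omega> (Suc n) else x0) \<in> measurable ?O M"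
      by (rule measurable_observed_value) (use x0 in auto)
    have [measurable]: "Measurable.pred ?O (S (Suc n))"
      by (rule measurable_observed_mono[OF _ S_predictable]) simp_all
    have "Measurable.pred ?O (\<lambda>\<omega>. used 0 (\<lambda>i. \<omega> (Suc i)) (Suc n) = j)"
      by (rule measurable_compose[OF used_measurable_observed]) simp
    then have "Measurable.pred ?O (\<lambda>\<omega>. S (Suc n) \<omega> \<and> used 0 (\<lambda>i. \<omega> (Suc i)) (Suc n) = j)"
      by (intro pred_intros_logic) simp_all
    then have "{\<omega>\<in>space ?O. S (Suc n) \<omega> \<and> used 0 (\<lambda>i. \<omega> (Suc i)) (Suc n) = j} \<in> sets ?O"
      by (simp only: pred_def)
    then show ?case unfolding used_samples.simps
      by (rule measurable_If[rotated 2]) fact+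
  qed
  show ?thesis
  proof (rule measurable_PiM_single')
    show "(\<lambda>\<omega>. used_samples x0 n \<omega> j) \<in> measurable (observed M S (enat n)) M" for j by (rule comp)
    show "used_samples x0 n \<in> space (observed M S (enat n)) \<rightarrow> (\<Pi>\<^sub>E i\<in>UNIV. space M)"
      using measurable_space[OF comp] by (auto simp: PiE_iff)
  qed
qed

text \<open>The supremum over an arbitrary \<Theta> gives no direct route to measurability of the
  statistic. Instead, an alarm up to time \<open>n\<close> is rewritten as an alarm of GCuSum on the
  samples used so far, within the number of uses, and both of these are functions of the data
  observed up to \<open>n\<close>.\<close>

lemma gd_policy:
  assumes A: "0 < A" and gc: "gc_time A \<in> measurable (seqM M) (count_space UNIV)"
  shows "is_policy M (GDECuSum f0 f \<Theta> \<theta>s \<mu> h A)"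
proof -
  obtain x0 where x0: "x0 \<in> space M" by (rule space_M_nonempty)
  have "stopping_time (observed M S) (gd_time A)"
  proof
    fix t :: enat
    show "Measurable.pred (observed M S t) (\<lambda>\<omega>. gd_time A \<omega> \<le> t)"
    proof (cases t)
      case (enat n)
      let ?u = "\<lambda>\<omega>. used 0 (\<lambda>i. \<omega> (Suc i))"
      have "gd_time A \<omega> \<le> enat n \<longleftrightarrow> gc_time A (used_samples x0 n \<omega>) \<le> enat (?u \<omega> n)" for \<omega>
        by (rule glr_time_selected[OF A]) (use \<theta>s in \<open>auto simp: S_state[symmetric] used_samples_eq\<close>)
      moreover have "Measurable.pred (observed M S t) (\<lambda>\<omega>. gc_time A (used_samples x0 n \<omega>) \<le> enat (?u \<omega> n))"
      proof (rule measurable_compose_countable[where f="\<lambda>j \<omega>. gc_time A (used_samples x0 n \<omega>) \<le> enat j"])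
        have "(\<lambda>\<omega>. gc_time A (used_samples x0 n \<omega>)) \<in> measurable (observed M S t) (count_space UNIV)"
          unfolding enat by (rule measurable_compose[OF used_samples_measurable[OF x0] gc])
        then show "Measurable.pred (observed M S t) (\<lambda>\<omega>. gc_time A (used_samples x0 n \<omega>) \<le> enat j)" for j
          by (rule measurable_compose) simp
        show "(\<lambda>\<omega>. ?u \<omega> n) \<in> measurable (observed M S t) (count_space UNIV)"
          unfolding enat by (rule used_measurable_observed)
      qed
      ultimately show ?thesis by (simp add: enat)
    qed simp
  qed
  then show ?thesis
    unfolding is_policy_def GDECuSum_def Let_def prod.case using S_predictable glr_time_ge_1 by blast
qed

text \<open>This is the source of all measurability of alarm times: the stopping time property
  contained in the notion of policy supplies it.\<close>

lemma gc_time_measurable: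
  assumes "is_policy M (GCuSum f0 f \<Theta> A)"
  shows "gc_time A \<in> measurable (seqM M) (count_space UNIV)"
proof (rule measurable_enat_of_le)
  fix n
  have "Measurable.pred (observed M (\<lambda>_ _. True) (enat n)) (\<lambda>\<omega>. gc_time A \<omega> \<le> enat n)"
    using assms by (auto simp: is_policy_def GCuSum_def Let_def stopping_time_def)
  then have "{\<omega>\<in>space (seqM M). gc_time A \<omega> \<le> enat n} \<in> sets (observed M (\<lambda>_ _. True) (enat n))"
    by (simp add: pred_def)
  also have "\<dots> \<subseteq> sets (seqM M)" by (rule observed_subset_seqM) simp
  finally show "{\<omega>\<in>space (seqM M). gc_time A \<omega> \<le> enat n} \<in> sets (seqM M)" .
qed

lemma gd_time_measurable:
  assumes "is_policy M (GDECuSum f0 f \<Theta> \<theta>s \<mu> h A)"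
  shows "gd_time A \<in> measurable (seqM M) (count_space UNIV)"
    and "{\<omega>\<in>space (seqM M). gd_time A \<omega> \<le> enat n} \<in> sets (observed M S (enat n))"
proof -
  have o: "{\<omega>\<in>space (seqM M). gd_time A \<omega> \<le> enat n} \<in> sets (observed M S (enat n))" for n
  proof -
    have "Measurable.pred (observed M S (enat n)) (\<lambda>\<omega>. gd_time A \<omega> \<le> enat n)"
      using assms by (auto simp: is_policy_def GDECuSum_def Let_def stopping_time_def)
    then show ?thesis by (simp add: pred_def)
  qed
  then show "{\<omega>\<in>space (seqM M). gd_time A \<omega> \<le> enat n} \<in> sets (observed M S (enat n))" .
  show "gd_time A \<in> measurable (seqM M) (count_space UNIV)"
    by (rule measurable_enat_of_le, rule subsetD[OF observed_subset_seqM[OF S_sets] o])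
qed

end

section \<open>Delay and false alarm bounds\<close>

text \<open>If the conditional expectation exceeded \<open>c + e\<close> on a past event
  \<open>B\<close>, integrating over \<open>B\<close> would give (c + e) P(B) \<le> c P(B), hence
  P(B) = 0 for finite \<open>c\<close>. Bounds on conditional delays thus reduce to bounds on
  integrals over past events.\<close>

lemma (in prob_space) esssup_nn_cond_exp_le:
  fixes c :: ennreal
  assumes F: "subalgebra M F" and f[measurable]: "f \<in> borel_measurable M"
    and le: "\<And>B. B \<in> sets F \<Longrightarrow> (\<integral>\<^sup>+x. f x * indicator B x \<partial>M) \<le> c * emeasure M B"
  shows "esssup M (nn_cond_exp M F f) \<le> c"
proof -
  interpret finite_measure_subalgebra M F by unfold_locales (rule F)
  let ?g = "nn_cond_exp M F f"
  have "AE x in M. ?g x \<le> c"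
  proof (cases "c = top")
    case False
    show ?thesis
    proof (rule AE_upper_bound_inf_ennreal)
      fix e :: real assume e: "0 < e"
      define B where "B = {x\<in>space F. c + ennreal e < ?g x}"
      have B: "B \<in> sets F" unfolding B_def by measurable
      then have BM: "B \<in> sets M" using F by (auto simp: subalgebra_def)
      have "(c + ennreal e) * emeasure M B = (\<integral>\<^sup>+x. (c + ennreal e) * indicator B x \<partial>M)"
        using BM by (simp add: nn_integral_cmult_indicator)
      also have "\<dots> \<le> (\<integral>\<^sup>+x. indicator B x * ?g x \<partial>M)"
        by (intro nn_integral_mono) (auto simp: indicator_def B_def)
      also have "\<dots> = (\<integral>\<^sup>+x. indicator B x * f x \<partial>M)"
        using B by (intro nn_cond_exp_intg) auto
      also have "\<dots> \<le> c * emeasure M B"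
        using le[OF B] by (simp add: mult.commute)
      finally have "c * emeasure M B + ennreal e * emeasure M B \<le> c * emeasure M B + 0"
        by (simp add: distrib_right)
      moreover have "c * emeasure M B \<noteq> top"
        using False emeasure_finite[of B] by (simp add: ennreal_mult_eq_top_iff)
      ultimately have "ennreal e * emeasure M B = 0"
        unfolding ennreal_add_left_cancel_le by auto
      then have "emeasure M B = 0" using e by auto
      then have "AE x in M. x \<notin> B" using BM by (intro AE_not_in) auto
      moreover have "AE x in M. x \<in> space M" by simp
      ultimately show "AE x in M. ?g x \<le> c + ennreal e"
        by eventually_elim (use F in \<open>auto simp: B_def subalgebra_def not_less\<close>)
    qed
  qed simp
  then show ?thesis by (intro esssup_I borel_measurable_nn_cond_exp2)
qed

lemma (in prob_space) nn_integral_le_esssup_nn_cond_exp: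
  fixes f :: "'a \<Rightarrow> ennreal"
  assumes F: "subalgebra M F" and f[measurable]: "f \<in> borel_measurable M"
  shows "(\<integral>\<^sup>+x. f x \<partial>M) \<le> esssup M (nn_cond_exp M F f)"
proof -
  interpret finite_measure_subalgebra M F by unfold_locales (rule F)
  have "(\<integral>\<^sup>+x. f x \<partial>M) = (\<integral>\<^sup>+x. nn_cond_exp M F f x \<partial>M)"
    using nn_cond_exp_intg[of "\<lambda>_. 1" f] by simp
  also have "\<dots> \<le> (\<integral>\<^sup>+x. esssup M (nn_cond_exp M F f) \<partial>M)"
    by (intro nn_integral_mono_AE esssup_AE)
  finally show ?thesis by (simp add: emeasure_space_1)
qed

lemma one_divide_antimono_ennreal:
  fixes a b :: ennreal
  assumes "a \<le> b"
  shows "1 / b \<le> 1 / a"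
proof (cases "a = 0 \<or> b = top")
  case False
  with assms have a: "a \<noteq> 0" "a < top" "0 < b"
    by (auto simp: less_top zero_less_iff_neq_zero dest: top_unique[THEN iffD1])
  have "1 = a / a" using a by simp
  also have "\<dots> \<le> b / a" by (rule divide_right_mono_ennreal[OF assms])
  also have "\<dots> = b * (1 / a)" by (simp add: ennreal_times_divide)
  finally show ?thesis by (rule divide_le_posI_ennreal[OF a(3)])
qed auto

context de_setting
begin

lemma gc_time_dummy: "gc_time A \<omega> = gc_time A (case_nat d (\<lambda>i. \<omega> (Suc i)))"
  by (rule glr_time_cong) (auto split: nat.split)

text \<open>The GCuSum alarm time as a function of an i.i.d. sequence indexed from 0, the form that
  gluing at change point 1 produces; \<open>x0\<close> only fills the dummy coordinate.\<close>

definition alarm :: "'a \<Rightarrow> real \<Rightarrow> (nat \<Rightarrow> 'a) \<Rightarrow> ennreal" where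
  "alarm x0 A v = ennreal_of_enat (gc_time A (case_nat x0 v))"

lemma alarm_measurable:
  assumes x0: "x0 \<in> space M" and gc: "gc_time A \<in> measurable (seqM M) (count_space UNIV)"
  shows "alarm x0 A \<in> borel_measurable (seqM M)"
proof -
  have "(\<lambda>v. case_nat x0 v) \<in> measurable (seqM M) (seqM M)"
    using x0 by (intro measurable_case_nat') simp_all
  from measurable_ennreal_of_enat_comp[OF measurable_compose[OF this gc]]
  show ?thesis unfolding alarm_def[abs_def] .
qed

text \<open>The function \<open>g\<close> is the identity for the false alarm rate and truncated
  subtraction of 1 for the delay.\<close>

lemma gc_time_integral:
  assumes \<theta>: "is_density M q" and x0: "x0 \<in> space M"
    and gc: "gc_time A \<in> measurable (seqM M) (count_space UNIV)"
    and g: "g \<in> borel_measurable borel"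
  shows "(\<integral>\<^sup>+\<omega>. g (ennreal_of_enat (gc_time A \<omega>)) \<partial>change_at M f0 q 1)
    = (\<integral>\<^sup>+v. g (alarm x0 A v) \<partial>no_change M q)"
proof -
  interpret N0: prob_space "no_change M f0" by (rule prob_space_no_change[OF density_f0])
  have meas: "(\<lambda>\<omega>. g (ennreal_of_enat (gc_time A \<omega>))) \<in> borel_measurable (seqM M)"
    by (rule measurable_compose[OF measurable_ennreal_of_enat_comp[OF gc] g])
  have "(\<integral>\<^sup>+\<omega>. g (ennreal_of_enat (gc_time A \<omega>)) \<partial>change_at M f0 q 1)
     = (\<integral>\<^sup>+u. \<integral>\<^sup>+v. g (ennreal_of_enat (gc_time A (case_nat (u 0) v))) \<partial>no_change M q \<partial>no_change M f0)"
    using nn_integral_change_at[OF density_f0 \<theta> meas, of 1] by simp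
  also have "\<dots> = (\<integral>\<^sup>+u. \<integral>\<^sup>+v. g (alarm x0 A v) \<partial>no_change M q \<partial>no_change M f0)"
    unfolding alarm_def by (subst gc_time_dummy[where d=x0]) simp
  also have "\<dots> = (\<integral>\<^sup>+v. g (alarm x0 A v) \<partial>no_change M q)"
    using N0.emeasure_space_1 by simp
  finally show ?thesis .
qed

lemma alarm_integral_le_gd_time:
  assumes A: "0 < A" and x0: "x0 \<in> space M"
    and gc: "gc_time A \<in> measurable (seqM M) (count_space UNIV)"
    and gd: "gd_time A \<in> measurable (seqM M) (count_space UNIV)"
  shows "(\<integral>\<^sup>+v. alarm x0 A v \<partial>no_change M f0) \<le> (\<integral>\<^sup>+\<omega>. ennreal_of_enat (gd_time A \<omega>) \<partial>no_change M f0)"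
proof -
  interpret N0: prob_space "no_change M f0" by (rule prob_space_no_change[OF density_f0])
  \<comment> \<open>Optional skipping allows the samples to be replaced by the selected ones; the
    outer variable \<open>u\<close> will carry the dummy coordinate.\<close>
  have "(\<integral>\<^sup>+v. alarm x0 A v \<partial>no_change M f0)
      = (\<integral>\<^sup>+u. \<integral>\<^sup>+v. alarm x0 A (\<lambda>i. selected i 0 v) \<partial>no_change M f0 \<partial>no_change M f0)"
    using N0.emeasure_space_1 by (simp add: nn_integral_selected[OF density_f0 alarm_measurable[OF x0 gc]])
  also have "\<dots> \<le> (\<integral>\<^sup>+u. \<integral>\<^sup>+v. ennreal_of_enat (gd_time A (comb_seq 1 u v)) \<partial>no_change M f0 \<partial>no_change M f0)"
    unfolding alarm_def using gc_time_le_gd_time[OF A, of x0 "comb_seq 1 _ _"]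
    by (intro nn_integral_mono) simp
  also have "\<dots> = (\<integral>\<^sup>+\<omega>. ennreal_of_enat (gd_time A \<omega>) \<partial>no_change M f0)"
    using nn_integral_change_at[OF density_f0 density_f0 measurable_ennreal_of_enat_comp[OF gd], of 1]
    by (simp add: change_at_same)
  finally show ?thesis .
qed

lemma gd_feasible:
  assumes A: "0 < A" and gc: "feasible M f0 \<alpha> 1 (GCuSum f0 f \<Theta> A)"
    and pdc: "PDC M f0 S \<le> ennreal \<beta>"
  shows "feasible M f0 \<alpha> \<beta> (GDECuSum f0 f \<Theta> \<theta>s \<mu> h A)"
proof -
  obtain x0 where x0: "x0 \<in> space M" by (rule space_M_nonempty)
  have pol: "is_policy M (GCuSum f0 f \<Theta> A)" and far: "FAR M f0 (GCuSum f0 f \<Theta> A) \<le> ennreal \<alpha>"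
    using gc by (auto simp: feasible_def)
  note gcm = gc_time_measurable[OF pol]
  note gdp = gd_policy[OF A gcm]
  note gdm = gd_time_measurable(1)[OF gdp]
  have id: "(\<lambda>x::ennreal. x) \<in> borel_measurable borel" by simp
  have "(\<integral>\<^sup>+\<omega>. ennreal_of_enat (gc_time A \<omega>) \<partial>no_change M f0) = (\<integral>\<^sup>+v. alarm x0 A v \<partial>no_change M f0)"
    using gc_time_integral[OF density_f0 x0 gcm id] by (simp add: change_at_same)
  also have "\<dots> \<le> (\<integral>\<^sup>+\<omega>. ennreal_of_enat (gd_time A \<omega>) \<partial>no_change M f0)"
    by (rule alarm_integral_le_gd_time[OF A x0 gcm gdm])
  finally have "FAR M f0 (GDECuSum f0 f \<Theta> \<theta>s \<mu> h A) \<le> FAR M f0 (GCuSum f0 f \<Theta> A)"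
    unfolding FAR_def GDECuSum_def GCuSum_def Let_def snd_conv
    by (rule one_divide_antimono_ennreal)
  then show ?thesis
    using gdp pdc far by (auto simp: feasible_def GDECuSum_def Let_def intro: order_trans)
qed

text \<open>With change point \<open>Suc n\<close>, an alarm at the first post-change sample has
  delay 0, hence the subtraction of 1 from the alarm time. A finite supremum of the skip counts is
  attained, which supplies the natural number \<open>k\<close> of the pathwise comparison; an
  infinite one makes the bound trivial.\<close>

lemma gd_delay_pointwise:
  assumes A: "0 < A" and w: "w = W n \<omega>" and v: "v = (\<lambda>i. \<omega> (Suc (n + i)))"
  shows "ennreal_of_enat (gd_time A \<omega>) - of_nat (Suc n)
    \<le> (alarm x0 A (\<lambda>i. selected i w v) - 1) + (SUP i. of_nat (skipped i w v))"
proof (cases "(SUP i. of_nat (skipped i w v)) = (top :: ennreal)")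
  case False
  let ?Z = "SUP i. of_nat (skipped i w v) :: ennreal"
  obtain N :: nat where N: "?Z \<le> of_nat N"
  proof -
    have "?Z < top" using False by (simp only: less_top)
    then obtain N where "?Z < of_nat N" using ennreal_Ex_less_of_nat by blast
    then show thesis by (intro that[of N] less_imp_le)
  qed
  have le_N: "skipped i w v \<le> N" for i
  proof -
    have "of_nat (skipped i w v) \<le> ?Z" by (rule SUP_upper) simp
    with N have "of_nat (skipped i w v) \<le> (of_nat N :: ennreal)" by (rule order_trans[rotated])
    then show ?thesis by simp
  qed
  have "range (\<lambda>i. skipped i w v) \<subseteq> {..N}"
    by (rule image_subsetI) (simp only: atMost_iff le_N)
  then have fin: "finite (range (\<lambda>i. skipped i w v))"
    by (rule finite_subset) simp
  define k where "k = Max (range (\<lambda>i. skipped i w v))"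
  have k: "skipped i w v \<le> k" for i unfolding k_def by (rule Max_ge[OF fin rangeI])
  have "k \<in> range (\<lambda>i. skipped i w v)" unfolding k_def by (rule Max_in[OF fin]) simp
  then obtain i where i: "k = skipped i w v" by (rule imageE)
  have kZ: "of_nat k \<le> ?Z" unfolding i by (rule SUP_upper) simp
  let ?g = "gc_time A (case_nat x0 (\<lambda>i. selected i w v))"
  have "gd_time A \<omega> \<le> enat n + (?g + enat k)"
    using gd_time_le_gc_time[OF A, of n \<omega> k x0] k by (simp add: w v)
  also have "\<dots> = enat n + ?g + enat k" by (simp add: add.assoc)
  finally have "ennreal_of_enat (gd_time A \<omega>) \<le> ennreal_of_enat (enat n + ?g + enat k)"
    by (simp only: ennreal_of_enat_le_iff)
  then have "ennreal_of_enat (gd_time A \<omega>) - of_nat (Suc n) \<le> of_nat n + ennreal_of_enat ?g + of_nat k - of_nat (Suc n)"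
    by (intro ennreal_minus_mono) simp_all
  also have "\<dots> \<le> (alarm x0 A (\<lambda>i. selected i w v) - 1) + of_nat k"
  proof (cases ?g)
    case (enat j)
    then obtain m where m: "j = Suc m"
      using glr_time_ge_1[of f0 f \<Theta> "\<lambda>_ _. True" A "case_nat x0 (\<lambda>i. selected i w v)"] by (cases j) (auto simp: one_enat_def)
    have e1: "of_nat n + ennreal_of_enat ?g + of_nat k = (of_nat (Suc n) + of_nat (m + k) :: ennreal)"
      unfolding enat m by (simp add: ac_simps)
    have e2: "alarm x0 A (\<lambda>i. selected i w v) - 1 = of_nat m"
      unfolding alarm_def enat m by simp
    show ?thesis unfolding e1 e2 by (subst ennreal_add_diff_cancel_left) simp_all
  qed (simp add: alarm_def)
  also have "\<dots> \<le> (alarm x0 A (\<lambda>i. selected i w v) - 1) + ?Z"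
    using kZ by (rule add_left_mono)
  finally show ?thesis .
next
  case True
  then show ?thesis by (simp only: add_top_right_ennreal top_greatest)
qed

text \<open>One estimate for both metrics: \<open>B\<close> is the event of no alarm before \<gamma>
  for the conditional average delay, and an arbitrary past event for the worst case. With the past
  \<open>u\<close> fixed, the control state and the indicator of \<open>B\<close> are constants and
  the selected samples are again i.i.d., so the inner integral has a bound independent of
  \<open>u\<close>.\<close>

lemma gd_delay_on_past_event:
  assumes A: "0 < A" and x0: "x0 \<in> space M" and q: "is_density M q"
    and gc: "gc_time A \<in> measurable (seqM M) (count_space UNIV)"
    and gd: "gd_time A \<in> measurable (seqM M) (count_space UNIV)"
    and K: "\<And>w. - ereal h \<le> w \<Longrightarrow> (\<integral>\<^sup>+v. (SUP i. of_nat (skipped i w v)) \<partial>no_change M q) \<le> K"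
    and \<gamma>: "1 \<le> \<gamma>" and B: "B \<in> sets (observed M S (enat (\<gamma> - 1)))"
  shows "(\<integral>\<^sup>+\<omega>. (ennreal_of_enat (gd_time A \<omega>) - of_nat \<gamma>) * indicator B \<omega> \<partial>change_at M f0 q \<gamma>)
    \<le> ((\<integral>\<^sup>+v. alarm x0 A v - 1 \<partial>no_change M q) + K) * emeasure (change_at M f0 q \<gamma>) B"
proof -
  let ?Q = "no_change M q" and ?P = "no_change M f0"
  let ?D = "\<integral>\<^sup>+v. alarm x0 A v - 1 \<partial>?Q"
  interpret NQ: prob_space ?Q by (rule prob_space_no_change[OF q])
  obtain n where n: "\<gamma> = Suc n" using \<gamma> by (cases \<gamma>) auto
  have BM: "B \<in> sets (seqM M)" by (rule subsetD[OF observed_subset_seqM[OF S_sets] B])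
  have indB: "indicator B \<in> borel_measurable (seqM M)" using BM by simp
  have T_meas: "(\<lambda>\<omega>. ennreal_of_enat (gd_time A \<omega>) - of_nat \<gamma>) \<in> borel_measurable (seqM M)"
    by (intro borel_measurable_minus_ennreal measurable_ennreal_of_enat_comp[OF gd]) simp_all
  have al_meas: "(\<lambda>v. alarm x0 A v - 1) \<in> borel_measurable (seqM M)"
    by (intro borel_measurable_minus_ennreal alarm_measurable[OF x0 gc]) simp_all
  have sel_meas: "(\<lambda>v. alarm x0 A (\<lambda>i. selected i w v) - 1) \<in> borel_measurable ?Q" for w
    using measurable_compose[OF measurable_selected_seq al_meas] by simp
  have Z_meas: "(\<lambda>v. SUP i. of_nat (skipped i w v) :: ennreal) \<in> borel_measurable ?Q" for w
  proof (rule borel_measurable_SUP)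
    have "(\<lambda>v. skipped i w v) \<in> measurable ?Q (count_space UNIV)" for i
      by (rule measurable_skipped) simp_all
    then show "(\<lambda>v. of_nat (skipped i w v) :: ennreal) \<in> borel_measurable ?Q" for i
      by (rule measurable_compose) simp
  qed simp
  have inner: "(\<integral>\<^sup>+v. (ennreal_of_enat (gd_time A (comb_seq \<gamma> u v)) - of_nat \<gamma>) * indicator B (comb_seq \<gamma> u v) \<partial>?Q)
    \<le> (?D + K) * (\<integral>\<^sup>+v. indicator B (comb_seq \<gamma> u v) \<partial>?Q)" if u: "u \<in> space (seqM M)" for u
  proof -
    \<comment> \<open>The indicator does not depend on the continuation of \<open>u\<close>; using
      \<open>u\<close> itself as the continuation names its value.\<close>
    define b :: ennreal where "b = indicator B (comb_seq \<gamma> u u)"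
    have b: "indicator B (comb_seq \<gamma> u v) = b" if v: "v \<in> space (seqM M)" for v
      using observed_determined[of \<gamma> S, OF S_comb_seq B u v u] by (simp add: b_def indicator_def)
    define w where "w = W n u"
    have w: "w = W n (comb_seq \<gamma> u v)" for v
      unfolding w_def n by (rule W_cong) (simp add: comb_seq_less)
    have v: "v = (\<lambda>i. comb_seq \<gamma> u v (Suc (n + i)))" for v
      unfolding n by (simp add: comb_seq_def fun_eq_iff)
    have "(\<integral>\<^sup>+v. (ennreal_of_enat (gd_time A (comb_seq \<gamma> u v)) - of_nat \<gamma>) * indicator B (comb_seq \<gamma> u v) \<partial>?Q)
      \<le> (\<integral>\<^sup>+v. ((alarm x0 A (\<lambda>i. selected i w v) - 1) + (SUP i. of_nat (skipped i w v))) * b \<partial>?Q)"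
    proof (rule nn_integral_mono)
      fix v assume "v \<in> space ?Q"
      then have "indicator B (comb_seq \<gamma> u v) = b" by (intro b) simp
      then show "(ennreal_of_enat (gd_time A (comb_seq \<gamma> u v)) - of_nat \<gamma>) * indicator B (comb_seq \<gamma> u v)
        \<le> ((alarm x0 A (\<lambda>i. selected i w v) - 1) + (SUP i. of_nat (skipped i w v))) * b"
        using gd_delay_pointwise[OF A w v, of v x0] unfolding n[symmetric] by (simp add: mult_right_mono)
    qed
    also have "\<dots> = (\<integral>\<^sup>+v. (alarm x0 A (\<lambda>i. selected i w v) - 1) + (SUP i. of_nat (skipped i w v)) \<partial>?Q) * b"
      using sel_meas Z_meas by (intro nn_integral_multc borel_measurable_add)
    also have "(\<integral>\<^sup>+v. (alarm x0 A (\<lambda>i. selected i w v) - 1) + (SUP i. of_nat (skipped i w v)) \<partial>?Q)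
      = (\<integral>\<^sup>+v. (alarm x0 A (\<lambda>i. selected i w v) - 1) \<partial>?Q) + (\<integral>\<^sup>+v. (SUP i. of_nat (skipped i w v)) \<partial>?Q)"
      by (rule nn_integral_add[OF sel_meas Z_meas])
    also have "(\<integral>\<^sup>+v. (alarm x0 A (\<lambda>i. selected i w v) - 1) \<partial>?Q) = ?D"
      by (rule nn_integral_selected[OF q al_meas])
    also have "(?D + (\<integral>\<^sup>+v. (SUP i. of_nat (skipped i w v)) \<partial>?Q)) * b \<le> (?D + K) * b"
      using K[of w] W_ge[of n u] by (intro mult_right_mono add_left_mono) (simp_all add: w_def)
    also have "b = (\<integral>\<^sup>+v. indicator B (comb_seq \<gamma> u v) \<partial>?Q)"
    proof -
      have "(\<integral>\<^sup>+v. indicator B (comb_seq \<gamma> u v) \<partial>?Q) = (\<integral>\<^sup>+v. b \<partial>?Q)"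
        by (intro nn_integral_cong b) simp
      then show ?thesis using NQ.emeasure_space_1 by simp
    qed
    finally show ?thesis .
  qed
  have "(\<integral>\<^sup>+\<omega>. (ennreal_of_enat (gd_time A \<omega>) - of_nat \<gamma>) * indicator B \<omega> \<partial>change_at M f0 q \<gamma>)
    = (\<integral>\<^sup>+u. \<integral>\<^sup>+v. (ennreal_of_enat (gd_time A (comb_seq \<gamma> u v)) - of_nat \<gamma>) * indicator B (comb_seq \<gamma> u v) \<partial>?Q \<partial>?P)"
    by (rule nn_integral_change_at[OF density_f0 q borel_measurable_times_ennreal[OF T_meas indB]])
  also have "\<dots> \<le> (\<integral>\<^sup>+u. (?D + K) * (\<integral>\<^sup>+v. indicator B (comb_seq \<gamma> u v) \<partial>?Q) \<partial>?P)"
    by (intro nn_integral_mono inner) simp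
  also have "\<dots> = (?D + K) * (\<integral>\<^sup>+u. \<integral>\<^sup>+v. indicator B (comb_seq \<gamma> u v) \<partial>?Q \<partial>?P)"
  proof (rule nn_integral_cmult, rule NQ.borel_measurable_nn_integral)
    have "(\<lambda>x. comb_seq \<gamma> (fst x) (snd x)) \<in> measurable (?P \<Otimes>\<^sub>M ?Q) (seqM M)"
      by measurable
    from measurable_compose[OF this indB]
    show "(\<lambda>(u, v). indicator B (comb_seq \<gamma> u v) :: ennreal) \<in> borel_measurable (?P \<Otimes>\<^sub>M ?Q)"
      by (simp add: split_beta')
  qed
  also have "(\<integral>\<^sup>+u. \<integral>\<^sup>+v. indicator B (comb_seq \<gamma> u v) \<partial>?Q \<partial>?P) = (\<integral>\<^sup>+\<omega>. indicator B \<omega> \<partial>change_at M f0 q \<gamma>)"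
    by (rule nn_integral_change_at[OF density_f0 q indB, symmetric])
  also have "\<dots> = emeasure (change_at M f0 q \<gamma>) B"
    using BM by simp
  finally show ?thesis .
qed

lemma subalgebra_observed:
  assumes "\<And>k. 1 \<le> k \<Longrightarrow> {\<omega>\<in>space (seqM M). C k \<omega>} \<in> sets (seqM M)"
  shows "subalgebra (change_at M p q n) (observed M C t)"
  using observed_subset_seqM[OF assms] by (simp add: subalgebra_def)

text \<open>At change point 1 the event of no earlier alarm is the whole space, so the conditional
  average is the plain mean; for the worst case, the mean is the integral of the conditional mean
  and so lies below its essential supremum.\<close>

lemma gc_delay_ge:
  assumes x0: "x0 \<in> space M" and q: "is_density M q"
    and gc: "gc_time A \<in> measurable (seqM M) (count_space UNIV)"
  shows "(\<integral>\<^sup>+v. alarm x0 A v - 1 \<partial>no_change M q) \<le> CADD M f0 q (GCuSum f0 f \<Theta> A)"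
    and "(\<integral>\<^sup>+v. alarm x0 A v - 1 \<partial>no_change M q) \<le> WADD M f0 q (GCuSum f0 f \<Theta> A)"
proof -
  let ?P = "change_at M f0 q 1"
  interpret P: prob_space ?P by (rule prob_space_change_at[OF density_f0 q])
  have g: "(\<lambda>x::ennreal. x - 1) \<in> borel_measurable borel" by measurable
  have T_meas: "(\<lambda>\<omega>. ennreal_of_enat (gc_time A \<omega>) - of_nat 1) \<in> borel_measurable ?P"
    using borel_measurable_minus_ennreal[OF measurable_ennreal_of_enat_comp[OF gc], of "\<lambda>_. 1"] by simp
  have int: "(\<integral>\<^sup>+v. alarm x0 A v - 1 \<partial>no_change M q) = (\<integral>\<^sup>+\<omega>. ennreal_of_enat (gc_time A \<omega>) - of_nat 1 \<partial>?P)"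
    using gc_time_integral[OF q x0 gc g] by simp
  have ge1: "enat 1 \<le> gc_time A \<omega>" for \<omega>
    using glr_time_ge_1[of f0 f \<Theta> "\<lambda>_ _. True" A \<omega>] by (simp add: one_enat_def)
  have "(\<integral>\<^sup>+v. alarm x0 A v - 1 \<partial>no_change M q) =
    (\<integral>\<^sup>+\<omega>\<in>{\<omega>. enat 1 \<le> gc_time A \<omega>}. (ennreal_of_enat (gc_time A \<omega>) - of_nat 1) \<partial>?P)
       / emeasure ?P {\<omega>\<in>space ?P. enat 1 \<le> gc_time A \<omega>}"
    unfolding int using ge1 P.emeasure_space_1 by (simp add: divide_ennreal_def)
  also have "\<dots> \<le> CADD M f0 q (GCuSum f0 f \<Theta> A)"
    unfolding CADD_def GCuSum_def Let_def prod.case by (rule SUP_upper) simp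
  finally show "(\<integral>\<^sup>+v. alarm x0 A v - 1 \<partial>no_change M q) \<le> CADD M f0 q (GCuSum f0 f \<Theta> A)" .
  have "(\<integral>\<^sup>+v. alarm x0 A v - 1 \<partial>no_change M q) \<le> esssup ?P (nn_cond_exp ?P (observed M (\<lambda>_ _. True) (enat (1 - 1)))
                   (\<lambda>\<omega>. ennreal_of_enat (gc_time A \<omega>) - of_nat 1))"
    unfolding int by (rule P.nn_integral_le_esssup_nn_cond_exp[OF subalgebra_observed T_meas]) simp
  also have "\<dots> \<le> WADD M f0 q (GCuSum f0 f \<Theta> A)"
    unfolding WADD_def GCuSum_def Let_def prod.case by (rule SUP_upper) simp
  finally show "(\<integral>\<^sup>+v. alarm x0 A v - 1 \<partial>no_change M q) \<le> WADD M f0 q (GCuSum f0 f \<Theta> A)" .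
qed

lemma gd_delay_le:
  assumes A: "0 < A" and x0: "x0 \<in> space M" and q: "is_density M q"
    and gc: "gc_time A \<in> measurable (seqM M) (count_space UNIV)"
    and K: "\<And>w. - ereal h \<le> w \<Longrightarrow> (\<integral>\<^sup>+v. (SUP i. of_nat (skipped i w v)) \<partial>no_change M q) \<le> K"
  shows "CADD M f0 q (GDECuSum f0 f \<Theta> \<theta>s \<mu> h A) \<le> (\<integral>\<^sup>+v. alarm x0 A v - 1 \<partial>no_change M q) + K"
    and "WADD M f0 q (GDECuSum f0 f \<Theta> \<theta>s \<mu> h A) \<le> (\<integral>\<^sup>+v. alarm x0 A v - 1 \<partial>no_change M q) + K"
proof -
  let ?c = "(\<integral>\<^sup>+v. alarm x0 A v - 1 \<partial>no_change M q) + K"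
  note pol = gd_policy[OF A gc]
  note gd = gd_time_measurable(1)[OF pol]
  note key = gd_delay_on_past_event[OF A x0 q gc gd K]
  show "CADD M f0 q (GDECuSum f0 f \<Theta> \<theta>s \<mu> h A) \<le> ?c"
    unfolding CADD_def GDECuSum_def Let_def prod.case
  proof (rule SUP_least)
    fix \<gamma> :: nat assume \<gamma>: "\<gamma> \<in> {1..}"
    let ?P = "change_at M f0 q \<gamma>"
    interpret P: prob_space ?P by (rule prob_space_change_at[OF density_f0 q])
    define B where "B = {\<omega>\<in>space ?P. enat \<gamma> \<le> gd_time A \<omega>}"
    obtain n where n: "\<gamma> = Suc n" using \<gamma> by (cases \<gamma>) auto
    have lt: "enat \<gamma> \<le> t \<longleftrightarrow> \<not> t \<le> enat (\<gamma> - 1)" for t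
      unfolding n by (cases t) auto
    \<comment> \<open>Having no alarm before \<gamma> is decided by the data up to \<gamma> -
      1.\<close>
    have "B = space (observed M S (enat (\<gamma> - 1))) - {\<omega>\<in>space (seqM M). gd_time A \<omega> \<le> enat (\<gamma> - 1)}"
      unfolding B_def lt by auto
    also have "\<dots> \<in> sets (observed M S (enat (\<gamma> - 1)))"
      by (intro sets.compl_sets gd_time_measurable(2)[OF pol])
    finally have B: "B \<in> sets (observed M S (enat (\<gamma> - 1)))" .
    have "(\<integral>\<^sup>+\<omega>\<in>{\<omega>. enat \<gamma> \<le> gd_time A \<omega>}. (ennreal_of_enat (gd_time A \<omega>) - of_nat \<gamma>) \<partial>?P)
      = (\<integral>\<^sup>+\<omega>. (ennreal_of_enat (gd_time A \<omega>) - of_nat \<gamma>) * indicator B \<omega> \<partial>?P)"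
      by (intro nn_integral_cong) (simp add: B_def indicator_def)
    also have "\<dots> \<le> ?c * emeasure ?P B"
      by (rule key[OF _ _ B]) (use \<gamma> in auto)
    finally have le: "(\<integral>\<^sup>+\<omega>\<in>{\<omega>. enat \<gamma> \<le> gd_time A \<omega>}. (ennreal_of_enat (gd_time A \<omega>) - of_nat \<gamma>) \<partial>?P)
      \<le> ?c * emeasure ?P B" .
    show "(\<integral>\<^sup>+\<omega>\<in>{\<omega>. enat \<gamma> \<le> gd_time A \<omega>}. (ennreal_of_enat (gd_time A \<omega>) - of_nat \<gamma>) \<partial>?P)
       / emeasure ?P {\<omega>\<in>space ?P. enat \<gamma> \<le> gd_time A \<omega>} \<le> ?c"
    proof (cases "emeasure ?P B = 0")
      \<comment> \<open>On a null event the estimate makes the numerator 0 as well, and 0 / 0 is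
        0.\<close>
      case True
      then show ?thesis using le by (simp add: B_def[symmetric])
    next
      case False
      then show ?thesis
        using divide_right_mono_ennreal[OF le, of "emeasure ?P B"] P.emeasure_finite[of B]
        unfolding B_def[symmetric] by (simp add: ennreal_mult_divide_eq)
    qed
  qed
  show "WADD M f0 q (GDECuSum f0 f \<Theta> \<theta>s \<mu> h A) \<le> ?c"
    unfolding WADD_def GDECuSum_def Let_def prod.case
  proof (rule SUP_least)
    fix \<gamma> :: nat assume \<gamma>: "\<gamma> \<in> {1..}"
    let ?P = "change_at M f0 q \<gamma>"
    interpret P: prob_space ?P by (rule prob_space_change_at[OF density_f0 q])
    have T_meas: "(\<lambda>\<omega>. ennreal_of_enat (gd_time A \<omega>) - of_nat \<gamma>) \<in> borel_measurable ?P"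
      using borel_measurable_minus_ennreal[OF measurable_ennreal_of_enat_comp[OF gd], of "\<lambda>_. of_nat \<gamma>"] by simp
    show "esssup ?P (nn_cond_exp ?P (observed M S (enat (\<gamma> - 1)))
                   (\<lambda>\<omega>. ennreal_of_enat (gd_time A \<omega>) - of_nat \<gamma>)) \<le> ?c"
      by (rule P.esssup_nn_cond_exp_le[OF subalgebra_observed[OF S_sets] T_meas key])
        (use \<gamma> in auto)
  qed
qed

end

section \<open>The delay of GCuSum diverges\<close>

text \<open>The likelihood ratio may be unbounded, so it is truncated: outside an event of
  q-probability at most n times that of q > c p, each of the first \<open>n\<close> samples
  satisfies q \<le> c p, and there the law of the prefix under q is at most c^n times its law under
  p.\<close>

lemma emeasure_no_change_prefix_le:
  assumes p: "is_density M p" and q: "is_density M q" and c: "0 \<le> c"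
    and E: "E \<in> sets (seqM M)"
    and prefix: "\<And>v v'. v \<in> space (seqM M) \<Longrightarrow> v' \<in> space (seqM M) \<Longrightarrow> (\<And>i. i < n \<Longrightarrow> v i = v' i) \<Longrightarrow>
      v \<in> E \<longleftrightarrow> v' \<in> E"
  shows "emeasure (no_change M q) E \<le>
    of_nat n * emeasure (dens M q) {x\<in>space M. c * p x < q x} + ennreal c ^ n * emeasure (no_change M p) E"
  using E prefix
proof (induction n arbitrary: E)
  case 0
  interpret NP: prob_space "no_change M p" by (rule prob_space_no_change[OF p])
  interpret NQ: prob_space "no_change M q" by (rule prob_space_no_change[OF q])
  show ?case
  proof (cases "E = {}")
    case False
    then obtain v where v: "v \<in> E" by auto
    then have "v \<in> space (seqM M)" using sets.sets_into_space[OF 0(1)] by blast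
    then have "E = space (seqM M)"
      using 0(2)[of v] v sets.sets_into_space[OF 0(1)] by blast
    then show ?thesis using NP.emeasure_space_1 NQ.emeasure_space_1 by simp
  qed simp
next
  case (Suc n)
  let ?P = "no_change M p" and ?Q = "no_change M q"
  let ?b = "emeasure (dens M q) {x\<in>space M. c * p x < q x}"
  interpret NP: prob_space ?P by (rule prob_space_no_change[OF p])
  interpret NQ: prob_space ?Q by (rule prob_space_no_change[OF q])
  interpret Q1: prob_space "dens M q" by (rule prob_space_dens[OF q])
  have [measurable]: "p \<in> borel_measurable M" "q \<in> borel_measurable M"
    and pos: "\<And>x. x \<in> space M \<Longrightarrow> 0 \<le> p x" "\<And>x. x \<in> space M \<Longrightarrow> 0 \<le> q x"
    using p q by (auto simp: is_density_def)
  define Ey where "Ey y = {v\<in>space (seqM M). case_nat y v \<in> E}" for y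
  have cn: "(\<lambda>v. case_nat y v) \<in> measurable (seqM M) (seqM M)" if "y \<in> space M" for y
    using that by (intro measurable_case_nat') simp_all
  have Ey: "Ey y \<in> sets (seqM M)" if "y \<in> space M" for y
    using measurable_sets[OF cn[OF that] Suc.prems(1)] by (simp add: Ey_def vimage_def Int_def conj_commute)
  have int_E: "emeasure (no_change M r) E = (\<integral>\<^sup>+y. emeasure (no_change M r) (Ey y) \<partial>dens M r)"
    if r: "is_density M r" for r
  proof -
    have "emeasure (no_change M r) E = (\<integral>\<^sup>+v. indicator E v \<partial>no_change M r)"
      using Suc.prems(1) by simp
    also have "\<dots> = (\<integral>\<^sup>+y. \<integral>\<^sup>+v. indicator E (case_nat y v) \<partial>no_change M r \<partial>dens M r)"
      using Suc.prems(1) by (intro nn_integral_no_change_case_nat[OF r]) simp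
    also have "\<dots> = (\<integral>\<^sup>+y. emeasure (no_change M r) (Ey y) \<partial>dens M r)"
    proof (rule nn_integral_cong)
      fix y assume "y \<in> space (dens M r)"
      then have y: "Ey y \<in> sets (no_change M r)" using Ey by simp
      show "(\<integral>\<^sup>+v. indicator E (case_nat y v) \<partial>no_change M r) = emeasure (no_change M r) (Ey y)"
        unfolding nn_integral_indicator[OF y, symmetric]
        by (intro nn_integral_cong) (simp add: Ey_def indicator_def)
    qed
    finally show ?thesis .
  qed
  have Ey_meas: "(\<lambda>y. emeasure ?P (Ey y)) \<in> borel_measurable M"
  proof -
    have m: "(\<lambda>x. case_nat (fst x) (snd x)) \<in> measurable (M \<Otimes>\<^sub>M ?P) (seqM M)"
      by measurable
    have ind: "indicator E \<in> borel_measurable (seqM M)" using Suc.prems(1) by simp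
    have "(\<lambda>(y, v). indicator E (case_nat y v) :: ennreal) \<in> borel_measurable (M \<Otimes>\<^sub>M ?P)"
      using measurable_compose[OF m ind] by (simp add: split_beta')
    then have "(\<lambda>y. \<integral>\<^sup>+v. indicator E (case_nat y v) \<partial>?P) \<in> borel_measurable M"
      by (rule NP.borel_measurable_nn_integral)
    also have "(\<lambda>y. \<integral>\<^sup>+v. indicator E (case_nat y v) \<partial>?P) \<in> borel_measurable M \<longleftrightarrow> ?thesis"
    proof (rule measurable_cong)
      fix y assume "y \<in> space M"
      then have y: "Ey y \<in> sets ?P" using Ey by simp
      show "(\<integral>\<^sup>+v. indicator E (case_nat y v) \<partial>?P) = emeasure ?P (Ey y)"
        unfolding nn_integral_indicator[OF y, symmetric]
        by (intro nn_integral_cong) (simp add: Ey_def indicator_def)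
    qed
    finally show ?thesis .
  qed
  let ?B = "{x\<in>space M. c * p x < q x}"
  have B: "?B \<in> sets M" by measurable
  \<comment> \<open>A first sample with large ratio is charged to the indicator, where the trivial
    bound 1 suffices; otherwise the section \<open>Ey y\<close>, which depends on \<open>n\<close>
    samples only, is handled by induction.\<close>
  have bound: "emeasure ?Q (Ey y) \<le> indicator ?B y +
      (of_nat n * ?b + ennreal c ^ n * (emeasure ?P (Ey y) * indicator (space M - ?B) y))" if y: "y \<in> space M" for y
  proof (cases "y \<in> ?B")
    case True
    have "emeasure ?Q (Ey y) \<le> 1" by (rule NQ.measure_le_1)
    also have "1 \<le> indicator ?B y + (of_nat n * ?b + ennreal c ^ n * (emeasure ?P (Ey y) * indicator (space M - ?B) y))"
      using True by simp
    finally show ?thesis .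
  next
    case False
    have "emeasure ?Q (Ey y) \<le> of_nat n * ?b + ennreal c ^ n * emeasure ?P (Ey y)"
    proof (rule Suc.IH[OF Ey[OF y]])
      fix v v' assume v: "v \<in> space (seqM M)" "v' \<in> space (seqM M)" "\<And>i. i < n \<Longrightarrow> v i = v' i"
      then have "case_nat y v \<in> E \<longleftrightarrow> case_nat y v' \<in> E"
        using measurable_space[OF cn[OF y]] by (intro Suc.prems(2)) (auto split: nat.split)
      then show "v \<in> Ey y \<longleftrightarrow> v' \<in> Ey y" using v by (simp add: Ey_def)
    qed
    then show ?thesis using False y by simp
  qed
  have "(\<integral>\<^sup>+y. emeasure ?P (Ey y) * indicator (space M - ?B) y \<partial>dens M q)
      = (\<integral>\<^sup>+y. ennreal (q y) * (emeasure ?P (Ey y) * indicator (space M - ?B) y) \<partial>M)"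
    using Ey_meas B by (intro nn_integral_density) simp_all
  \<comment> \<open>Off \<open>?B\<close>, q \<le> c p changes the law of the first sample from q to
    p at the cost of one factor \<open>c\<close>.\<close>
  also have "\<dots> \<le> (\<integral>\<^sup>+y. ennreal c * (ennreal (p y) * emeasure ?P (Ey y)) \<partial>M)"
  proof (rule nn_integral_mono)
    fix y assume y: "y \<in> space M"
    show "ennreal (q y) * (emeasure ?P (Ey y) * indicator (space M - ?B) y) \<le> ennreal c * (ennreal (p y) * emeasure ?P (Ey y))"
    proof (cases "y \<in> ?B")
      case False
      then have "ennreal (q y) \<le> ennreal (c * p y)" using y by (intro ennreal_leI) simp
      also have "\<dots> = ennreal c * ennreal (p y)" using c pos(1)[OF y] by (rule ennreal_mult)
      finally have "ennreal (q y) * emeasure ?P (Ey y) \<le> ennreal c * ennreal (p y) * emeasure ?P (Ey y)"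
        by (rule mult_right_mono) simp
      then show ?thesis using False y by (simp add: mult.assoc)
    qed simp
  qed
  also have "\<dots> = ennreal c * (\<integral>\<^sup>+y. ennreal (p y) * emeasure ?P (Ey y) \<partial>M)"
    by (intro nn_integral_cmult borel_measurable_times_ennreal Ey_meas) measurable
  also have "(\<integral>\<^sup>+y. ennreal (p y) * emeasure ?P (Ey y) \<partial>M) = (\<integral>\<^sup>+y. emeasure ?P (Ey y) \<partial>dens M p)"
    using Ey_meas by (intro nn_integral_density[symmetric]) simp_all
  also have "\<dots> = emeasure ?P E" by (rule int_E[OF p, symmetric])
  finally have main: "(\<integral>\<^sup>+y. emeasure ?P (Ey y) * indicator (space M - ?B) y \<partial>dens M q) \<le> ennreal c * emeasure ?P E" .
  have "emeasure ?Q E \<le> (\<integral>\<^sup>+y. indicator ?B y +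
      (of_nat n * ?b + ennreal c ^ n * (emeasure ?P (Ey y) * indicator (space M - ?B) y)) \<partial>dens M q)"
    unfolding int_E[OF q] by (intro nn_integral_mono bound) simp
  also have "\<dots> = (\<integral>\<^sup>+y. indicator ?B y \<partial>dens M q) + ((\<integral>\<^sup>+y. of_nat n * ?b \<partial>dens M q) +
      ennreal c ^ n * (\<integral>\<^sup>+y. emeasure ?P (Ey y) * indicator (space M - ?B) y \<partial>dens M q))"
    using Ey_meas B by (subst nn_integral_add; (subst nn_integral_add)?; (subst nn_integral_cmult)?) simp_all
  also have "(\<integral>\<^sup>+y. indicator ?B y \<partial>dens M q) = ?b"
    using B by (intro nn_integral_indicator) simp
  also have "(\<integral>\<^sup>+y. of_nat n * ?b \<partial>dens M q) = of_nat n * ?b"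
    using Q1.emeasure_space_1 by simp
  also have "?b + (of_nat n * ?b + ennreal c ^ n * (\<integral>\<^sup>+y. emeasure ?P (Ey y) * indicator (space M - ?B) y \<partial>dens M q))
      \<le> ?b + (of_nat n * ?b + ennreal c ^ n * (ennreal c * emeasure ?P E))"
    by (intro add_left_mono mult_left_mono main) simp
  finally show ?case by (simp add: algebra_simps)
qed

text \<open>The sets decrease, and k p x < q x for all k forces p x = 0; this is a null event under
  p, hence under q by absolute continuity.\<close>

lemma density_ratio_tail:
  assumes p: "is_density M p" and q: "is_density M q"
    and ac: "absolutely_continuous (dens M p) (dens M q)"
  shows "(\<lambda>k. emeasure (dens M q) {x\<in>space M. real k * p x < q x}) \<longlonglongrightarrow> 0"
proof -
  interpret Q: prob_space "dens M q" by (rule prob_space_dens[OF q])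
  have [measurable]: "p \<in> borel_measurable M" "q \<in> borel_measurable M"
    and pos: "\<And>x. x \<in> space M \<Longrightarrow> 0 \<le> p x" "\<And>x. x \<in> space M \<Longrightarrow> 0 \<le> q x"
    using p q by (auto simp: is_density_def)
  let ?B = "\<lambda>k. {x\<in>space M. real k * p x < q x}"
  have "(\<lambda>k. emeasure (dens M q) (?B k)) \<longlonglongrightarrow> emeasure (dens M q) (\<Inter>k. ?B k)"
  proof (rule Lim_emeasure_decseq)
    show "decseq ?B"
    proof (rule decseq_SucI, rule subsetI)
      fix k x assume x: "x \<in> ?B (Suc k)"
      have "real k * p x \<le> real (Suc k) * p x" using x pos by (intro mult_right_mono) auto
      with x show "x \<in> ?B k" by simp
    qed
  qed auto
  moreover have "(\<Inter>k. ?B k) \<subseteq> {x\<in>space M. p x = 0}"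
  proof
    fix x assume x: "x \<in> (\<Inter>k. ?B k)"
    then have xM: "x \<in> space M" and less: "\<And>k. real k * p x < q x" by auto
    have "\<not> 0 < p x" using less reals_Archimedean3[of "p x"] by (metis less_asym)
    then show "x \<in> {x\<in>space M. p x = 0}" using pos(1)[OF xM] xM by simp
  qed
  moreover have "{x\<in>space M. p x = 0} \<in> null_sets (dens M q)"
  proof -
    have "{x\<in>space M. p x = 0} \<in> null_sets (dens M p)"
      by (subst null_sets_density_iff) (auto intro!: AE_I2)
    then show ?thesis using ac by (auto simp: absolutely_continuous_def)
  qed
  ultimately show ?thesis
    by (metis (no_types, lifting) emeasure_eq_0 null_setsD1 null_setsD2)
qed

context de_setting
begin

lemma AE_dens_positive:
  assumes p: "is_density M p" and ac: "absolutely_continuous (dens M p) (dens M q)"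
  shows "AE x in dens M q. p x \<noteq> 0"
proof -
  have [measurable]: "p \<in> borel_measurable M" using p by (simp add: is_density_def)
  have "{x\<in>space M. p x = 0} \<in> null_sets (dens M p)"
    by (subst null_sets_density_iff) (auto intro!: AE_I2)
  then have "{x\<in>space M. p x = 0} \<in> null_sets (dens M q)"
    using ac by (auto simp: absolutely_continuous_def)
  then show ?thesis by (rule AE_I') auto
qed

lemma skip_bound:
  assumes \<theta>: "\<theta> \<in> \<Theta>"
    and drift: "0 < (\<integral>\<omega>. ln (f \<theta>s (\<omega> 1) / f0 (\<omega> 1)) \<partial>change_at M f0 (f \<theta>) 1)"
  obtains K :: real where "0 \<le> K"
    "\<And>w. - ereal h \<le> w \<Longrightarrow> (\<integral>\<^sup>+v. (SUP i. of_nat (skipped i w v)) \<partial>no_change M (f \<theta>)) \<le> ennreal K"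
proof -
  let ?Y = "\<lambda>x. ln (f \<theta>s x / f0 x)"
  note q = density_f[OF \<theta>]
  note [measurable] = measurable_f[OF \<theta>s]
  have Y: "?Y \<in> borel_measurable M" by measurable
  have "distr (change_at M f0 (f \<theta>) 1) (dens M (f \<theta>)) (\<lambda>\<omega>. \<omega> 1) = dens M (f \<theta>)"
    unfolding change_at_def
    using distr_PiM_component[of UNIV "\<lambda>n. if n < 1 then dens M f0 else dens M (f \<theta>)" "1::nat"]
      prob_space_dens[OF q] prob_space_dens[OF density_f0] by simp
  then have "(\<integral>x. ?Y x \<partial>dens M (f \<theta>)) = (\<integral>x. ?Y x \<partial>distr (change_at M f0 (f \<theta>) 1) (dens M (f \<theta>)) (\<lambda>\<omega>. \<omega> 1))"
    by simp
  also have "\<dots> = (\<integral>\<omega>. ?Y (\<omega> 1) \<partial>change_at M f0 (f \<theta>) 1)"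
    using Y by (intro integral_distr) simp_all
  finally have pos: "0 < (\<integral>x. ?Y x \<partial>dens M (f \<theta>))" using drift by simp
  \<comment> \<open>The integral of a nonintegrable function is 0 by convention, so a positive value
    implies integrability.\<close>
  then have int: "integrable (dens M (f \<theta>)) ?Y"
    using not_integrable_integral_eq[of "dens M (f \<theta>)" ?Y] by auto
  \<comment> \<open>The law for \<theta> is dominated by that of \<open>f0\<close>, which is
    dominated by that of \<open>f \<theta>s\<close>. Hence almost surely neither density vanishes
    and the extended log-likelihood ratio is the real logarithm.\<close>
  have ac: "absolutely_continuous (dens M f0) (dens M (f \<theta>))"
    "absolutely_continuous (dens M (f \<theta>s)) (dens M f0)"
    using model \<theta> \<theta>s by (auto simp: qcd_model_def KL_finite_def)
  then have "absolutely_continuous (dens M (f \<theta>s)) (dens M (f \<theta>))"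
    by (auto simp: absolutely_continuous_def)
  then have "AE x in dens M (f \<theta>). f \<theta>s x \<noteq> 0" by (rule AE_dens_positive[OF density_f[OF \<theta>s]])
  moreover have "AE x in dens M (f \<theta>). f0 x \<noteq> 0" by (rule AE_dens_positive[OF density_f0 ac(1)])
  ultimately have "AE x in dens M (f \<theta>). llr f0 (f \<theta>s) x = ereal (?Y x)"
    by eventually_elim (simp add: llr_def)
  from skipped_total_bound[OF q int pos this] that show thesis by blast
qed

lemma gc_time_le_cong:
  assumes "\<And>i. i < n \<Longrightarrow> v i = v' i"
  shows "gc_time A (case_nat x0 v) \<le> enat n \<longleftrightarrow> gc_time A (case_nat x0 v') \<le> enat n"
proof -
  have "glr_stat f0 f \<Theta> (\<lambda>_ _. True) m (case_nat x0 v) = glr_stat f0 f \<Theta> (\<lambda>_ _. True) m (case_nat x0 v')"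
    if "m \<in> {1..n}" for m
    using that assms by (intro glr_stat_cong) (auto split: nat.split)
  then show ?thesis unfolding glr_time_le_iff by auto
qed

lemma alarm_early_set:
  assumes x0: "x0 \<in> space M" and gc: "gc_time A \<in> measurable (seqM M) (count_space UNIV)"
  shows "{v\<in>space (seqM M). gc_time A (case_nat x0 v) \<le> enat n} \<in> sets (seqM M)"
proof -
  have "{v\<in>space (seqM M). alarm x0 A v \<le> ennreal_of_enat (enat n)} \<in> sets (seqM M)"
    using alarm_measurable[OF x0 gc] by (intro borel_measurable_le) simp_all
  then show ?thesis unfolding alarm_def ennreal_of_enat_le_iff .
qed

text \<open>
  Restarting the test after every \<open>n\<close> samples bounds the mean time to a false alarm by \<open>n\<close>
  divided by the probability of an alarm within \<open>n\<close> samples.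
\<close>

lemma alarm_early_mult_mean:
  assumes x0: "x0 \<in> space M" and q: "is_density M q"
    and gc: "gc_time A \<in> measurable (seqM M) (count_space UNIV)"
  shows "emeasure (no_change M q) {v\<in>space (seqM M). gc_time A (case_nat x0 v) \<le> enat n}
    * (\<integral>\<^sup>+v. alarm x0 A v \<partial>no_change M q) \<le> of_nat n"
proof -
  let ?Q = "no_change M q"
  interpret NQ: prob_space ?Q by (rule prob_space_no_change[OF q])
  let ?E = "{v\<in>space (seqM M). gc_time A (case_nat x0 v) \<le> enat n}"
  let ?C = "space (seqM M) - ?E"
  note al = alarm_measurable[OF x0 gc]
  note E = alarm_early_set[OF x0 gc, of n]
  have C: "?C \<in> sets ?Q" using E by auto
  \<comment> \<open>Truncation keeps the mean finite so that it can be cancelled; monotone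
    convergence removes it at the end.\<close>
  define m where "m N v = min (alarm x0 A v) (of_nat N)" for N v
  have m_meas: "m N \<in> borel_measurable (seqM M)" for N
    unfolding m_def by (intro borel_measurable_min al) simp
  have le: "m N (comb_seq n u v) \<le> of_nat n + indicator ?C u * m N v" if u: "u \<in> space (seqM M)" for N u v
  proof (cases "u \<in> ?E")
    case True
    then have "gc_time A (case_nat x0 (comb_seq n u v)) \<le> enat n"
      using gc_time_le_cong[of n "comb_seq n u v" u A x0] by (simp add: comb_seq_less)
    then have "alarm x0 A (comb_seq n u v) \<le> of_nat n"
      unfolding alarm_def by (simp only: ennreal_of_enat_le_iff flip: ennreal_of_enat_enat)
    then show ?thesis unfolding m_def by (auto intro: min.coboundedI1 order_trans)
  next
    case False
    have "gc_time A (case_nat x0 (comb_seq n u v)) \<le> enat n + gc_time A (case_nat x0 v)"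
    proof (rule glr_time_le_shift)
      fix i :: nat assume "1 \<le> i"
      then obtain j where "i = Suc j" by (cases i) auto
      then show "True = True \<and> (True \<longrightarrow> case_nat x0 (comb_seq n u v) (n + i) = case_nat x0 v i)"
        by (simp add: comb_seq_def)
    qed
    then have "ennreal_of_enat (gc_time A (case_nat x0 (comb_seq n u v))) \<le> ennreal_of_enat (enat n + gc_time A (case_nat x0 v))"
      by (simp only: ennreal_of_enat_le_iff)
    then have al_le: "alarm x0 A (comb_seq n u v) \<le> of_nat n + alarm x0 A v"
      by (simp add: alarm_def)
    have "m N (comb_seq n u v) \<le> of_nat n + m N v"
      unfolding m_def
    proof (cases "alarm x0 A v \<le> of_nat N")
      case True
      then show "min (alarm x0 A (comb_seq n u v)) (of_nat N) \<le> of_nat n + min (alarm x0 A v) (of_nat N)"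
        using al_le by (simp add: min.coboundedI1)
    next
      case False
      then show "min (alarm x0 A (comb_seq n u v)) (of_nat N) \<le> of_nat n + min (alarm x0 A v) (of_nat N)"
        by (intro min.coboundedI2) (simp add: min_def)
    qed
    then show ?thesis using False u by simp
  qed
  have mean_le: "emeasure ?Q ?E * (\<integral>\<^sup>+v. m N v \<partial>?Q) \<le> of_nat n" for N
  proof -
    let ?e = "\<integral>\<^sup>+v. m N v \<partial>?Q"
    have fin: "?e \<noteq> top"
    proof -
      have "?e \<le> (\<integral>\<^sup>+v. of_nat N \<partial>?Q)" by (intro nn_integral_mono) (simp add: m_def)
      also have "\<dots> < top" using NQ.emeasure_space_1 by (simp add: less_top[symmetric])
      finally show ?thesis by simp
    qed
    have "?e = (\<integral>\<^sup>+u. \<integral>\<^sup>+v. m N (comb_seq n u v) \<partial>?Q \<partial>?Q)"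
      using nn_integral_change_at[OF q q m_meas, of n] by (simp add: change_at_same)
    also have "\<dots> \<le> (\<integral>\<^sup>+u. \<integral>\<^sup>+v. of_nat n + indicator ?C u * m N v \<partial>?Q \<partial>?Q)"
      by (intro nn_integral_mono le) simp
    also have "\<dots> = (\<integral>\<^sup>+u. of_nat n + indicator ?C u * ?e \<partial>?Q)"
    proof (intro nn_integral_cong)
      fix u
      have "(\<integral>\<^sup>+v. of_nat n + indicator ?C u * m N v \<partial>?Q) = (\<integral>\<^sup>+v. of_nat n \<partial>?Q) + (\<integral>\<^sup>+v. indicator ?C u * m N v \<partial>?Q)"
        using m_meas[of N] by (intro nn_integral_add) simp_all
      also have "(\<integral>\<^sup>+v. indicator ?C u * m N v \<partial>?Q) = indicator ?C u * ?e"
        using m_meas[of N] by (intro nn_integral_cmult) simp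
      finally show "(\<integral>\<^sup>+v. of_nat n + indicator ?C u * m N v \<partial>?Q) = of_nat n + indicator ?C u * ?e"
        using NQ.emeasure_space_1 by simp
    qed
    also have "\<dots> = (\<integral>\<^sup>+u. of_nat n \<partial>?Q) + (\<integral>\<^sup>+u. indicator ?C u * ?e \<partial>?Q)"
      using C by (intro nn_integral_add borel_measurable_times_ennreal borel_measurable_indicator) simp_all
    also have "(\<integral>\<^sup>+u. indicator ?C u * ?e \<partial>?Q) = emeasure ?Q ?C * ?e"
      using C by (subst nn_integral_multc) simp_all
    finally have e_le: "?e \<le> of_nat n + emeasure ?Q ?C * ?e" using NQ.emeasure_space_1 by simp
    have "emeasure ?Q ?E + emeasure ?Q ?C = emeasure ?Q (?E \<union> ?C)"
      using E C by (intro plus_emeasure) auto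
    also have "?E \<union> ?C = space ?Q" by auto
    finally have sum1: "emeasure ?Q ?E + emeasure ?Q ?C = 1" using NQ.emeasure_space_1 by simp
    have "emeasure ?Q ?C * ?e + emeasure ?Q ?E * ?e = (emeasure ?Q ?E + emeasure ?Q ?C) * ?e"
      by (simp add: distrib_right add.commute)
    also have "\<dots> = ?e" by (simp only: sum1 mult_1)
    also note e_le
    finally have "emeasure ?Q ?C * ?e + emeasure ?Q ?E * ?e \<le> emeasure ?Q ?C * ?e + of_nat n"
      by (simp add: add.commute)
    moreover have "emeasure ?Q ?C * ?e \<noteq> top"
      using fin NQ.emeasure_finite[of ?C] by (simp add: ennreal_mult_eq_top_iff)
    ultimately show ?thesis unfolding ennreal_add_left_cancel_le by auto
  qed
  have "(\<integral>\<^sup>+v. alarm x0 A v \<partial>?Q) = (\<integral>\<^sup>+v. (SUP N. m N v) \<partial>?Q)"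
  proof (rule nn_integral_cong)
    fix v
    show "alarm x0 A v = (SUP N. m N v)"
    proof (rule antisym)
      show "alarm x0 A v \<le> (SUP N. m N v)"
      proof (rule dense_le)
        fix y assume y: "y < alarm x0 A v"
        then have "y < top" by (rule less_le_trans) simp
        then obtain N :: nat where "y < of_nat N" using ennreal_Ex_less_of_nat by blast
        with y have "y \<le> m N v" by (simp add: m_def less_imp_le)
        then show "y \<le> (SUP N. m N v)" by (rule SUP_upper2[OF UNIV_I])
      qed
      show "(SUP N. m N v) \<le> alarm x0 A v" by (intro SUP_least) (simp add: m_def)
    qed
  qed
  also have "\<dots> = (SUP N. \<integral>\<^sup>+v. m N v \<partial>?Q)"
  proof (rule nn_integral_monotone_convergence_SUP)
    show "incseq m" unfolding m_def
      by (intro incseq_SucI le_funI min.mono order_refl of_nat_mono) simp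
    show "m N \<in> borel_measurable ?Q" for N using m_meas[of N] by simp
  qed
  finally show ?thesis
    using mean_le by (simp add: SUP_mult_left_ennreal SUP_le_iff)
qed

text \<open>The false alarm constraint bounds the mean alarm time below by 1 / \<alpha>, and the
  probability of an alarm within \<open>n\<close> samples times that mean is at most
  \<open>n\<close>.\<close>

lemma alarm_early_le:
  assumes x0: "x0 \<in> space M" and gc: "gc_time A \<in> measurable (seqM M) (count_space UNIV)"
    and far: "FAR M f0 (GCuSum f0 f \<Theta> A) \<le> ennreal \<alpha>" and \<alpha>: "0 < \<alpha>"
  shows "emeasure (no_change M f0) {v\<in>space (seqM M). gc_time A (case_nat x0 v) \<le> enat n} \<le> ennreal (real n * \<alpha>)"
proof -
  let ?e = "\<integral>\<^sup>+v. alarm x0 A v \<partial>no_change M f0"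
  let ?p = "emeasure (no_change M f0) {v\<in>space (seqM M). gc_time A (case_nat x0 v) \<le> enat n}"
  have id: "(\<lambda>x::ennreal. x) \<in> borel_measurable borel" by simp
  have "FAR M f0 (GCuSum f0 f \<Theta> A) = 1 / ?e"
    using gc_time_integral[OF density_f0 x0 gc id] by (simp add: FAR_def GCuSum_def Let_def change_at_same)
  with far have le: "1 / ?e \<le> ennreal \<alpha>" by simp
  then have e0: "?e \<noteq> 0" by (auto simp: top_unique)
  have "1 \<le> ennreal \<alpha> * ?e"
  proof (cases "?e = top")
    case True
    then show ?thesis using \<alpha> by (simp add: ennreal_mult_top)
  next
    case False
    then have "1 = (1 / ?e) * ?e" using e0 by (simp add: ennreal_divide_times less_top)
    also have "\<dots> \<le> ennreal \<alpha> * ?e" by (rule mult_right_mono[OF le]) simp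
    finally show ?thesis .
  qed
  then have "?p * 1 \<le> ?p * (ennreal \<alpha> * ?e)" by (rule mult_left_mono) simp
  also have "\<dots> = ennreal \<alpha> * (?p * ?e)" by (simp add: ac_simps)
  also have "\<dots> \<le> ennreal \<alpha> * of_nat n"
    by (intro mult_left_mono alarm_early_mult_mean[OF x0 density_f0 gc]) simp
  also have "\<dots> = ennreal (real n * \<alpha>)"
    using \<alpha> by (simp add: ennreal_of_nat_eq_real_of_nat ennreal_mult' mult.commute)
  finally show ?thesis by simp
qed

text \<open>Choose n \<ge> 2 R, then a truncation level at which the n samples contribute at most
  1/4 to the tail term, then \<alpha> so small that the false alarm term contributes at most 1/4. An
  alarm within n samples then has post-change probability at most 1/2, and the mean of the alarm
  time minus 1 is at least n / 2.\<close>

lemma gc_delay_diverges: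
  fixes A :: "real \<Rightarrow> real"
  assumes x0: "x0 \<in> space M" and \<theta>: "\<theta> \<in> \<Theta>"
    and gc: "\<And>\<alpha>. 0 < \<alpha> \<Longrightarrow> \<alpha> \<le> 1 \<Longrightarrow> feasible M f0 \<alpha> 1 (GCuSum f0 f \<Theta> (A \<alpha>))"
  shows "\<forall>\<^sub>F \<alpha> in at_right 0. ennreal R \<le> (\<integral>\<^sup>+v. alarm x0 (A \<alpha>) v - 1 \<partial>no_change M (f \<theta>))"
proof -
  let ?Q = "no_change M (f \<theta>)"
  note q = density_f[OF \<theta>]
  interpret NQ: prob_space ?Q by (rule prob_space_no_change[OF q])
  define n where "n = nat \<lceil>2 * \<bar>R\<bar>\<rceil> + 1"
  have n: "2 * R \<le> real n" "0 < n" unfolding n_def by linarith+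
  have ac: "absolutely_continuous (dens M f0) (dens M (f \<theta>))"
    using model \<theta> by (auto simp: qcd_model_def KL_finite_def)
  let ?b = "\<lambda>k. emeasure (dens M (f \<theta>)) {x\<in>space M. real k * f0 x < f \<theta> x}"
  have "?b \<longlonglongrightarrow> 0" by (rule density_ratio_tail[OF density_f0 q ac])
  then have "\<forall>\<^sub>F k in sequentially. ?b k < ennreal (1 / (4 * real n))"
    by (rule order_tendstoD(2)) (use n in \<open>simp add: ennreal_zero_less_divide ennreal_less_zero_iff\<close>)
  from eventually_happens'[OF sequentially_bot this]
  obtain k where k: "?b k < ennreal (1 / (4 * real n))" ..
  define c where "c = real k"
  \<comment> \<open>The minimum with 1 keeps \<alpha> in the range where feasibility is known; the
    added 1 keeps the denominator positive when \<open>c\<close> is 0.\<close>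
  define \<delta> where "\<delta> = min 1 (1 / (4 * (c ^ n * real n + 1)))"
  have c: "0 \<le> c" by (simp add: c_def)
  then have \<delta>: "0 < \<delta>" unfolding \<delta>_def by (simp add: add_nonneg_pos)
  have "ennreal R \<le> (\<integral>\<^sup>+v. alarm x0 (A \<alpha>) v - 1 \<partial>?Q)" if \<alpha>: "0 < \<alpha>" "\<alpha> < \<delta>" for \<alpha>
  proof -
    have "\<alpha> \<le> 1" using \<alpha> by (simp add: \<delta>_def)
    from gc[OF \<alpha>(1) this]
    have pol: "is_policy M (GCuSum f0 f \<Theta> (A \<alpha>))" and far: "FAR M f0 (GCuSum f0 f \<Theta> (A \<alpha>)) \<le> ennreal \<alpha>"
      by (auto simp: feasible_def)
    note gcm = gc_time_measurable[OF pol]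
    let ?E = "{v\<in>space (seqM M). gc_time (A \<alpha>) (case_nat x0 v) \<le> enat n}"
    have E: "?E \<in> sets (seqM M)" by (rule alarm_early_set[OF x0 gcm])
    have "emeasure ?Q ?E \<le> of_nat n * ?b k + ennreal c ^ n * emeasure (no_change M f0) ?E"
      unfolding c_def
    proof (rule emeasure_no_change_prefix_le[OF density_f0 q _ E])
      fix v v' assume "v \<in> space (seqM M)" "v' \<in> space (seqM M)" "\<And>i. i < n \<Longrightarrow> v i = v' i"
      then show "v \<in> ?E \<longleftrightarrow> v' \<in> ?E" using gc_time_le_cong[of n v v' "A \<alpha>" x0] by simp
    qed simp
    also have "\<dots> \<le> of_nat n * ennreal (1 / (4 * real n)) + ennreal c ^ n * ennreal (real n * \<alpha>)"
      using k alarm_early_le[OF x0 gcm far \<alpha>(1), of n]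
      by (intro add_mono mult_left_mono) (simp_all add: less_imp_le)
    also have "\<dots> = ennreal (1 / 4 + c ^ n * (real n * \<alpha>))"
      using n c \<alpha> by (simp add: ennreal_of_nat_eq_real_of_nat ennreal_power flip: ennreal_mult ennreal_plus)
    also have "\<dots> \<le> ennreal (1 / 2)"
    proof (rule ennreal_leI)
      have "c ^ n * real n * \<alpha> \<le> (c ^ n * real n + 1) * (1 / (4 * (c ^ n * real n + 1)))"
        using \<alpha> c by (intro mult_mono) (auto simp: \<delta>_def)
      also have "\<dots> = 1 / 4"
        using c by (simp add: add_nonneg_eq_0_iff)
      finally show "1 / 4 + c ^ n * (real n * \<alpha>) \<le> 1 / 2" by (simp add: mult.assoc)
    qed
    finally have "emeasure ?Q ?E \<le> ennreal (1 / 2)" .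
    then have "measure ?Q ?E \<le> 1 / 2"
      unfolding NQ.emeasure_eq_measure by (subst (asm) ennreal_le_iff) simp_all
    then have "1 / 2 \<le> measure ?Q (space ?Q - ?E)"
      using E by (subst NQ.prob_compl) simp_all
    then have "real n * (1 / 2) \<le> real n * measure ?Q (space ?Q - ?E)"
      by (rule mult_left_mono) simp
    then have "ennreal R \<le> ennreal (real n * measure ?Q (space ?Q - ?E))"
      using n by (intro ennreal_leI) linarith
    also have "\<dots> = of_nat n * emeasure ?Q (space ?Q - ?E)"
      by (simp add: NQ.emeasure_eq_measure ennreal_mult ennreal_of_nat_eq_real_of_nat)
    also have "\<dots> = (\<integral>\<^sup>+v. of_nat n * indicator (space ?Q - ?E) v \<partial>?Q)"
      using E by (subst nn_integral_cmult_indicator) auto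
    also have "\<dots> \<le> (\<integral>\<^sup>+v. alarm x0 (A \<alpha>) v - 1 \<partial>?Q)"
    proof (rule nn_integral_mono)
      fix v
      show "of_nat n * indicator (space ?Q - ?E) v \<le> alarm x0 (A \<alpha>) v - 1"
      proof (cases "v \<in> space ?Q - ?E")
        case True
        then have "enat n < gc_time (A \<alpha>) (case_nat x0 v)" by (auto simp: not_le)
        then have "enat (Suc n) \<le> gc_time (A \<alpha>) (case_nat x0 v)"
          by (cases "gc_time (A \<alpha>) (case_nat x0 v)") auto
        then have "ennreal_of_enat (enat (Suc n)) \<le> alarm x0 (A \<alpha>) v"
          unfolding alarm_def by (simp only: ennreal_of_enat_le_iff)
        then have "of_nat (Suc n) - 1 \<le> alarm x0 (A \<alpha>) v - 1"
          by (intro ennreal_minus_mono) simp_all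
        then show ?thesis using True by simp
      qed simp
    qed
    finally show ?thesis .
  qed
  then show ?thesis unfolding eventually_at_right_field using \<delta> by blast
qed

end

section \<open>Asymptotic optimality\<close>

text \<open>The ratio d2 / I2 lies between 1 and (d1 + K) / I1 = (1 + \<epsilon>) (1 + K / d1), and
  the upper bound tends to 1 because d1 diverges. Infinite infima need separate care, since both
  sides are then infinite.\<close>

lemma ratio_tends_to_one:
  fixes d1 d2 I1 I2 :: "'b \<Rightarrow> ennreal" and \<epsilon> :: "'b \<Rightarrow> real" and K :: real
  assumes \<epsilon>: "(\<epsilon> \<longlongrightarrow> 0) F" and d1: "\<forall>\<^sub>F x in F. d1 x = ennreal (1 + \<epsilon> x) * I1 x"
    and diverges: "\<And>R. \<forall>\<^sub>F x in F. ennreal R \<le> d1 x"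
    and le: "\<forall>\<^sub>F x in F. I1 x \<le> I2 x \<and> I2 x \<le> d2 x \<and> d2 x \<le> d1 x + ennreal K" and K: "0 \<le> K"
  shows "\<exists>\<epsilon>'. (\<epsilon>' \<longlongrightarrow> 0) F \<and> (\<forall>\<^sub>F x in F. d2 x = ennreal (1 + \<epsilon>' x) * I2 x)"
proof -
  define \<epsilon>' where "\<epsilon>' x = (if I2 x = top then 0 else enn2real (d2 x) / enn2real (I2 x) - 1)" for x
  define g where "g x = \<bar>(1 + \<epsilon> x) * (1 + K / enn2real (d1 x)) - 1\<bar>" for x
  \<comment> \<open>This makes 1 + \<epsilon> positive, so its conversion to an extended nonnegative
    real loses nothing.\<close>
  have small: "\<forall>\<^sub>F x in F. \<bar>\<epsilon> x\<bar> < 1 / 2"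
    using tendstoD[OF \<epsilon>, of "1 / 2"] by (simp add: dist_real_def)
  have K0: "((\<lambda>x. K / enn2real (d1 x)) \<longlongrightarrow> 0) F"
  proof (rule tendstoI)
    fix e :: real assume e: "0 < e"
    show "\<forall>\<^sub>F x in F. dist (K / enn2real (d1 x)) 0 < e"
      using diverges[of "(K + 1) / e"]
    proof eventually_elim
      case (elim x)
      show ?case
      \<comment> \<open>An infinite \<open>d1 x\<close> has \<open>enn2real\<close> equal to 0, and
        division by 0 gives 0, so that case is immediate.\<close>
      proof (cases "d1 x = top")
        case False
        then have "(K + 1) / e \<le> enn2real (d1 x)"
          using elim enn2real_mono[OF elim] K e by (simp add: less_top)
        then have "K + 1 \<le> e * enn2real (d1 x)" using e by (simp add: field_simps)
        moreover have "0 < enn2real (d1 x)"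
          using \<open>(K + 1) / e \<le> _\<close> K e by (intro less_le_trans[OF _ \<open>(K + 1) / e \<le> _\<close>] divide_pos_pos) auto
        ultimately show ?thesis using K by (simp add: dist_real_def field_simps)
      qed (use e in simp)
    qed
  qed
  have "((\<lambda>x. (1 + \<epsilon> x) * (1 + K / enn2real (d1 x)) - 1) \<longlongrightarrow> (1 + 0) * (1 + 0) - 1) F"
    by (intro tendsto_intros \<epsilon> K0)
  then have g: "(g \<longlongrightarrow> 0) F" unfolding g_def by (intro tendsto_rabs_zero) simp
  have main: "\<forall>\<^sub>F x in F. \<bar>\<epsilon>' x\<bar> \<le> g x \<and> d2 x = ennreal (1 + \<epsilon>' x) * I2 x"
    using d1 le small diverges[of 1]
  proof eventually_elim
    case (elim x)
    then have I12: "I1 x \<le> I2 x" and I2d2: "I2 x \<le> d2 x" and d21: "d2 x \<le> d1 x + ennreal K" by auto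
    show ?case
    proof (cases "I2 x = top")
      case True
      then have "d2 x = top" using I2d2 by (simp add: top_unique)
      then show ?thesis using True by (simp add: \<epsilon>'_def g_def)
    next
      case False
      then have I1: "I1 x < top" using I12 by (auto simp: less_top intro: le_less_trans)
      then have d1f: "d1 x < top" using elim(1) by (simp add: ennreal_mult_less_top)
      then have "d1 x + ennreal K < top" by simp
      with d21 have d2f: "d2 x < top" by (rule le_less_trans)
      define r1 where "r1 = enn2real (d1 x)"
      define r2 where "r2 = enn2real (d2 x)"
      define i1 where "i1 = enn2real (I1 x)"
      define i2 where "i2 = enn2real (I2 x)"
      note r_def = r1_def r2_def i1_def i2_def
      have eqs: "d1 x = ennreal r1" "d2 x = ennreal r2" "I1 x = ennreal i1" "I2 x = ennreal i2"
        using False I1 d1f d2f by (simp_all add: r_def less_top)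
      have nn: "0 \<le> r1" "0 \<le> r2" "0 \<le> i1" "0 \<le> i2" by (simp_all add: r_def)
      have e: "0 < 1 + \<epsilon> x" using elim(3) by linarith
      have "ennreal r1 = ennreal ((1 + \<epsilon> x) * i1)"
        using elim(1) e nn unfolding eqs by (simp add: ennreal_mult)
      then have r1: "r1 = (1 + \<epsilon> x) * i1" using nn e by (simp add: ennreal_inj)
      \<comment> \<open>Divergence with R = 1 excludes a vanishing infimum, so the divisions below
        are genuine.\<close>
      have "1 \<le> r1" using elim(4) nn unfolding eqs by (simp flip: ennreal_1)
      then have i1: "0 < i1" using r1 e nn by (cases "i1 = 0") auto
      have i12: "i1 \<le> i2" and i2r2: "i2 \<le> r2" using I12 I2d2 nn unfolding eqs by simp_all
      have r2: "r2 \<le> r1 + K" using d21 nn K unfolding eqs by (simp flip: ennreal_plus)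
      have eps': "\<epsilon>' x = r2 / i2 - 1" using False by (simp add: \<epsilon>'_def r_def)
      have "0 \<le> \<epsilon>' x" using i12 i2r2 i1 unfolding eps' by (simp add: field_simps)
      moreover have "\<epsilon>' x \<le> (1 + \<epsilon> x) * (1 + K / r1) - 1"
      proof -
        have "r2 / i2 \<le> (r1 + K) / i1"
          using r2 i12 i1 nn K by (intro frac_le) auto
        also have "\<dots> = (1 + \<epsilon> x) * (1 + K / r1)"
        proof -
          have "(t * i1 + K) / i1 = t * (1 + K / (t * i1))" if "0 < t" for t :: real
            using that i1 by (simp add: field_simps)
          from this[OF e] show ?thesis unfolding r1 .
        qed
        finally show ?thesis unfolding eps' by simp
      qed
      ultimately have "\<bar>\<epsilon>' x\<bar> \<le> g x" unfolding g_def r_def(1)[symmetric] by linarith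
      moreover have "d2 x = ennreal (1 + \<epsilon>' x) * I2 x"
      proof -
        have "r2 = (1 + \<epsilon>' x) * i2" using i12 i1 unfolding eps' by simp
        then show ?thesis using \<open>0 \<le> \<epsilon>' x\<close> nn unfolding eqs by (simp add: ennreal_mult)
      qed
      ultimately show ?thesis ..
    qed
  qed
  have "(\<epsilon>' \<longlongrightarrow> 0) F"
    by (rule Lim_null_comparison[OF _ g]) (use main in \<open>eventually_elim, simp\<close>)
  moreover have "\<forall>\<^sub>F x in F. d2 x = ennreal (1 + \<epsilon>' x) * I2 x"
    using main by eventually_elim simp
  ultimately show ?thesis by blast
qed

lemma feasible_mono:
  "feasible M f0 \<alpha> \<beta> \<Phi> \<Longrightarrow> \<beta> \<le> \<beta>' \<Longrightarrow> feasible M f0 \<alpha> \<beta>' \<Phi>"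
  unfolding feasible_def by (auto intro: order_trans ennreal_leI)

context de_setting
begin

text \<open>The delay metric is kept abstract because each problem enters only through a lower bound
  for GCuSum and an upper bound for GDECuSum around the same mean; both bounds are then fed into
  \<open>ratio_tends_to_one\<close>.\<close>

lemma gd_unif_asymp_optimal:
  fixes delay :: "('a \<Rightarrow> real) \<Rightarrow> 'a policy \<Rightarrow> ennreal" and A :: "real \<Rightarrow> real"
  assumes A: "\<And>\<alpha>. 0 < \<alpha> \<Longrightarrow> \<alpha> \<le> 1 \<Longrightarrow> 0 < A \<alpha>"
    and drift: "\<And>\<theta>. \<theta> \<in> \<Theta> \<Longrightarrow> 0 < (\<integral>\<omega>. ln (f \<theta>s (\<omega> 1) / f0 (\<omega> 1)) \<partial>change_at M f0 (f \<theta>) 1)"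
    and x0: "x0 \<in> space M"
    and gc_delay: "\<And>\<theta> a. \<theta> \<in> \<Theta> \<Longrightarrow> gc_time a \<in> measurable (seqM M) (count_space UNIV) \<Longrightarrow>
      (\<integral>\<^sup>+v. alarm x0 a v - 1 \<partial>no_change M (f \<theta>)) \<le> delay (f \<theta>) (GCuSum f0 f \<Theta> a)"
    and gd_delay: "\<And>\<theta> a K. \<theta> \<in> \<Theta> \<Longrightarrow> 0 < a \<Longrightarrow> gc_time a \<in> measurable (seqM M) (count_space UNIV) \<Longrightarrow>
      (\<And>w. - ereal h \<le> w \<Longrightarrow> (\<integral>\<^sup>+v. (SUP i. of_nat (skipped i w v)) \<partial>no_change M (f \<theta>)) \<le> K) \<Longrightarrow>
      delay (f \<theta>) (GDECuSum f0 f \<Theta> \<theta>s \<mu> h a) \<le> (\<integral>\<^sup>+v. alarm x0 a v - 1 \<partial>no_change M (f \<theta>)) + K"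
    and opt: "unif_asymp_optimal M f0 f \<Theta> delay 1 (\<lambda>\<alpha>. GCuSum f0 f \<Theta> (A \<alpha>))"
    and \<beta>: "\<beta> \<le> 1" and pdc: "PDC M f0 S \<le> ennreal \<beta>"
  shows "unif_asymp_optimal M f0 f \<Theta> delay \<beta> (\<lambda>\<alpha>. GDECuSum f0 f \<Theta> \<theta>s \<mu> h (A \<alpha>))"
  unfolding unif_asymp_optimal_def
proof (intro conjI ballI)
  have gc: "feasible M f0 \<alpha> 1 (GCuSum f0 f \<Theta> (A \<alpha>))" if "0 < \<alpha>" "\<alpha> \<le> 1" for \<alpha>
    using opt that by (auto simp: unif_asymp_optimal_def)
  have gd: "feasible M f0 \<alpha> \<beta> (GDECuSum f0 f \<Theta> \<theta>s \<mu> h (A \<alpha>))" if "0 < \<alpha>" "\<alpha> \<le> 1" for \<alpha>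
    by (rule gd_feasible[OF A[OF that] gc[OF that] pdc])
  then show "feasible M f0 \<alpha> \<beta> (GDECuSum f0 f \<Theta> \<theta>s \<mu> h (A \<alpha>))" if "\<alpha> \<in> {0<..1}" for \<alpha>
    using that by simp
  fix \<theta> assume \<theta>: "\<theta> \<in> \<Theta>"
  let ?I = "\<lambda>\<beta> \<alpha>. INF \<Phi>\<in>{\<Phi>. feasible M f0 \<alpha> \<beta> \<Phi>}. delay (f \<theta>) \<Phi>"
  let ?D = "\<lambda>\<alpha>. \<integral>\<^sup>+v. alarm x0 (A \<alpha>) v - 1 \<partial>no_change M (f \<theta>)"
  let ?d1 = "\<lambda>\<alpha>. delay (f \<theta>) (GCuSum f0 f \<Theta> (A \<alpha>))"
  let ?d2 = "\<lambda>\<alpha>. delay (f \<theta>) (GDECuSum f0 f \<Theta> \<theta>s \<mu> h (A \<alpha>))"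
  obtain K :: real where K: "0 \<le> K"
    "\<And>w. - ereal h \<le> w \<Longrightarrow> (\<integral>\<^sup>+v. (SUP i. of_nat (skipped i w v)) \<partial>no_change M (f \<theta>)) \<le> ennreal K"
    using skip_bound[OF \<theta> drift[OF \<theta>]] by metis
  obtain \<epsilon> where \<epsilon>: "(\<epsilon> \<longlongrightarrow> 0) (at_right 0)" "\<forall>\<^sub>F \<alpha> in at_right 0. ?d1 \<alpha> = ennreal (1 + \<epsilon> \<alpha>) * ?I 1 \<alpha>"
    using opt \<theta> unfolding unif_asymp_optimal_def by blast
  have range: "\<forall>\<^sub>F \<alpha> in at_right 0. 0 < \<alpha> \<and> \<alpha> \<le> (1::real)"
    unfolding eventually_at_right_field by (auto intro!: exI[of _ 1])
  have D_le: "?D \<alpha> \<le> ?d1 \<alpha>" if "0 < \<alpha>" "\<alpha> \<le> 1" for \<alpha>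
    by (rule gc_delay[OF \<theta> gc_time_measurable]) (use gc[OF that] in \<open>simp add: feasible_def\<close>)
  show "\<exists>\<epsilon>. (\<epsilon> \<longlongrightarrow> 0) (at_right 0) \<and> (\<forall>\<^sub>F \<alpha> in at_right 0. ?d2 \<alpha> = ennreal (1 + \<epsilon> \<alpha>) * ?I \<beta> \<alpha>)"
  proof (rule ratio_tends_to_one[OF \<epsilon> _ _ K(1)])
    fix R
    have "\<forall>\<^sub>F \<alpha> in at_right 0. ennreal R \<le> ?D \<alpha>"
      by (rule gc_delay_diverges[OF x0 \<theta>]) (rule gc)
    with range show "\<forall>\<^sub>F \<alpha> in at_right 0. ennreal R \<le> ?d1 \<alpha>"
      by eventually_elim (auto intro: order_trans[OF _ D_le])
  next
    show "\<forall>\<^sub>F \<alpha> in at_right 0. ?I 1 \<alpha> \<le> ?I \<beta> \<alpha> \<and> ?I \<beta> \<alpha> \<le> ?d2 \<alpha> \<and> ?d2 \<alpha> \<le> ?d1 \<alpha> + ennreal K"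
      using range
    proof eventually_elim
      case (elim \<alpha>)
      have "?I 1 \<alpha> \<le> ?I \<beta> \<alpha>"
        using \<beta> by (intro INF_superset_mono) (auto intro: feasible_mono)
      moreover have "?I \<beta> \<alpha> \<le> ?d2 \<alpha>"
        using gd elim by (intro INF_lower) simp
      moreover have "?d2 \<alpha> \<le> ?D \<alpha> + ennreal K"
        using elim gc[of \<alpha>] by (intro gd_delay[OF \<theta> A gc_time_measurable K(2)]) (auto simp: feasible_def)
      then have "?d2 \<alpha> \<le> ?d1 \<alpha> + ennreal K"
        by (rule order_trans) (intro add_right_mono D_le; use elim in simp)
      ultimately show ?case by blast
    qed
  qed
qed

end

theorem mainTheorem3:
  fixes M :: "'a measure"
    and f0 :: "'a \<Rightarrow> real"
    and f :: "'t \<Rightarrow> 'a \<Rightarrow> real"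
    and \<Theta> :: "'t set"
    and \<theta>s :: 't
    and A :: "real \<Rightarrow> real"
  assumes model: "qcd_model M f0 f \<Theta>"
    and \<theta>s: "\<theta>s \<in> \<Theta>"
    and drift: "\<And>\<theta>. \<theta> \<in> \<Theta> \<Longrightarrow>
          (\<integral>\<omega>. ln (f \<theta>s (\<omega> 1) / f0 (\<omega> 1)) \<partial>change_at M f0 (f \<theta>) 1)
            = KL M (f \<theta>) f0 - KL M (f \<theta>) (f \<theta>s) \<and>
          KL M (f \<theta>) f0 - KL M (f \<theta>) (f \<theta>s) > 0"
    and thresholds: "\<And>\<alpha>. 0 < \<alpha> \<Longrightarrow> \<alpha> \<le> 1 \<Longrightarrow> 0 < A \<alpha>"
  shows "(unif_asymp_optimal M f0 f \<Theta> (CADD M f0) 1 (\<lambda>\<alpha>. GCuSum f0 f \<Theta> (A \<alpha>)) \<longrightarrow>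
            (\<forall>\<beta> \<mu> h. 0 \<le> \<beta> \<and> \<beta> \<le> 1 \<and> 0 < \<mu> \<and> 0 \<le> h \<and>
               PDC M f0 (de_control f0 (f \<theta>s) \<mu> h) \<le> ennreal \<beta> \<longrightarrow>
               unif_asymp_optimal M f0 f \<Theta> (CADD M f0) \<beta> (\<lambda>\<alpha>. GDECuSum f0 f \<Theta> \<theta>s \<mu> h (A \<alpha>)))) \<and>
         (unif_asymp_optimal M f0 f \<Theta> (WADD M f0) 1 (\<lambda>\<alpha>. GCuSum f0 f \<Theta> (A \<alpha>)) \<longrightarrow>
            (\<forall>\<beta> \<mu> h. 0 \<le> \<beta> \<and> \<beta> \<le> 1 \<and> 0 < \<mu> \<and> 0 \<le> h \<and>
               PDC M f0 (de_control f0 (f \<theta>s) \<mu> h) \<le> ennreal \<beta> \<longrightarrow>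
               unif_asymp_optimal M f0 f \<Theta> (WADD M f0) \<beta> (\<lambda>\<alpha>. GDECuSum f0 f \<Theta> \<theta>s \<mu> h (A \<alpha>))))"
proof (intro conjI impI allI; elim conjE)
  fix \<beta> \<mu> h :: real
  assume opt: "unif_asymp_optimal M f0 f \<Theta> (CADD M f0) 1 (\<lambda>\<alpha>. GCuSum f0 f \<Theta> (A \<alpha>))"
    and "0 < \<mu>" "0 \<le> h" and \<beta>: "\<beta> \<le> 1" "PDC M f0 (de_control f0 (f \<theta>s) \<mu> h) \<le> ennreal \<beta>"
  then interpret de_setting M f0 f \<Theta> \<theta>s \<mu> h
    by unfold_locales (use model \<theta>s in auto)
  obtain x0 where x0: "x0 \<in> space M" by (rule space_M_nonempty)
  show "unif_asymp_optimal M f0 f \<Theta> (CADD M f0) \<beta> (\<lambda>\<alpha>. GDECuSum f0 f \<Theta> \<theta>s \<mu> h (A \<alpha>))"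
    by (rule gd_unif_asymp_optimal[OF thresholds _ x0 gc_delay_ge(1)[OF x0 density_f]
          gd_delay_le(1)[OF _ x0 density_f] opt \<beta>]) (use drift in auto)
next
  fix \<beta> \<mu> h :: real
  assume opt: "unif_asymp_optimal M f0 f \<Theta> (WADD M f0) 1 (\<lambda>\<alpha>. GCuSum f0 f \<Theta> (A \<alpha>))"
    and "0 < \<mu>" "0 \<le> h" and \<beta>: "\<beta> \<le> 1" "PDC M f0 (de_control f0 (f \<theta>s) \<mu> h) \<le> ennreal \<beta>"
  then interpret de_setting M f0 f \<Theta> \<theta>s \<mu> h
    by unfold_locales (use model \<theta>s in auto)
  obtain x0 where x0: "x0 \<in> space M" by (rule space_M_nonempty)
  show "unif_asymp_optimal M f0 f \<Theta> (WADD M f0) \<beta> (\<lambda>\<alpha>. GDECuSum f0 f \<Theta> \<theta>s \<mu> h (A \<alpha>))"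
    by (rule gd_unif_asymp_optimal[OF thresholds _ x0 gc_delay_ge(2)[OF x0 density_f]
          gd_delay_le(2)[OF _ x0 density_f] opt \<beta>]) (use drift in auto)
qed

end
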